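(* Let $\tilde\gamma=\gamma\otimes\mu$ be a character of $S(V_{\mathbb C})\otimes\mathbb C T$, with $\gamma\in V_{\mathbb C}^*$ and $\mu\in T^\vee$, and let $i$, $\sigma$, $R_i^+$ be attached to $\mu$ as in the context. For $\nu\in V_{\mathbb C}^*$ put $P_i(\nu)=\{\alpha\in R_i^+:\nu(\alpha)=\pm 2k\}$. The following assertions are equivalent: (i) $M(\tilde\gamma)$ is a simple $\mathbb H_B$-module; (ii) $M({}^{w}\tilde\gamma)$ is a simple $\mathbb H_B$-module for every $w\in W_A$; (iii) $P_i({}^{\sigma}\gamma)=\emptyset$.
   Context: Let $n\ge 2$ and let $V$ be a real Euclidean space with orthonormal basis $\epsilon_1,\dots,\epsilon_n$; $V_{\mathbb C}$ is its complexification, $V_{\mathbb C}^*$ the dual of $V_{\mathbb C}$, $S(V_{\mathbb C})$ the symmetric algebra. Let $R_B=\{\pm\epsilon_i\pm\epsilon_j\ (i<j),\ \pm\epsilon_l\}$ be the root system of type $B_n$, with Weyl group $W_B\subset GL(V)$. For a root $\alpha$, $s_\alpha$ is the reflection and $\alpha^\vee\in V^*$ the coroot, so $s_\alpha(v)=v-\langle\alpha^\vee,v\rangle\alpha$. Put $\alpha_{i,j}=\epsilon_i-\epsilon_j$, $R_A=\{\alpha_{i,j}:i\ne j\}$, $R_A^+=\{\alpha_{i,j}:i<j\}$, $S_A=\{\alpha_i=\epsilon_i-\epsilon_{i+1}:1\le i\le n-1\}$; $W_A\cong\mathfrak S_n$ is the Weyl group of $R_A$ (permuting the $\epsilon_i$),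 and $T\cong\{\pm1\}^n$ is the subgroup of $W_B$ generated by the $s_{\epsilon_i}$; $W_B=T\rtimes W_A$. Let $t_w$ ($w\in W_B$) be the standard basis of $\mathbb C W_B$, $t_i=t_{s_{\epsilon_i}}$. Fix $k\in\mathbb C$, $k\neq0$, and put $\tilde k_{\alpha_{i,j}}=k(1+t_it_j)\in\mathbb C T$ for $i\neq j$. $\mathbb H_B$ is the unital associative $\mathbb C$-algebra generated by $S(V_{\mathbb C})$ and $\mathbb C W_B$ (each with its own multiplication) subject to: $t_x\zeta=\zeta t_x$ for $x\in T$, $\zeta\in V$; and $t_{s_\alpha}\zeta=s_\alpha(\zeta)t_{s_\alpha}+\langle\alpha^\vee,s_\alpha(\zeta)\rangle\tilde k_\alpha$ for $\alpha\in S_A$, $\zeta\in V$. $T^\vee$ is the group of characters of $T$, extended linearly to $\mathbb C T$. For $w\in W_A$: ${}^w\mu(x)=\mu(w^{-1}xw)$ for $\mu\in T^\vee$, $x\in T$; ${}^w\gamma(\zeta)=\gamma(w^{-1}(\zeta))$ for $\gamma\in V_{\mathbb C}^*$; and ${}^w(\gamma\otimes\mu)={}^w\gamma\otimes{}^w\mu$. Each $\gamma\otimes\mu$ is a character of the commutative subalgebra $S(V_{\mathbb C})\otimes\mathbb C T$ of $\mathbb H_B$. For $\tilde\gamma=\gamma\otimes\mu$, $\mathbb C v_{\tilde\gamma}$ is the corresponding one-dimensional module and the principal series module is $M(\tilde\gamma)=\mathbb H_B\otimes_{S(V_{\mathbb C})\otimes\mathbb C T}\mathbb C v_{\tilde\gamma}$.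 Given $\mu\in T^\vee$, let $i$ be the number of $j$ with $\mu(t_j)=1$; write $j_1<\dots<j_i$ for the indices with $\mu(t_j)=1$ and $j_{i+1}<\dots<j_n$ for those with $\mu(t_j)=-1$. Let $\sigma\in W_A$ be the element with $\sigma(\epsilon_{j_p})=\epsilon_p$ for all $p$. Let $R_i=\{\pm\alpha_{p,q}: 1\le p<q\le i \text{ or } i<p<q\le n\}$ (type $A_{i-1}\times A_{n-i-1}$) and $R_i^+=R_i\cap R_A^+$. *)

theory Defs
  imports "HOL-Analysis.Analysis" "HOL-Algebra.Algebra" "HOL-Algebra.Algebraic_Closure_Type"
begin

section \<open>Modules over noncommutative rings and balanced tensor products\<close>

text \<open>The locale \<^locale>\<open>module\<close> requires a commutative ring of scalars. Only the additive
  structure and the scalar multiplication of the record \<open>M\<close> matter below.\<close>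

locale left_module = R?: ring R + M?: abelian_group M
  for R :: "('a, 'm) ring_scheme" (structure) and M :: "('a, 'b, 'n) module_scheme" (structure) +
  assumes smult_closed [simp, intro]:
      "\<lbrakk>a \<in> carrier R; x \<in> carrier M\<rbrakk> \<Longrightarrow> a \<odot>\<^bsub>M\<^esub> x \<in> carrier M"
    and smult_l_distr:
      "\<lbrakk>a \<in> carrier R; b \<in> carrier R; x \<in> carrier M\<rbrakk> \<Longrightarrow>
        (a \<oplus>\<^bsub>R\<^esub> b) \<odot>\<^bsub>M\<^esub> x = (a \<odot>\<^bsub>M\<^esub> x) \<oplus>\<^bsub>M\<^esub> (b \<odot>\<^bsub>M\<^esub> x)"
    and smult_r_distr:
      "\<lbrakk>a \<in> carrier R; x \<in> carrier M; y \<in> carrier M\<rbrakk> \<Longrightarrow>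
        a \<odot>\<^bsub>M\<^esub> (x \<oplus>\<^bsub>M\<^esub> y) = (a \<odot>\<^bsub>M\<^esub> x) \<oplus>\<^bsub>M\<^esub> (a \<odot>\<^bsub>M\<^esub> y)"
    and smult_assoc1:
      "\<lbrakk>a \<in> carrier R; b \<in> carrier R; x \<in> carrier M\<rbrakk> \<Longrightarrow>
        (a \<otimes>\<^bsub>R\<^esub> b) \<odot>\<^bsub>M\<^esub> x = a \<odot>\<^bsub>M\<^esub> (b \<odot>\<^bsub>M\<^esub> x)"
    and smult_one [simp]: "x \<in> carrier M \<Longrightarrow> \<one>\<^bsub>R\<^esub> \<odot>\<^bsub>M\<^esub> x = x"

definition simple_module :: "('a, 'm) ring_scheme \<Rightarrow> ('a, 'b, 'n) module_scheme \<Rightarrow> bool" where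
  "simple_module R M \<longleftrightarrow> left_module R M \<and> carrier M \<noteq> {\<zero>\<^bsub>M\<^esub>} \<and>
     (\<forall>N. submodule N R M \<longrightarrow> N = {\<zero>\<^bsub>M\<^esub>} \<or> N = carrier M)"

definition balanced_rels ::
  "('a, 'm) ring_scheme \<Rightarrow> 'a set \<Rightarrow> ('a, 'b, 'n) module_scheme \<Rightarrow> ('a \<times> 'b \<Rightarrow>\<^sub>0 int) set" where
  "balanced_rels H A N =
     {frag_of (x \<oplus>\<^bsub>H\<^esub> y, z) - frag_of (x, z) - frag_of (y, z) | x y z.
        x \<in> carrier H \<and> y \<in> carrier H \<and> z \<in> carrier N} \<union>
     {frag_of (x, y \<oplus>\<^bsub>N\<^esub> z) - frag_of (x, y) - frag_of (x, z) | x y z.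
        x \<in> carrier H \<and> y \<in> carrier N \<and> z \<in> carrier N} \<union>
     {frag_of (x \<otimes>\<^bsub>H\<^esub> a, z) - frag_of (x, a \<odot>\<^bsub>N\<^esub> z) | x a z.
        x \<in> carrier H \<and> a \<in> A \<and> z \<in> carrier N}"

definition balanced_subgroup ::
  "('a, 'm) ring_scheme \<Rightarrow> 'a set \<Rightarrow> ('a, 'b, 'n) module_scheme \<Rightarrow> ('a \<times> 'b \<Rightarrow>\<^sub>0 int) set" where
  "balanced_subgroup H A N =
     generate (free_Abelian_group (carrier H \<times> carrier N)) (balanced_rels H A N)"

text \<open>The left \<open>H\<close>-module \<open>H \<otimes>\<^sub>A N\<close> for a subring \<open>A\<close> of \<open>H\<close> and a left \<open>A\<close>-module \<open>N\<close>: the free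
  abelian group on \<open>H \<times> N\<close> modulo the balancing relations. As for products of cosets in the
  library, the image of a coset is written as a union over all its representatives.\<close>

definition induced_module ::
  "('a, 'm) ring_scheme \<Rightarrow> 'a set \<Rightarrow> ('a, 'b, 'n) module_scheme \<Rightarrow>
     ('a, ('a \<times> 'b \<Rightarrow>\<^sub>0 int) set) module" where
  "induced_module H A N =
     (let F = free_Abelian_group (carrier H \<times> carrier N); K = balanced_subgroup H A N in
      \<lparr>carrier = carrier (F Mod K), monoid.mult = undefined, one = undefined,
       ring.zero = \<one>\<^bsub>F Mod K\<^esub>, add = monoid.mult (F Mod K),
       smult = (\<lambda>h Y. \<Union>c\<in>Y. K #>\<^bsub>F\<^esub> frag_extend (\<lambda>(x, z). frag_of (h \<otimes>\<^bsub>H\<^esub> x, z)) c)\<rparr>)"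


section \<open>Free associative algebras\<close>

datatype 'g word = Word (letters: "'g list")

instantiation word :: (type) monoid_add
begin
definition zero_word :: "'a word" where "zero_word = Word []"
definition plus_word :: "'a word \<Rightarrow> 'a word \<Rightarrow> 'a word"
  where "plus_word u v = Word (letters u @ letters v)"
instance by standard (simp_all add: zero_word_def plus_word_def)
end

text \<open>Since addition of words is concatenation, the convolution product of finitely supported
  functions is the product of noncommutative polynomials.\<close>

type_synonym 'g ncpoly = "'g word \<Rightarrow>\<^sub>0 complex"

definition free_algebra :: "'g set \<Rightarrow> 'g ncpoly ring" where
  "free_algebra G = \<lparr>carrier = {p. \<forall>u\<in>Poly_Mapping.keys p. letters u \<in> lists G},
     monoid.mult = (*), one = 1, ring.zero = 0, add = (+)\<rparr>"

definition scalar :: "complex \<Rightarrow> 'g ncpoly" where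
  "scalar c = Poly_Mapping.single 0 c"

definition gen :: "'g \<Rightarrow> 'g ncpoly" where
  "gen g = Poly_Mapping.single (Word [g]) 1"

lemma ring_free_algebra: "ring (free_algebra G)"
proof -
  let ?C = "{p :: 'a ncpoly. \<forall>u\<in>Poly_Mapping.keys p. letters u \<in> lists G}"
  have mult: "p * q \<in> ?C" if p: "p \<in> ?C" and q: "q \<in> ?C" for p q
  proof -
    have "letters u \<in> lists G" if u: "u \<in> Poly_Mapping.keys (p * q)" for u
    proof -
      obtain a b where "u = a + b" "a \<in> Poly_Mapping.keys p" "b \<in> Poly_Mapping.keys q"
        using keys_mult[of p q] u by blast
      then show ?thesis
        using p q by (auto simp: plus_word_def)
    qed
    then show ?thesis by simp
  qed
  have add: "p + q \<in> ?C" if "p \<in> ?C" "q \<in> ?C" for p q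
    using that Poly_Mapping.keys_add[of p q] by blast
  have one: "1 \<in> ?C"
    by (simp add: zero_word_def)
  have neg: "- p \<in> ?C" if "p \<in> ?C" for p
    using that by simp
  have "abelian_group (free_algebra G)"
  proof (rule abelian_groupI)
    fix x assume "x \<in> carrier (free_algebra G)"
    then have "- x \<in> carrier (free_algebra G)"
      using neg by (simp add: free_algebra_def)
    then show "\<exists>y\<in>carrier (free_algebra G). y \<oplus>\<^bsub>free_algebra G\<^esub> x = \<zero>\<^bsub>free_algebra G\<^esub>"
      by (rule bexI[rotated]) (simp add: free_algebra_def)
  next
    fix x y assume "x \<in> carrier (free_algebra G)" "y \<in> carrier (free_algebra G)"
    then show "x \<oplus>\<^bsub>free_algebra G\<^esub> y \<in> carrier (free_algebra G)"
      using add[of x y] by (simp add: free_algebra_def)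
  qed (simp_all add: free_algebra_def ac_simps)
  moreover have "Group.monoid (free_algebra G)"
  proof (rule monoidI)
    fix x y assume "x \<in> carrier (free_algebra G)" "y \<in> carrier (free_algebra G)"
    then show "x \<otimes>\<^bsub>free_algebra G\<^esub> y \<in> carrier (free_algebra G)"
      using mult[of x y] by (simp add: free_algebra_def)
  next
    show "\<one>\<^bsub>free_algebra G\<^esub> \<in> carrier (free_algebra G)"
      using one by (simp add: free_algebra_def)
  qed (simp_all add: free_algebra_def mult.assoc)
  ultimately show ?thesis
    by (rule ringI) (simp_all add: free_algebra_def distrib_left distrib_right)
qed


section \<open>The root system of type B and its Weyl group\<close>

definition orthonormal_basis :: "nat \<Rightarrow> (nat \<Rightarrow> 'v::euclidean_space) \<Rightarrow> bool" where
  "orthonormal_basis n \<epsilon> \<longleftrightarrow>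
     (\<forall>i\<in>{1..n}. \<forall>j\<in>{1..n}. inner (\<epsilon> i) (\<epsilon> j) = (if i = j then 1 else 0)) \<and>
     Real_Vector_Spaces.span (\<epsilon> ` {1..n}) = UNIV"

definition coroot :: "'v::euclidean_space \<Rightarrow> 'v \<Rightarrow> real" where
  "coroot \<alpha> v = 2 * inner \<alpha> v / inner \<alpha> \<alpha>"

definition reflection :: "'v::euclidean_space \<Rightarrow> 'v \<Rightarrow> 'v" where
  "reflection \<alpha> v = v - coroot \<alpha> v *\<^sub>R \<alpha>"

definition rootA :: "(nat \<Rightarrow> 'v::euclidean_space) \<Rightarrow> nat \<Rightarrow> nat \<Rightarrow> 'v" where
  "rootA \<epsilon> i j = \<epsilon> i - \<epsilon> j"

definition R_B :: "nat \<Rightarrow> (nat \<Rightarrow> 'v::euclidean_space) \<Rightarrow> 'v set" where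
  "R_B n \<epsilon> =
     {a *\<^sub>R \<epsilon> i + b *\<^sub>R \<epsilon> j | a b i j. a \<in> {1, -1} \<and> b \<in> {1, -1} \<and> 1 \<le> i \<and> i < j \<and> j \<le> n} \<union>
     {a *\<^sub>R \<epsilon> l | a l. a \<in> {1, -1} \<and> l \<in> {1..n}}"

definition R_A :: "nat \<Rightarrow> (nat \<Rightarrow> 'v::euclidean_space) \<Rightarrow> 'v set" where
  "R_A n \<epsilon> = {rootA \<epsilon> i j | i j. i \<in> {1..n} \<and> j \<in> {1..n} \<and> i \<noteq> j}"

definition R_A_pos :: "nat \<Rightarrow> (nat \<Rightarrow> 'v::euclidean_space) \<Rightarrow> 'v set" where
  "R_A_pos n \<epsilon> = {rootA \<epsilon> i j | i j. i \<in> {1..n} \<and> j \<in> {1..n} \<and> i < j}"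

definition GL_group :: "('v::euclidean_space \<Rightarrow> 'v) monoid" where
  "GL_group = \<lparr>carrier = {f. Real_Vector_Spaces.linear f \<and> bij f}, monoid.mult = (\<circ>), one = id\<rparr>"

definition W_B :: "nat \<Rightarrow> (nat \<Rightarrow> 'v::euclidean_space) \<Rightarrow> ('v \<Rightarrow> 'v) set" where
  "W_B n \<epsilon> = generate GL_group (reflection ` R_B n \<epsilon>)"

definition W_A :: "nat \<Rightarrow> (nat \<Rightarrow> 'v::euclidean_space) \<Rightarrow> ('v \<Rightarrow> 'v) set" where
  "W_A n \<epsilon> = generate GL_group (reflection ` R_A n \<epsilon>)"

definition T_grp :: "nat \<Rightarrow> (nat \<Rightarrow> 'v::euclidean_space) \<Rightarrow> ('v \<Rightarrow> 'v) set" where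
  "T_grp n \<epsilon> = generate GL_group (reflection ` (\<epsilon> ` {1..n}))"


section \<open>The complexification\<close>

text \<open>The complexification is modelled on pairs, \<open>(a, b)\<close> standing for \<open>a + \<i> b\<close>.\<close>

type_synonym 'v complexified = "'v \<times> 'v"

definition scaleC :: "complex \<Rightarrow> 'v::real_vector complexified \<Rightarrow> 'v complexified" where
  "scaleC c p = (Re c *\<^sub>R fst p - Im c *\<^sub>R snd p, Re c *\<^sub>R snd p + Im c *\<^sub>R fst p)"

definition of_V :: "'v::real_vector \<Rightarrow> 'v complexified" where
  "of_V v = (v, 0)"

definition complexify :: "('v \<Rightarrow> 'v) \<Rightarrow> 'v complexified \<Rightarrow> 'v complexified" where
  "complexify f = map_prod f f"

definition dual_VC :: "('v::euclidean_space complexified \<Rightarrow> complex) set" where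
  "dual_VC = {\<gamma>. Vector_Spaces.linear scaleC (*) \<gamma>}"

lemma vector_space_scaleC: "vector_space (scaleC :: complex \<Rightarrow> 'v::real_vector complexified \<Rightarrow> _)"
  by standard (auto simp: scaleC_def algebra_simps)


section \<open>The algebra\<close>

datatype 'v hgen = Vec "'v complexified" | Grp "'v \<Rightarrow> 'v"

definition hecke_gens :: "nat \<Rightarrow> (nat \<Rightarrow> 'v::euclidean_space) \<Rightarrow> 'v hgen set" where
  "hecke_gens n \<epsilon> = range Vec \<union> Grp ` W_B n \<epsilon>"

abbreviation vgen :: "'v complexified \<Rightarrow> 'v hgen ncpoly" where
  "vgen \<zeta> \<equiv> gen (Vec \<zeta>)"

abbreviation tgen :: "('v \<Rightarrow> 'v) \<Rightarrow> 'v hgen ncpoly" where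
  "tgen w \<equiv> gen (Grp w)"

text \<open>Relations presenting the symmetric algebra of the complexification, i.e. its tensor algebra
  modulo commutators.\<close>

definition sym_rels :: "'v::euclidean_space hgen ncpoly set" where
  "sym_rels =
     {vgen (u + v) - (vgen u + vgen v) | u v. True} \<union>
     {vgen (scaleC c u) - scalar c * vgen u | c u. True} \<union>
     {vgen u * vgen v - vgen v * vgen u | u v. True}"

definition group_rels :: "('v \<Rightarrow> 'v) set \<Rightarrow> 'v hgen ncpoly set" where
  "group_rels W = {tgen x * tgen y - tgen (x \<circ> y) | x y. x \<in> W \<and> y \<in> W} \<union> {tgen id - 1}"

definition k_tilde ::
  "(nat \<Rightarrow> 'v::euclidean_space) \<Rightarrow> complex \<Rightarrow> nat \<Rightarrow> nat \<Rightarrow> 'v hgen ncpoly" where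
  "k_tilde \<epsilon> k i j = scalar k * (1 + tgen (reflection (\<epsilon> i)) * tgen (reflection (\<epsilon> j)))"

definition cross_rels ::
  "nat \<Rightarrow> (nat \<Rightarrow> 'v::euclidean_space) \<Rightarrow> complex \<Rightarrow> 'v hgen ncpoly set" where
  "cross_rels n \<epsilon> k =
     {tgen x * vgen (of_V \<zeta>) - vgen (of_V \<zeta>) * tgen x | x \<zeta>. x \<in> T_grp n \<epsilon>} \<union>
     {tgen s * vgen (of_V \<zeta>) -
        (vgen (of_V (s \<zeta>)) * tgen s + scalar (complex_of_real (coroot \<alpha> (s \<zeta>))) * k_tilde \<epsilon> k i (i + 1))
      | i \<alpha> s \<zeta>. 1 \<le> i \<and> i < n \<and> \<alpha> = rootA \<epsilon> i (i + 1) \<and> s = reflection \<alpha>}"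

definition hecke_ideal ::
  "nat \<Rightarrow> (nat \<Rightarrow> 'v::euclidean_space) \<Rightarrow> complex \<Rightarrow> 'v hgen ncpoly set" where
  "hecke_ideal n \<epsilon> k =
     genideal (free_algebra (hecke_gens n \<epsilon>)) (sym_rels \<union> group_rels (W_B n \<epsilon>) \<union> cross_rels n \<epsilon> k)"

definition H_B ::
  "nat \<Rightarrow> (nat \<Rightarrow> 'v::euclidean_space) \<Rightarrow> complex \<Rightarrow> 'v hgen ncpoly set ring" where
  "H_B n \<epsilon> k = free_algebra (hecke_gens n \<epsilon>) Quot hecke_ideal n \<epsilon> k"

definition hecke_class ::
  "nat \<Rightarrow> (nat \<Rightarrow> 'v::euclidean_space) \<Rightarrow> complex \<Rightarrow> 'v hgen ncpoly \<Rightarrow> 'v hgen ncpoly set" where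
  "hecke_class n \<epsilon> k p = hecke_ideal n \<epsilon> k +>\<^bsub>free_algebra (hecke_gens n \<epsilon>)\<^esub> p"

text \<open>The commutative subalgebra \<open>S(V\<^sub>C) \<otimes> \<complex>T\<close>, as the subalgebra generated by \<open>V\<^sub>C\<close> and \<open>T\<close>.\<close>

definition SCT ::
  "nat \<Rightarrow> (nat \<Rightarrow> 'v::euclidean_space) \<Rightarrow> complex \<Rightarrow> 'v hgen ncpoly set set" where
  "SCT n \<epsilon> k = generate_ring (H_B n \<epsilon> k)
     (hecke_class n \<epsilon> k ` (range scalar \<union> range vgen \<union> tgen ` T_grp n \<epsilon>))"


section \<open>Characters and principal series\<close>

definition T_dual :: "nat \<Rightarrow> (nat \<Rightarrow> 'v::euclidean_space) \<Rightarrow> (('v \<Rightarrow> 'v) \<Rightarrow> complex) set" where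
  "T_dual n \<epsilon> = hom (GL_group\<lparr>carrier := T_grp n \<epsilon>\<rparr>) \<lparr>carrier = - {0}, monoid.mult = (*), one = 1\<rparr>"

text \<open>The algebra character \<open>\<gamma> \<otimes> \<mu>\<close> of \<open>S(V\<^sub>C) \<otimes> \<complex>T\<close>.\<close>

definition tensor_char ::
  "nat \<Rightarrow> (nat \<Rightarrow> 'v::euclidean_space) \<Rightarrow> complex \<Rightarrow> ('v complexified \<Rightarrow> complex) \<Rightarrow>
     (('v \<Rightarrow> 'v) \<Rightarrow> complex) \<Rightarrow> 'v hgen ncpoly set \<Rightarrow> complex" where
  "tensor_char n \<epsilon> k \<gamma> \<mu> = (THE \<psi>.
     \<psi> \<in> ring_hom (H_B n \<epsilon> k\<lparr>carrier := SCT n \<epsilon> k\<rparr>) ring_of_type_algebra \<and>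
     \<psi> \<in> extensional (SCT n \<epsilon> k) \<and>
     (\<forall>c. \<psi> (hecke_class n \<epsilon> k (scalar c)) = c) \<and>
     (\<forall>\<zeta>. \<psi> (hecke_class n \<epsilon> k (vgen \<zeta>)) = \<gamma> \<zeta>) \<and>
     (\<forall>x\<in>T_grp n \<epsilon>. \<psi> (hecke_class n \<epsilon> k (tgen x)) = \<mu> x))"

definition one_dim_module :: "('a \<Rightarrow> complex) \<Rightarrow> ('a, complex) module" where
  "one_dim_module \<psi> =
     \<lparr>carrier = UNIV, monoid.mult = (*), one = 1, ring.zero = 0, add = (+), smult = (\<lambda>a z. \<psi> a * z)\<rparr>"

definition principal_series ::
  "nat \<Rightarrow> (nat \<Rightarrow> 'v::euclidean_space) \<Rightarrow> complex \<Rightarrow> ('v hgen ncpoly set \<Rightarrow> complex) \<Rightarrow>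
     ('v hgen ncpoly set, ('v hgen ncpoly set \<times> complex \<Rightarrow>\<^sub>0 int) set) module" where
  "principal_series n \<epsilon> k \<psi> = induced_module (H_B n \<epsilon> k) (SCT n \<epsilon> k) (one_dim_module \<psi>)"

definition twist_T :: "('v \<Rightarrow> 'v) \<Rightarrow> (('v \<Rightarrow> 'v) \<Rightarrow> complex) \<Rightarrow> ('v \<Rightarrow> 'v) \<Rightarrow> complex" where
  "twist_T w \<mu> x = \<mu> (inv_into UNIV w \<circ> x \<circ> w)"

definition twist_V ::
  "('v \<Rightarrow> 'v) \<Rightarrow> ('v complexified \<Rightarrow> complex) \<Rightarrow> 'v complexified \<Rightarrow> complex" where
  "twist_V w \<gamma> \<zeta> = \<gamma> (complexify (inv_into UNIV w) \<zeta>)"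


section \<open>The combinatorial data attached to a character of T\<close>

definition plus_inds ::
  "nat \<Rightarrow> (nat \<Rightarrow> 'v::euclidean_space) \<Rightarrow> (('v \<Rightarrow> 'v) \<Rightarrow> complex) \<Rightarrow> nat set" where
  "plus_inds n \<epsilon> \<mu> = {j \<in> {1..n}. \<mu> (reflection (\<epsilon> j)) = 1}"

definition minus_inds ::
  "nat \<Rightarrow> (nat \<Rightarrow> 'v::euclidean_space) \<Rightarrow> (('v \<Rightarrow> 'v) \<Rightarrow> complex) \<Rightarrow> nat set" where
  "minus_inds n \<epsilon> \<mu> = {j \<in> {1..n}. \<mu> (reflection (\<epsilon> j)) = -1}"

text \<open>The list \<open>[j\<^sub>1, \<dots>, j\<^sub>n]\<close>; since list positions start at \<open>0\<close>, \<open>j\<^sub>p\<close> is its entry at \<open>p - 1\<close>.\<close>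

definition sorted_inds ::
  "nat \<Rightarrow> (nat \<Rightarrow> 'v::euclidean_space) \<Rightarrow> (('v \<Rightarrow> 'v) \<Rightarrow> complex) \<Rightarrow> nat list" where
  "sorted_inds n \<epsilon> \<mu> =
     sorted_list_of_set (plus_inds n \<epsilon> \<mu>) @ sorted_list_of_set (minus_inds n \<epsilon> \<mu>)"

definition is_sorting_element ::
  "nat \<Rightarrow> (nat \<Rightarrow> 'v::euclidean_space) \<Rightarrow> (('v \<Rightarrow> 'v) \<Rightarrow> complex) \<Rightarrow> ('v \<Rightarrow> 'v) \<Rightarrow> bool" where
  "is_sorting_element n \<epsilon> \<mu> \<sigma> \<longleftrightarrow>
     \<sigma> \<in> W_A n \<epsilon> \<and> (\<forall>p\<in>{1..n}. \<sigma> (\<epsilon> (sorted_inds n \<epsilon> \<mu> ! (p - 1))) = \<epsilon> p)"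

definition R_sub :: "nat \<Rightarrow> (nat \<Rightarrow> 'v::euclidean_space) \<Rightarrow> nat \<Rightarrow> 'v set" where
  "R_sub n \<epsilon> i =
     {a *\<^sub>R rootA \<epsilon> p q | a p q. a \<in> {1, -1} \<and>
        (1 \<le> p \<and> p < q \<and> q \<le> i \<or> i < p \<and> p < q \<and> q \<le> n)}"

definition P_set ::
  "nat \<Rightarrow> (nat \<Rightarrow> 'v::euclidean_space) \<Rightarrow> complex \<Rightarrow> nat \<Rightarrow> ('v complexified \<Rightarrow> complex) \<Rightarrow> 'v set" where
  "P_set n \<epsilon> k i \<nu> =
     {\<alpha> \<in> R_sub n \<epsilon> i \<inter> R_A_pos n \<epsilon>. \<nu> (of_V \<alpha>) = 2 * k \<or> \<nu> (of_V \<alpha>) = - 2 * k}"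

end

theory Submission
  imports Defs "HOL-Library.Function_Algebras" "HOL-Combinatorics.Permutations"
begin

text \<open>Put \<open>lam j = \<gamma>(\<epsilon>\<^sub>j)\<close> and \<open>nu j =
  \<mu>(t\<^sub>j) = \<plusminus>1\<close>. All three assertions are equivalent to one
  condition, \<open>noncrit\<close>: \<open>(lam a - lam b)\<^sup>2 \<noteq>
  (2k)\<^sup>2\<close> for all \<open>a \<noteq> b\<close> with \<open>nu a = nu b\<close>.
  Twisting by \<open>w \<in> W\<^sub>A\<close> permutes \<open>lam\<close> and \<open>nu\<close>
  simultaneously, so the condition is the same for all twists. The element
  \<open>\<sigma>\<close> moves the indices with \<open>nu = 1\<close> to the front, so that the
  roots in \<open>R\<^sub>i\<^sup>+\<close> are exactly the \<open>\<epsilon>\<^sub>a -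
  \<epsilon>\<^sub>b\<close> with \<open>a < b\<close> and equal signs after sorting
  (\<open>P_set_iff\<close>). What remains is the criterion for a single principal series
  module.

  The principal series has the basis \<open>t\<^sub>w \<otimes> v\<close> with \<open>w \<in>
  W\<^sub>A\<close>. It is identified with the space of functions on the symmetric group, on
  which the generators act by the explicit formulas \<open>Sop\<close>, \<open>Top\<close> and
  \<open>Xop\<close>: the Hecke relations reduce every tensor to a normal form
  (\<open>spanned_all\<close>), and the operators keep the normal forms apart
  (\<open>simple_iff_model\<close>). In what follows \<open>\<kappa>\<close> is the operator
  \<open>k(1 + t\<^sub>a t\<^sub>b)\<close> or its eigenvalue \<open>k(1 + nu a nu b)\<close>,
  which is \<open>2k\<close> or \<open>0\<close>.

  Necessity. Right multiplication by \<open>a s\<^sub>i + b\<close>, for suitable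
  \<open>a\<close> and \<open>b\<close>, is a homomorphism from the module to the one with the
  entries \<open>i\<close> and \<open>i+1\<close> of \<open>lam\<close> and \<open>nu\<close>
  exchanged. If \<open>nu i = nu (i+1)\<close>, its composite with the analogous map back is the
  scalar \<open>\<kappa>\<^sup>2 - (lam i - lam (i+1))\<^sup>2\<close>. On a simple module this
  scalar cannot vanish, for otherwise the kernel would be a proper nonzero submodule. Being
  invertible, the homomorphism carries simplicity over to the permuted parameters
  (\<open>simple_swap\<close>). As every pair of indices becomes adjacent after a permutation,
  the condition follows for all pairs.

  Sufficiency. The operators \<open>x\<^sub>j + c t\<^sub>j\<close> have the same invariant
  subspaces as the \<open>x\<^sub>j\<close> and satisfy the same relations, with
  \<open>lam\<close> replaced by \<open>lam + c nu\<close>. A generic \<open>c\<close> achieves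
  \<open>lam a \<noteq> lam b\<close> whenever \<open>nu a \<noteq> nu b\<close>, so that
  \<open>(lam a - lam b)\<^sup>2 \<noteq> \<kappa>\<^sup>2\<close> holds for all pairs. A
  nonzero invariant subspace then contains the generator \<open>v\<close>, by descent through
  the symmetric groups (\<open>descend\<close>). Take a nonzero element supported on
  permutations of \<open>1..m\<close>, translated so as to involve the coset \<open>s\<^sub>1
  \<dots> s\<^sub>m\<^sub>-\<^sub>1 S\<^sub>m\<^sub>-\<^sub>1\<close>. The polynomial
  \<open>(x\<^sub>1 - lam 1) \<dots> (x\<^sub>1 - lam (m-1))\<close> annihilates the part of the
  element on all other cosets (\<open>Qop_span\<close>), and on this coset it replaces, up to
  sign, the product of the \<open>s\<^sub>i\<close> by the product of the intertwining operators
  \<open>\<tau>\<^sub>i\<close> (\<open>Qop_ss_1\<close>). Applying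
  \<open>\<tau>\<^sub>1\<close>, then \<open>\<tau>\<^sub>2\<close>, and so on up to
  \<open>\<tau>\<^sub>m\<^sub>-\<^sub>1\<close> cancels that product, since
  \<open>\<tau>\<^sub>i\<^sup>2 = \<kappa>\<^sup>2 - (x\<^sub>i -
  x\<^sub>i\<^sub>+\<^sub>1)\<^sup>2\<close>, and leaves a nonzero multiple of an element
  supported on permutations of \<open>1..m-1\<close>.\<close>

section \<open>Operators satisfying the Hecke relations\<close>

abbreviation swp :: "nat \<Rightarrow> nat \<Rightarrow> nat \<Rightarrow> nat" where
  "swp \<equiv> Transposition.transpose"

definition lin :: "(complex \<Rightarrow> 'e \<Rightarrow> 'e) \<Rightarrow> ('e::ab_group_add \<Rightarrow> 'e) \<Rightarrow> bool" where
  "lin cm A \<longleftrightarrow> (\<forall>f g. A (f + g) = A f + A g) \<and> (\<forall>c f. A (cm c f) = cm c (A f))"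

lemma lin_add: "lin cm A \<Longrightarrow> A (f + g) = A f + A g" and lin_cm: "lin cm A \<Longrightarrow> A (cm c f) = cm c (A f)"
  by (auto simp: lin_def)

lemma lin_diff: "lin cm A \<Longrightarrow> A (f - g) = A f - A g"
  by (metis lin_add add_diff_cancel diff_add_cancel)

lemma lin_0: "lin cm A \<Longrightarrow> A 0 = 0"
  using lin_diff[of cm A 0 0] by simp

lemma lin_uminus: "lin cm A \<Longrightarrow> A (- f) = - A f"
  using lin_diff[of cm A 0 f] by (simp add: lin_0)

lemma lin_sum: "lin cm A \<Longrightarrow> A (sum g I) = (\<Sum>i\<in>I. A (g i))"
  by (induction I rule: infinite_finite_induct) (auto simp: lin_0 lin_add)

lemma lin_comp: "lin cm A \<Longrightarrow> lin cm B \<Longrightarrow> lin cm (\<lambda>f. A (B f))"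
  by (simp add: lin_def)

lemma lin_id: "lin cm (\<lambda>f. f)"
  by (simp add: lin_def)

text \<open>Commutativity of the \<open>x\<^sub>j\<close> is left out: in the model it is a
  consequence of the other relations (\<open>x_comm_span\<close>), and checking it directly on
  the explicit operators would be far more laborious.\<close>

locale hecke_cross =
  fixes n :: nat and k :: complex and cm :: "complex \<Rightarrow> 'e::ab_group_add \<Rightarrow> 'e"
    and s t x :: "nat \<Rightarrow> 'e \<Rightarrow> 'e"
  assumes cm_right: "cm c (f + g) = cm c f + cm c g" and cm_left: "cm (c + d) f = cm c f + cm d f"
    and cm_cm [simp]: "cm c (cm d f) = cm (c * d) f" and cm_1 [simp]: "cm 1 f = f"
    and lin_s: "lin cm (s i)" and lin_t: "lin cm (t i)" and lin_x: "lin cm (x i)"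
    and t_t: "t i (t j f) = t j (t i f)"
    and t_sq [simp]: "1 \<le> j \<Longrightarrow> j \<le> n \<Longrightarrow> t j (t j f) = f"
    and t_x: "1 \<le> i \<Longrightarrow> i \<le> n \<Longrightarrow> 1 \<le> j \<Longrightarrow> j \<le> n \<Longrightarrow> t i (x j f) = x j (t i f)"
    and s_s [simp]: "1 \<le> i \<Longrightarrow> i < n \<Longrightarrow> s i (s i f) = f"
    and s_t: "1 \<le> i \<Longrightarrow> i < n \<Longrightarrow> s i (t j f) = t (swp i (Suc i) j) (s i f)"
    and cross1: "1 \<le> i \<Longrightarrow> i < n \<Longrightarrow> s i (x i f) = x (Suc i) (s i f) - cm k (f + t i (t (Suc i) f))"
    and cross3: "1 \<le> i \<Longrightarrow> i < n \<Longrightarrow> 1 \<le> j \<Longrightarrow> j \<le> n \<Longrightarrow> j \<noteq> i \<Longrightarrow> j \<noteq> Suc i \<Longrightarrow>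
      s i (x j f) = x j (s i f)"
begin

lemma lin_cmul: "lin cm (cm c)"
  by (simp add: lin_def cm_right mult.commute)

lemmas lin_rules =
  lin_add[OF lin_s] lin_diff[OF lin_s] lin_cm[OF lin_s] lin_uminus[OF lin_s] lin_0[OF lin_s]
  lin_add[OF lin_t] lin_diff[OF lin_t] lin_cm[OF lin_t] lin_uminus[OF lin_t] lin_0[OF lin_t]
  lin_add[OF lin_x] lin_diff[OF lin_x] lin_cm[OF lin_x] lin_uminus[OF lin_x] lin_0[OF lin_x]
  lin_add[OF lin_cmul] lin_diff[OF lin_cmul] lin_uminus[OF lin_cmul] lin_0[OF lin_cmul]

lemma cm_0 [simp]: "cm 0 f = 0"
  using cm_left[of 0 0 f] by simp

lemma cm_minus: "cm (- c) f = - cm c f"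
  using cm_left[of c "- c" f] by (simp add: eq_neg_iff_add_eq_0 add.commute)

lemma cm_diff: "cm (c - d) f = cm c f - cm d f"
  using cm_left[of c "- d" f] by (simp add: cm_minus)

text \<open>The action of the parameter \<open>k(1 + t\<^sub>i t\<^sub>j)\<close> in
  \<open>\<complex>T\<close>.\<close>

definition kap :: "nat \<Rightarrow> nat \<Rightarrow> 'e \<Rightarrow> 'e" where
  "kap i j f = cm k (f + t i (t j f))"

lemma kap_lin: "kap i j (f + g) = kap i j f + kap i j g" "kap i j (f - g) = kap i j f - kap i j g"
  "kap i j (- f) = - kap i j f" "kap i j (cm c f) = cm c (kap i j f)" "kap i j 0 = 0"
  by (simp_all add: kap_def lin_rules algebra_simps)

lemma kap_x: "1 \<le> i \<Longrightarrow> i \<le> n \<Longrightarrow> 1 \<le> l \<Longrightarrow> l \<le> n \<Longrightarrow> 1 \<le> j \<Longrightarrow> j \<le> n \<Longrightarrow>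
    kap i l (x j f) = x j (kap i l f)"
  by (simp add: kap_def lin_rules t_x)

lemma kap_s: "1 \<le> i \<Longrightarrow> i < n \<Longrightarrow> kap i (Suc i) (s i f) = s i (kap i (Suc i) f)"
  by (simp add: kap_def lin_rules s_t t_t)

lemma cross1': "1 \<le> i \<Longrightarrow> i < n \<Longrightarrow> s i (x i f) = x (Suc i) (s i f) - kap i (Suc i) f"
  by (simp add: cross1 kap_def)

lemma cross2: 
  assumes "1 \<le> i" "i < n"
  shows "s i (x (Suc i) f) = x i (s i f) + kap i (Suc i) f"
proof -
  have "s i (s i (x i (s i f))) = s i (x (Suc i) f - kap i (Suc i) (s i f))"
    using cross1'[OF assms, of "s i f"] assms by simp
  then show ?thesis
    using assms by (simp add: lin_rules kap_s algebra_simps)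
qed

lemma x_s:
  assumes i: "1 \<le> i" "i < n" and j: "1 \<le> j" "j \<le> n"
  shows "x j (s i f) = s i (x (swp i (Suc i) j) f) +
     cm (if j = i then -1 else if j = Suc i then 1 else 0) (kap i (Suc i) f)"
  using cross1'[OF i, of f] cross2[OF i, of f] cross3[OF i j, of f]
  by (auto simp: Transposition.transpose_def cm_minus)

text \<open>The image of \<open>v\<close> under the group algebra of the symmetric group on
  \<open>1..m\<close>; closure under the adjacent transpositions is the form needed for
  inductions.\<close>

inductive_set span_s :: "'e \<Rightarrow> nat \<Rightarrow> 'e set" for v :: 'e and m :: nat where
  base: "v \<in> span_s v m"
| add: "f \<in> span_s v m \<Longrightarrow> g \<in> span_s v m \<Longrightarrow> f + g \<in> span_s v m"
| cm: "f \<in> span_s v m \<Longrightarrow> cm c f \<in> span_s v m"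
| s: "1 \<le> i \<Longrightarrow> i < m \<Longrightarrow> f \<in> span_s v m \<Longrightarrow> s i f \<in> span_s v m"

text \<open>By the crossing relations \<open>[x\<^sub>a, x\<^sub>b] s\<^sub>i = s\<^sub>i
  [x\<^sub>a', x\<^sub>b']\<close>, where \<open>a'\<close> and \<open>b'\<close> are the images
  of \<open>a\<close> and \<open>b\<close> under the transposition: the correction terms cancel
  because they commute with the \<open>x\<^sub>j\<close>. Hence the commutator vanishes on
  everything generated from a joint eigenvector.\<close>

lemma x_comm_span:
  assumes v: "\<And>j. 1 \<le> j \<Longrightarrow> j \<le> n \<Longrightarrow> x j v = cm (lam j) v"
    and "f \<in> span_s v n" "1 \<le> a" "a \<le> n" "1 \<le> b" "b \<le> n"
  shows "x a (x b f) = x b (x a f)"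
  using assms(2-)
proof (induction arbitrary: a b)
  case (add f g)
  then show ?case by (simp add: lin_rules)
next
  case (cm f c)
  then show ?case by (simp add: lin_rules)
next
  case base
  then show ?case by (simp add: v lin_rules mult.commute)
next
  case (s i f)
  have K: "kap i (Suc i) (x j f) = x j (kap i (Suc i) f)" if "1 \<le> j" "j \<le> n" for j
    using kap_x s(1,2) that by simp
  let ?s = "swp i (Suc i)"
  let ?e = "\<lambda>j. (if j = i then -1 else if j = Suc i then 1 else 0) :: complex"
  have r: "1 \<le> ?s a" "?s a \<le> n" "1 \<le> ?s b" "?s b \<le> n"
    using s by (auto simp: Transposition.transpose_def)
  have IH: "x (?s a) (x (?s b) f) = x (?s b) (x (?s a) f)"
    using s.IH r by blast
  have "x a (x b (s i f)) = s i (x (?s a) (x (?s b) f)) +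
      cm (?e a) (kap i (Suc i) (x (?s b) f)) + cm (?e b) (x a (kap i (Suc i) f))"
    unfolding x_s[OF s(1,2) s(7,8)] lin_rules x_s[OF s(1,2) s(5,6)] by (rule refl)
  moreover have "x b (x a (s i f)) = s i (x (?s b) (x (?s a) f)) +
      cm (?e b) (kap i (Suc i) (x (?s a) f)) + cm (?e a) (x b (kap i (Suc i) f))"
    unfolding x_s[OF s(1,2) s(7,8)] lin_rules x_s[OF s(1,2) s(5,6)] by (rule refl)
  moreover have "cm (?e a) (kap i (Suc i) (x (?s b) f)) + cm (?e b) (x a (kap i (Suc i) f)) =
     cm (?e b) (kap i (Suc i) (x (?s a) f)) + cm (?e a) (x b (kap i (Suc i) f))"
    using s by (auto simp: K Transposition.transpose_def cm_minus)
  ultimately show ?case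
    using IH by (simp only: add.assoc)
qed

end

locale hecke_rep = hecke_cross n k cm s t x for n k and cm :: "complex \<Rightarrow> 'e::ab_group_add \<Rightarrow> 'e" and s t x +
  assumes x_comm: "1 \<le> a \<Longrightarrow> a \<le> n \<Longrightarrow> 1 \<le> b \<Longrightarrow> b \<le> n \<Longrightarrow> x a (x b f) = x b (x a f)"
begin

section \<open>Intertwining operators\<close>

text \<open>The correction \<open>\<kappa>\<close> is chosen such that
  \<open>\<tau>\<^sub>i\<close> carries joint eigenvectors of the \<open>x\<^sub>j\<close> and
  \<open>t\<^sub>j\<close> to joint eigenvectors with the entries \<open>i\<close> and
  \<open>i+1\<close> exchanged, without the inhomogeneous term that \<open>s\<^sub>i\<close>
  produces.\<close>

definition tau :: "nat \<Rightarrow> 'e \<Rightarrow> 'e" where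
  "tau i f = s i (x i f - x (Suc i) f) + kap i (Suc i) f"

lemma lin_tau: "lin cm (tau i)"
  by (simp add: lin_def tau_def lin_rules kap_lin algebra_simps)

lemma t_kap: "t j (kap i l f) = kap i l (t j f)"
  by (simp add: kap_def lin_rules t_t)

lemma t_kap_swap:
  assumes "1 \<le> i" "i < n"
  shows "t (swp i (Suc i) j) (kap i (Suc i) f) = kap i (Suc i) (t j f)"
proof -
  have "t i (kap i (Suc i) f) = t (Suc i) (kap i (Suc i) f)"
    using assms by (simp add: kap_def lin_rules t_t[of i "Suc i"] add.commute)
  then show ?thesis
    by (auto simp: Transposition.transpose_def t_kap)
qed

lemma t_tau:
  assumes "1 \<le> i" "i < n" "1 \<le> j" "j \<le> n"
  shows "t j (tau i f) = tau i (t (swp i (Suc i) j) f)"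
proof -
  let ?s = "swp i (Suc i)"
  have r: "1 \<le> ?s j" "?s j \<le> n" using assms by (auto simp: Transposition.transpose_def)
  have "s i (t (?s j) g) = t j (s i g)" for g
    using s_t[OF assms(1,2), of "?s j" g] by simp
  moreover have "kap i (Suc i) (t (?s j) f) = t j (kap i (Suc i) f)"
    using t_kap_swap[OF assms(1,2), of "?s j" f] by simp
  moreover have "x i (t (?s j) f) - x (Suc i) (t (?s j) f) = t (?s j) (x i f - x (Suc i) f)"
    using assms r by (simp add: lin_rules t_x)
  ultimately show ?thesis
    unfolding tau_def by (simp only: lin_rules)
qed

lemma x_tau:
  assumes i: "1 \<le> i" "i < n" and j: "1 \<le> j" "j \<le> n"
  shows "x j (tau i f) = tau i (x (swp i (Suc i) j) f)"
proof -
  have i': "1 \<le> Suc i" "Suc i \<le> n" "i \<le> n" using i by auto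
  note c = x_comm[OF i(1) i'(3) i'(1,2)]
  note K = kap_x[OF i(1) i'(3) i'(1,2)]
  consider "j = i" | "j = Suc i" | "j \<noteq> i" "j \<noteq> Suc i" by blast
  then show ?thesis
  proof cases
    case 1
    have "x i (s i g) = s i (x (Suc i) g) - kap i (Suc i) g" for g
      using x_s[OF i i(1) i'(3), of g] by (simp add: cm_minus)
    then show ?thesis
      unfolding tau_def 1 using i by (simp add: lin_rules kap_lin c K)
  next
    case 2
    have "x (Suc i) (s i g) = s i (x i g) + kap i (Suc i) g" for g
      using x_s[OF i i'(1,2), of g] by simp
    then show ?thesis
      unfolding tau_def 2 using i by (simp add: lin_rules kap_lin c K)
  next
    case 3
    have "x j (s i g) = s i (x j g)" for g
      using cross3[OF i j 3] by simp
    with 3 show ?thesis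
      unfolding tau_def using i j i' by (simp add: lin_rules x_comm[OF j] kap_x)
  qed
qed

lemma tau_tau:
  assumes i: "1 \<le> i" "i < n"
  shows "tau i (tau i f) = kap i (Suc i) (kap i (Suc i) f) -
     (x i (x i f - x (Suc i) f) - x (Suc i) (x i f - x (Suc i) f))"
proof -
  have i': "1 \<le> Suc i" "Suc i \<le> n" "i \<le> n" using i by auto
  define d where "d g = x i g - x (Suc i) g" for g
  have sd: "s i (d g) = - d (s i g) - kap i (Suc i) g - kap i (Suc i) g" for g
    using cross1'[OF i, of g] cross2[OF i, of g] by (simp add: d_def lin_rules)
  have tau: "tau i g = s i (d g) + kap i (Suc i) g" for g by (simp add: tau_def d_def)
  have Kd: "kap i (Suc i) (d g) = d (kap i (Suc i) g)" for g
    using i i' by (simp add: d_def kap_lin kap_x)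
  have d_lin: "d (g + h) = d g + d h" "d (- g) = - d g" for g h
    by (simp_all add: d_def lin_rules)
  have "tau i (tau i f) = s i (d (s i (d f))) + s i (d (kap i (Suc i) f)) +
      kap i (Suc i) (s i (d f)) + kap i (Suc i) (kap i (Suc i) f)"
    unfolding tau[of "tau i f"] unfolding tau by (simp add: d_lin lin_rules kap_lin)
  also have "s i (d (s i (d f))) = - d (d f) - kap i (Suc i) (s i (d f)) - kap i (Suc i) (s i (d f))"
    using sd[of "s i (d f)"] i by simp
  also have "s i (d (kap i (Suc i) f)) = kap i (Suc i) (s i (d f))"
    using kap_s[OF i] by (simp add: Kd)
  finally show ?thesis by (simp add: d_def)
qed

section \<open>Chains of intertwining operators\<close>

abbreviation taus :: "nat \<Rightarrow> nat \<Rightarrow> 'e \<Rightarrow> 'e" where "taus l m \<equiv> foldr tau [l..<m]"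
abbreviation ss :: "nat \<Rightarrow> nat \<Rightarrow> 'e \<Rightarrow> 'e" where "ss l m \<equiv> foldr s [l..<m]"

lemma lin_foldr: "(\<And>i. i \<in> set xs \<Longrightarrow> lin cm (F i)) \<Longrightarrow> lin cm (foldr F xs)"
proof (induction xs)
  case (Cons a xs)
  then have "lin cm (F a)" "lin cm (foldr F xs)" by auto
  then show ?case by (auto simp: lin_def)
qed (simp add: lin_def)

lemma lin_taus: "lin cm (taus l m)" and lin_ss: "lin cm (ss l m)"
  by (auto intro!: lin_foldr lin_tau lin_s)

lemma taus_step: "l < m \<Longrightarrow> taus l m f = tau l (taus (Suc l) m f)"
  and ss_step: "l < m \<Longrightarrow> ss l m f = s l (ss (Suc l) m f)"
  by (simp_all add: upt_rec)

lemma x_taus_low: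
  assumes "1 \<le> j" "j < l" "m \<le> n"
  shows "x j (taus l m f) = taus l m (x j f)" "t j (taus l m f) = taus l m (t j f)"
proof -
  have "x j (foldr tau xs f) = foldr tau xs (x j f) \<and> t j (foldr tau xs f) = foldr tau xs (t j f)"
    if "set xs \<subseteq> {l..<m}" for xs
    using that
  proof (induction xs)
    case (Cons i xs)
    then have "1 \<le> i" "i < n" "j \<le> n" "j \<noteq> i" "j \<noteq> Suc i" using assms by auto
    with Cons assms show ?case by (simp add: x_tau t_tau)
  qed simp
  from this[of "[l..<m]"] show "x j (taus l m f) = taus l m (x j f)" "t j (taus l m f) = taus l m (t j f)" by auto
qed

lemma x_taus:
  assumes "1 \<le> l" "l \<le> m" "m \<le> n"
  shows "x l (taus l m f) = taus l m (x m f) \<and> t l (taus l m f) = taus l m (t m f)"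
  using assms(2,1)
proof (induction rule: inc_induct)
  case (step l)
  then have "1 \<le> l" "l < n" "l \<le> n" "l < m" using assms by auto
  with step show ?case by (simp add: taus_step x_tau t_tau)
qed simp

lemma x_ss:
  assumes "1 \<le> j" "j < l" "m \<le> n"
  shows "x j (ss l m f) = ss l m (x j f)"
proof -
  have "x j (foldr s xs f) = foldr s xs (x j f)" if "set xs \<subseteq> {l..<m}" for xs
    using that
  proof (induction xs)
    case (Cons i xs)
    then have "1 \<le> i" "i < n" "j \<le> n" "j \<noteq> i" "j \<noteq> Suc i" using assms by auto
    with Cons assms show ?case by (simp add: cross3[symmetric])
  qed simp
  then show ?thesis by simp
qed

text \<open>The operator \<open>\<kappa>\<^sup>2 - (x\<^sub>j - x\<^sub>m)\<^sup>2\<close>, that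
  is, the value of a square \<open>\<tau>\<^sup>2\<close> after transport along a chain of
  intertwining operators from the position \<open>m\<close>.\<close>

definition Gop :: "nat \<Rightarrow> nat \<Rightarrow> 'e \<Rightarrow> 'e" where
  "Gop m j f = kap j m (kap j m f) - (x j (x j f - x m f) - x m (x j f - x m f))"

text \<open>Multiplying the chain \<open>\<tau>\<^sub>r \<dots>
  \<tau>\<^sub>m\<^sub>-\<^sub>1\<close> by \<open>\<tau>\<^sub>r\<close> produces
  \<open>\<tau>\<^sub>r\<^sup>2\<close>, a polynomial in the \<open>x\<close> and
  \<open>t\<close>. Moved to the right through the rest of the chain, its index
  \<open>r+1\<close> turns into \<open>m\<close>.\<close>

lemma tau_taus:
  assumes "1 \<le> r" "r < m" "m \<le> n"
  shows "tau r (taus r m f) = taus (Suc r) m (Gop m r f)"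
proof -
  have r: "1 \<le> r" "r < n" "1 \<le> Suc r" "Suc r \<le> m" "r < Suc r" using assms by auto
  note a = x_taus_low[OF r(1,5) assms(3)]
  note b = x_taus[OF r(3,4) assms(3), THEN conjunct1] x_taus[OF r(3,4) assms(3), THEN conjunct2]
  note L = lin_add[OF lin_taus] lin_diff[OF lin_taus] lin_cm[OF lin_taus]
  have k: "kap r (Suc r) (taus (Suc r) m g) = taus (Suc r) m (kap r m g)" for g
    by (simp only: kap_def a b L)
  show ?thesis
    unfolding taus_step[OF assms(2)] tau_tau[OF r(1,2)] Gop_def by (simp only: k L a b lin_rules)
qed

text \<open>A polynomial symmetric in \<open>x\<^sub>i, x\<^sub>i\<^sub>+\<^sub>1\<close>
  commutes with \<open>s\<^sub>i\<close>. Here the same happens in spite of the parameters in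
  \<open>\<complex>T\<close>: \<open>s\<^sub>i\<close> exchanges the two factors up to terms
  \<open>h\<close> of opposite signs.\<close>

lemma Gop_s:
  assumes i: "1 \<le> i" "Suc i < m" "m \<le> n"
  shows "Gop m (Suc i) (Gop m i (s i f)) = s i (Gop m (Suc i) (Gop m i f))"
proof -
  have i': "1 \<le> i" "i < n" "1 \<le> Suc i" "Suc i \<le> n" "i \<le> n" "1 \<le> m" using i by auto
  have ms: "s i (x m f) = x m (s i f)" for f
    using cross3[of i m f] i by simp
  have tm: "s i (t m f) = t m (s i f)" "s i (t i f) = t (Suc i) (s i f)" "s i (t (Suc i) f) = t i (s i f)" for f
    using s_t[OF i'(1,2), of m] s_t[OF i'(1,2), of i] s_t[OF i'(1,2), of "Suc i"] i
    by (simp_all add: Transposition.transpose_def)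
  have k1: "s i (kap i m f) = kap (Suc i) m (s i f)" "s i (kap (Suc i) m f) = kap i m (s i f)" for f
    by (simp_all add: kap_def lin_rules tm)
  define d where "d j g = x j g - x m g" for j g
  define K where "K = kap i (Suc i)"
  \<comment> \<open>The error made when \<open>s\<^sub>i\<close> moves past a single
    factor.\<close>
  define h where "h g = K (d i g) + K (d (Suc i) g)" for g
  have Gop: "Gop m j g = kap j m (kap j m g) - d j (d j g)" for j g
    by (simp add: Gop_def d_def)
  have d_lin: "d j (f + g) = d j f + d j g" "d j (f - g) = d j f - d j g" for j f g
    by (simp_all add: d_def lin_rules)
  have K_lin: "K (f + g) = K f + K g" "K (f - g) = K f - K g" for f g
    by (simp_all add: K_def kap_lin)
  have sd: "s i (d i g) = d (Suc i) (s i g) - K g" "s i (d (Suc i) g) = d i (s i g) + K g" for g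
    using i' by (simp_all add: d_def K_def lin_rules ms cross1' cross2)
  have Kd: "d j (K g) = K (d j g)" if "1 \<le> j" "j \<le> n" for j g
    using that i i' by (simp add: d_def K_def kap_lin kap_x)
  have kd: "d j (kap l m g) = kap l m (d j g)" if "1 \<le> j" "j \<le> n" "1 \<le> l" "l \<le> n" for j l g
    using that i i' by (simp add: d_def kap_lin kap_x)
  have dd: "d (Suc i) (d i g) = d i (d (Suc i) g)" for g
    using i i' by (simp add: d_def lin_rules x_comm[of "Suc i" i] x_comm[of m i] x_comm[of m "Suc i"])
  have kK: "kap l m (K g) = K (kap l m g)" for l g
    by (simp add: kap_def K_def lin_rules t_t)
  have kk: "kap (Suc i) m (kap i m g) = kap i m (kap (Suc i) m g)" for g
    by (simp add: kap_def lin_rules t_t)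
  have sG1: "s i (Gop m i g) = Gop m (Suc i) (s i g) + h g" for g
    using i' by (simp add: Gop h_def lin_rules sd k1 d_lin K_lin Kd)
  have sG2: "s i (Gop m (Suc i) g) = Gop m i (s i g) - h g" for g
    using i' by (simp add: Gop h_def lin_rules sd k1 d_lin K_lin Kd)
  have hG: "h (Gop m (Suc i) g) = Gop m (Suc i) (h g)" for g
    using i' by (simp add: Gop h_def kap_lin K_lin d_lin Kd kd kK dd)
  have Gadd: "Gop m j (f + g) = Gop m j f + Gop m j g" "Gop m j (f - g) = Gop m j f - Gop m j g" for j f g
    by (simp_all add: Gop d_lin kap_lin)
  have GG: "Gop m i (Gop m (Suc i) g) = Gop m (Suc i) (Gop m i g)" for g
    using i' by (simp add: Gop kap_lin d_lin kd kk dd)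
  have "s i (Gop m i (Gop m (Suc i) f)) = Gop m (Suc i) (Gop m i (s i f) - h f) + h (Gop m (Suc i) f)"
    by (simp only: sG1 sG2)
  also have "\<dots> = Gop m (Suc i) (Gop m i (s i f))"
    by (simp add: Gadd hG)
  finally show ?thesis by (simp only: GG)
qed

lemma upt_split_pair:
  assumes "1 \<le> i" "Suc i < m"
  shows "[1..<m] = [1..<i] @ [i, Suc i] @ [Suc (Suc i)..<m]"
proof -
  have "[1..<i + (m - i)] = [1..<i] @ [i..<i + (m - i)]"
    using assms(1) by (rule upt_add_eq_append)
  moreover have "[i..<m] = i # Suc i # [Suc (Suc i)..<m]"
    using assms(2) by (simp add: upt_conv_Cons)
  ultimately show ?thesis using assms(2) by simp
qed

lemma lin_fold: "(\<And>i. lin cm (F i)) \<Longrightarrow> lin cm (fold F xs)"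
proof (induction xs)
  case (Cons a xs)
  then have "lin cm (F a)" "lin cm (fold F xs)" by auto
  then show ?case by (auto simp: lin_def)
qed (simp add: lin_def)

text \<open>On an eigenvector \<open>v\<close> of \<open>x\<^sub>j\<close> with eigenvalue
  \<open>lam j\<close>, this operation turns \<open>A v\<close> into \<open>(x\<^sub>1 - lam j)
  A v\<close>. In contrast to that polynomial in \<open>x\<^sub>1\<close>, it is defined without
  reference to an eigenvector, and so it can be commuted past the transpositions.\<close>

definition Dop :: "nat \<Rightarrow> ('e \<Rightarrow> 'e) \<Rightarrow> 'e \<Rightarrow> 'e" where
  "Dop j A f = x 1 (A f) - A (x j f)"

lemma lin_Dop: "lin cm A \<Longrightarrow> lin cm (Dop j A)"
  by (simp add: lin_def Dop_def lin_rules algebra_simps)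

lemma lin_fold_Dop: "lin cm A \<Longrightarrow> lin cm (fold Dop xs A)"
  by (induction xs arbitrary: A) (auto intro: lin_Dop)

lemma fold_Dop_swap_far:
  assumes "1 \<le> i" "i < n" "\<And>j. j \<in> set xs \<Longrightarrow> 1 \<le> j \<and> j \<le> n \<and> j \<noteq> i \<and> j \<noteq> Suc i"
  shows "fold Dop xs A (s i f) = fold Dop xs (\<lambda>f. A (s i f)) f"
  using assms(3)
proof (induction xs arbitrary: A)
  case (Cons j xs)
  then have "(\<lambda>f. Dop j A (s i f)) = Dop j (\<lambda>f. A (s i f))"
    using assms(1,2) by (auto simp: fun_eq_iff Dop_def cross3)
  with Cons show ?case by simp
qed simp

text \<open>The two factors belonging to \<open>i\<close> and \<open>i+1\<close> together expand
  to \<open>x\<^sub>1\<^sup>2 A - x\<^sub>1 A (x\<^sub>i + x\<^sub>i\<^sub>+\<^sub>1) + A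
  x\<^sub>i x\<^sub>i\<^sub>+\<^sub>1\<close>, and the symmetric polynomials in
  \<open>x\<^sub>i, x\<^sub>i\<^sub>+\<^sub>1\<close> commute with
  \<open>s\<^sub>i\<close>.\<close>

lemma fold_Dop_s:
  assumes "lin cm A" "1 \<le> i" "Suc i < m" "m \<le> n"
  shows "fold Dop [1..<m] A (s i f) = fold Dop [1..<m] (\<lambda>f. A (s i f)) f"
proof -
  have e: "[1..<m] = [1..<i] @ [i, Suc i] @ [Suc (Suc i)..<m]"
    using assms upt_split_pair by simp
  have i: "1 \<le> i" "i < n" using assms by auto
  define B where "B = fold Dop [1..<i] A"
  have linB: "lin cm B"
    unfolding B_def using assms(1) by (rule lin_fold_Dop)
  have far: "B (s i g) = fold Dop [1..<i] (\<lambda>f. A (s i f)) g" for g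
    unfolding B_def by (rule fold_Dop_swap_far) (use i in auto)
  have mid: "Dop (Suc i) (Dop i B) (s i g) = Dop (Suc i) (Dop i (\<lambda>f. B (s i f))) g" for g
  proof -
    have c: "x i (x (Suc i) g) = x (Suc i) (x i g)" using x_comm i by simp
    have xs: "x i (s i g) = s i (x (Suc i) g) - kap i (Suc i) g" "x (Suc i) (s i g) = s i (x i g) + kap i (Suc i) g" for g
      using cross1'[OF i, of g] cross2[OF i, of g] by (simp_all add: algebra_simps)
    show ?thesis
      using i by (simp add: Dop_def lin_rules xs kap_lin lin_add[OF linB] lin_diff[OF linB] c kap_x)
  qed
  have "fold Dop [1..<m] A (s i f) =
      fold Dop [Suc (Suc i)..<m] (Dop (Suc i) (Dop i B)) (s i f)"
    unfolding e B_def by simp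
  also have "\<dots> = fold Dop [Suc (Suc i)..<m] (\<lambda>f. Dop (Suc i) (Dop i B) (s i f)) f"
    by (rule fold_Dop_swap_far) (use assms in auto)
  also have "\<dots> = fold Dop [1..<m] (\<lambda>f. A (s i f)) f"
    unfolding mid far e by simp
  finally show ?thesis .
qed

definition Qop :: "(nat \<Rightarrow> complex) \<Rightarrow> nat \<Rightarrow> 'e \<Rightarrow> 'e" where
  "Qop lam m = fold (\<lambda>j g. x 1 g - cm (lam j) g) [1..<m]"

lemma lin_Qop: "lin cm (Qop lam m)"
  unfolding Qop_def
  by (intro lin_fold) (simp add: lin_def lin_rules mult.commute algebra_simps)

text \<open>For \<open>f = v\<close> each factor is \<open>x\<^sub>1 - lam j\<close>; since the
  product may be moved past the transpositions \<open>s\<^sub>i\<close> with \<open>i < m -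
  1\<close>, the same holds for everything they generate from \<open>v\<close>.\<close>

lemma fold_Dop_span:
  assumes v: "\<And>j. 1 \<le> j \<Longrightarrow> j \<le> n \<Longrightarrow> x j v = cm (lam j) v"
    and m: "1 \<le> m" "m \<le> n" and "lin cm A" and "f \<in> span_s v (m - 1)"
  shows "fold Dop [1..<m] A f = Qop lam m (A f)"
  using assms(5,4)
proof (induction arbitrary: A)
  case base
  have "fold Dop xs A v = fold (\<lambda>j g. x 1 g - cm (lam j) g) xs (A v)"
    if "set xs \<subseteq> {1..n}" for xs
    using that base
  proof (induction xs arbitrary: A)
    case (Cons j xs)
    then have "Dop j A v = x 1 (A v) - cm (lam j) (A v)"
      by (simp add: Dop_def v lin_cm)
    with Cons lin_Dop[of A j] show ?case by simp
  qed simp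
  moreover have "set [1..<m] \<subseteq> {1..n}" using m by auto
  ultimately show ?case unfolding Qop_def by blast
next
  case (add f g)
  then show ?case using add by (simp only: lin_add[OF add(5)] lin_add[OF lin_Qop] lin_add[OF lin_fold_Dop[OF add(5)]])
next
  case (cm f c)
  then show ?case using cm by (simp only: lin_cm[OF cm(3)] lin_cm[OF lin_Qop] lin_cm[OF lin_fold_Dop[OF cm(3)]])
next
  case (s i f)
  have "fold Dop [1..<m] A (s i f) = fold Dop [1..<m] (\<lambda>f. A (s i f)) f"
    using s m by (intro fold_Dop_s) auto
  also have "\<dots> = Qop lam m (A (s i f))"
    by (rule s.IH[OF lin_comp[OF s.prems(1) lin_s]])
  finally show ?case .
qed

text \<open>With \<open>A\<close> the identity the factor for \<open>j = 1\<close> is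
  \<open>x\<^sub>1 - x\<^sub>1\<close>. This is a Cayley--Hamilton statement: on the module
  generated from \<open>v\<close> by the symmetric group on \<open>1..m-1\<close>, the
  eigenvalues of \<open>x\<^sub>1\<close> are among \<open>lam 1, \<dots>, lam
  (m-1)\<close>.\<close>

lemma Qop_span:
  assumes v: "\<And>j. 1 \<le> j \<Longrightarrow> j \<le> n \<Longrightarrow> x j v = cm (lam j) v"
    and m: "2 \<le> m" "m \<le> n" and f: "f \<in> span_s v (m - 1)"
  shows "Qop lam m f = 0"
proof -
  have "fold Dop [1..<m] (\<lambda>f. f) f = Qop lam m f"
    using m by (intro fold_Dop_span[OF v _ _ lin_id f]) auto
  moreover have "[1..<m] = 1 # [2..<m]" using m by (metis Suc_1 Suc_le_lessD less_le_trans one_less_numeral_iff semiring_norm(76) upt_conv_Cons)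
  moreover have "fold Dop xs (\<lambda>f. 0) = (\<lambda>f. 0)" for xs
    by (induction xs) (auto simp: Dop_def[abs_def] lin_rules)
  ultimately show ?thesis by (simp add: Dop_def[abs_def])
qed

lemma Qop_ss:
  assumes "2 \<le> l" "m \<le> n"
  shows "Qop lam m (ss l m f) = ss l m (Qop lam m f)"
proof -
  have "fold (\<lambda>j g. x 1 g - cm (lam j) g) xs (ss l m f) = ss l m (fold (\<lambda>j g. x 1 g - cm (lam j) g) xs f)" for xs
  proof (induction xs arbitrary: f)
    case (Cons j xs)
    have "x 1 (ss l m f) - cm (lam j) (ss l m f) = ss l m (x 1 f - cm (lam j) f)"
      using assms x_ss[of 1 l m f] by (simp add: lin_diff[OF lin_ss] lin_cm[OF lin_ss])
    then show ?case by (simp only: fold_simps Cons)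
  qed simp
  then show ?thesis by (simp add: Qop_def)
qed

text \<open>Each factor converts one more transposition in \<open>s\<^sub>1 \<dots>
  s\<^sub>m\<^sub>-\<^sub>1\<close> to an intertwining operator, because \<open>x\<^sub>r
  s\<^sub>r - s\<^sub>r x\<^sub>r = - \<tau>\<^sub>r\<close> and \<open>x\<^sub>1 \<tau>\<^sub>1
  \<dots> \<tau>\<^sub>r\<^sub>-\<^sub>1 = \<tau>\<^sub>1 \<dots> \<tau>\<^sub>r\<^sub>-\<^sub>1
  x\<^sub>r\<close>.\<close>

lemma fold_Dop_ss:
  assumes "1 \<le> r" "r \<le> m" "m \<le> n"
  shows "fold Dop [1..<r] (ss 1 m) = (\<lambda>f. cm ((-1) ^ (r - 1)) (taus 1 r (ss r m f)))"
  using assms(1,2)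
proof (induction rule: dec_induct)
  case base
  show ?case by simp
next
  case (step r)
  have r: "1 \<le> r" "r < n" "r < m" "r < Suc r" using step assms by auto
  have "x 1 (taus 1 r g) = taus 1 r (x r g)" for g
    using x_taus[of 1 r g] r by simp
  moreover have "x r (ss r m f) - ss r m (x r f) = - tau r (ss (Suc r) m f)" for f
    unfolding ss_step[OF r(3)] tau_def x_ss[OF r(1,4) assms(3), symmetric]
    using cross2[OF r(1,2), of "ss (Suc r) m f"] by (simp add: lin_rules algebra_simps)
  moreover have "taus 1 (Suc r) g = taus 1 r (tau r g)" for g
    using r by simp
  ultimately have D: "Dop r (\<lambda>f. cm ((-1) ^ (r - 1)) (taus 1 r (ss r m f))) f =
      cm ((-1) ^ r) (taus 1 (Suc r) (ss (Suc r) m f))" for f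
  proof -
    assume 1: "\<And>g. x 1 (taus 1 r g) = taus 1 r (x r g)"
      and 2: "\<And>f. x r (ss r m f) - ss r m (x r f) = - tau r (ss (Suc r) m f)"
      and 3: "\<And>g. taus 1 (Suc r) g = taus 1 r (tau r g)"
    have "Dop r (\<lambda>f. cm ((-1) ^ (r - 1)) (taus 1 r (ss r m f))) f =
       cm ((-1) ^ (r - 1)) (taus 1 r (x r (ss r m f) - ss r m (x r f)))"
      unfolding Dop_def lin_rules 1 lin_diff[OF lin_taus] by simp
    also have "\<dots> = cm (- ((-1) ^ (r - 1))) (taus 1 (Suc r) (ss (Suc r) m f))"
      unfolding 2 3 lin_uminus[OF lin_taus] by (simp add: cm_minus lin_rules)
    also have "- ((-1) ^ (r - 1)) = (-1 :: complex) ^ r"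
      using r(1) by (cases r) auto
    finally show ?thesis .
  qed
  have F: "fold Dop [1..<Suc r] (ss 1 m) = Dop r (fold Dop [1..<r] (ss 1 m))"
    using r by simp
  show ?case
    unfolding F step.IH[OF less_imp_le[OF r(3)]] diff_Suc_1 by (rule ext) (rule D)
qed

lemma Qop_ss_1:
  assumes v: "\<And>j. 1 \<le> j \<Longrightarrow> j \<le> n \<Longrightarrow> x j v = cm (lam j) v"
    and m: "1 \<le> m" "m \<le> n" and f: "f \<in> span_s v (m - 1)"
  shows "Qop lam m (ss 1 m f) = cm ((-1) ^ (m - 1)) (taus 1 m f)"
  using fold_Dop_span[OF v m lin_ss f, of 1 m] fold_Dop_ss[OF m(1) order_refl m(2)] by simp

lemma lin_Gop: "lin cm (Gop m j)"
  by (simp add: lin_def Gop_def lin_rules kap_lin algebra_simps)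

lemma lin_fold_Gop: "lin cm (fold (Gop m) xs)"
  by (intro lin_fold lin_Gop)

lemma Gop_far:
  assumes "1 \<le> i" "Suc i < m" "m \<le> n" "1 \<le> j" "j \<le> n" "j \<noteq> i" "j \<noteq> Suc i"
  shows "Gop m j (s i f) = s i (Gop m j f)"
proof -
  have t: "t j (s i g) = s i (t j g)" "t m (s i g) = s i (t m g)" for g
    using s_t[of i j g] s_t[of i m g] assms by (auto simp: Transposition.transpose_def)
  have x: "x j (s i g) = s i (x j g)" "x m (s i g) = s i (x m g)" for g
    using cross3[of i j g] cross3[of i m g] assms by auto
  show ?thesis by (simp add: Gop_def kap_def lin_rules t x)
qed

lemma fold_Gop_s:
  assumes "1 \<le> i" "Suc i < m" "m \<le> n"
  shows "fold (Gop m) [1..<m] (s i f) = s i (fold (Gop m) [1..<m] f)"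
proof -
  have e: "[1..<m] = [1..<i] @ [i, Suc i] @ [Suc (Suc i)..<m]"
    using assms upt_split_pair by simp
  have far: "fold (Gop m) xs (s i f) = s i (fold (Gop m) xs f)"
    if "\<And>j. j \<in> set xs \<Longrightarrow> 1 \<le> j \<and> j \<le> n \<and> j \<noteq> i \<and> j \<noteq> Suc i" for xs f
    using that by (induction xs arbitrary: f) (use assms in \<open>auto simp: Gop_far\<close>)
  have 1: "fold (Gop m) [1..<i] (s i g) = s i (fold (Gop m) [1..<i] g)" for g
    using assms by (intro far) auto
  have 2: "fold (Gop m) [Suc (Suc i)..<m] (s i g) = s i (fold (Gop m) [Suc (Suc i)..<m] g)" for g
    using assms by (intro far) auto
  show ?thesis
    unfolding e fold_append comp_def fold_simps id_apply 1 2 Gop_s[OF assms] ..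
qed

text \<open>The product of all factors commutes with the symmetric group on
  \<open>1..m-1\<close>, so it acts on the module generated from \<open>v\<close> by its scalar
  value at \<open>v\<close>.\<close>

lemma fold_Gop_span:
  assumes x: "\<And>j. 1 \<le> j \<Longrightarrow> j \<le> n \<Longrightarrow> x j v = cm (lam j) v"
    and t: "\<And>j. 1 \<le> j \<Longrightarrow> j \<le> n \<Longrightarrow> t j v = cm (nu j) v"
    and m: "1 \<le> m" "m \<le> n" and f: "f \<in> span_s v (m - 1)"
  shows "fold (Gop m) [1..<m] f =
    cm (\<Prod>j\<in>{1..<m}. (k * (1 + nu j * nu m))\<^sup>2 - (lam j - lam m)\<^sup>2) f"
  using f
proof induction
  case base
  let ?c = "\<lambda>j. (k * (1 + nu j * nu m))\<^sup>2 - (lam j - lam m)\<^sup>2"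
  have G: "Gop m j v = cm (?c j) v" if "1 \<le> j" "j \<le> n" for j
  proof -
    have tv: "t j (t m v) = cm (nu j * nu m) v"
      using that m by (simp only: t lin_rules cm_cm mult.commute)
    have 1: "kap j m v = cm (k * (1 + nu j * nu m)) v"
      unfolding kap_def tv using cm_left[of 1 "nu j * nu m" v] by (metis cm_1 cm_cm)
    have xx: "x j (cm c v) - x m (cm c v) = cm (c * (lam j - lam m)) v" for c
      using that m by (simp only: lin_rules x cm_cm right_diff_distrib cm_diff)
    then have 2: "x j v - x m v = cm (lam j - lam m) v"
      by (metis cm_1 mult_1)
    show ?thesis
      unfolding Gop_def 1 2 kap_lin(4) xx cm_cm power2_eq_square
      unfolding cm_diff ..
  qed
  have "fold (Gop m) xs (cm d v) = cm (d * (\<Prod>j\<leftarrow>xs. ?c j)) v" if "set xs \<subseteq> {1..n}" for xs d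
    using that
  proof (induction xs arbitrary: d)
    case (Cons j xs)
    then have "Gop m j (cm d v) = cm (d * ?c j) v"
      using G[of j] lin_cm[OF lin_Gop, of m j d v] by simp
    with Cons show ?case by (simp add: mult.assoc)
  qed simp
  moreover have "set [1..<m] \<subseteq> {1..n}" using m by auto
  ultimately have "fold (Gop m) [1..<m] (cm 1 v) = cm (1 * (\<Prod>j\<leftarrow>[1..<m]. ?c j)) v"
    by blast
  then have "fold (Gop m) [1..<m] v = cm (\<Prod>j\<leftarrow>[1..<m]. ?c j) v"
    by (simp only: cm_1 mult_1)
  also have "(\<Prod>j\<leftarrow>[1..<m]. ?c j) = (\<Prod>j\<in>{1..<m}. ?c j)"
    using prod.distinct_set_conv_list[of "[1..<m]" ?c] by simp
  finally show ?case .
next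
  case (add f g)
  then show ?case by (simp only: lin_add[OF lin_fold_Gop] cm_right)
next
  case (cm f c)
  then show ?case using lin_cm[OF lin_fold_Gop[of m "[1..<m]"], of c f] by (simp add: mult.commute)
next
  case (s i f)
  then show ?case using fold_Gop_s[of i m f] m lin_cm[OF lin_s] by (simp add: less_diff_conv)
qed

end

section \<open>A model on functions on the symmetric group\<close>

abbreviation iv :: "('a \<Rightarrow> 'b) \<Rightarrow> 'b \<Rightarrow> 'a" where
  "iv \<equiv> inv_into UNIV"

text \<open>A function \<open>f\<close> stands for the combination of the \<open>t\<^sub>p
  \<otimes> v\<close> with coefficients \<open>f p\<close>. Permutations are total functions on
  the natural numbers, so the function space also contains functions not supported on
  permutations of \<open>1..n\<close>; there the operators are defined such that the relations
  hold on the whole type.\<close>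

type_synonym pfun = "(nat \<Rightarrow> nat) \<Rightarrow> complex"

definition cmul :: "complex \<Rightarrow> pfun \<Rightarrow> pfun" where
  "cmul c f = (\<lambda>q. c * f q)"

definition delta :: "(nat \<Rightarrow> nat) \<Rightarrow> pfun" where
  "delta p = (\<lambda>q. if q = p then 1 else 0)"

definition supp :: "nat \<Rightarrow> pfun set" where
  "supp m = {f. \<forall>q. f q \<noteq> 0 \<longrightarrow> q permutes {1..m}}"

definition Sop :: "nat \<Rightarrow> (nat \<Rightarrow> nat) \<Rightarrow> pfun \<Rightarrow> pfun" where
  "Sop n g f = (\<lambda>q. if q permutes {1..n} then f (iv g \<circ> q) else f q)"

definition Top :: "nat \<Rightarrow> (nat \<Rightarrow> complex) \<Rightarrow> nat \<Rightarrow> pfun \<Rightarrow> pfun" where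
  "Top n nu j f = (\<lambda>q. if q permutes {1..n} then nu (iv q j) * f q else f q)"

text \<open>Nonzero exactly if the pair of positions \<open>a\<close>, \<open>b\<close> is an
  inversion of \<open>q \<circ> (a b)\<close>; the sign tells which of the two positions comes
  first.\<close>

definition isign :: "(nat \<Rightarrow> nat) \<Rightarrow> nat \<Rightarrow> nat \<Rightarrow> complex" where
  "isign q a b = (if a < b \<and> q a < q b then 1 else if b < a \<and> q b < q a then -1 else 0)"

text \<open>Moving \<open>x\<^sub>j\<close> to the right past a permutation \<open>p\<close>
  gives \<open>p x\<^sub>l\<close> with \<open>l = p\<^sup>-\<^sup>1 j\<close>, and one
  correction term \<open>\<plusminus>\<kappa> p (a l)\<close> for every inversion of
  \<open>p\<close> involving the position \<open>l\<close>; the formula collects the coefficient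
  of a fixed \<open>q\<close> in the result. Outside the permutations of \<open>1..n\<close> the
  operators \<open>s\<^sub>i\<close> and \<open>t\<^sub>j\<close> act trivially and
  \<open>\<kappa>\<close> is \<open>2k\<close>, so that the crossing relation forces
  \<open>x\<^sub>i\<^sub>+\<^sub>1 = x\<^sub>i + 2k\<close>, whence the value
  \<open>2kj\<close>.\<close>

definition Xop :: "nat \<Rightarrow> complex \<Rightarrow> (nat \<Rightarrow> complex) \<Rightarrow> (nat \<Rightarrow> complex) \<Rightarrow> nat \<Rightarrow> pfun \<Rightarrow> pfun" where
  "Xop n k lam nu j f = (\<lambda>q. if q permutes {1..n}
     then lam (iv q j) * f q +
       (\<Sum>a\<in>{1..n}. isign q a (iv q j) * (k * (1 + nu a * nu (iv q j))) * f (q \<circ> swp a (iv q j)))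
     else 2 * k * of_nat j * f q)"

text \<open>The operator \<open>kap\<close> of the abstract setting, needed here to state the
  crossing relation that makes the abstract setting available.\<close>

definition Kop :: "nat \<Rightarrow> complex \<Rightarrow> (nat \<Rightarrow> complex) \<Rightarrow> nat \<Rightarrow> nat \<Rightarrow> pfun \<Rightarrow> pfun" where
  "Kop n k nu i j f = cmul k (f + Top n nu i (Top n nu j f))"

lemma cmul_simps [simp]:
  "cmul c (f + g) = cmul c f + cmul c g" "cmul c (f - g) = cmul c f - cmul c g"
  "cmul c (- f) = - cmul c f" "cmul c (cmul d f) = cmul (c * d) f" "cmul 1 f = f" "cmul 0 f = 0"
  "cmul c 0 = 0"
  by (auto simp: cmul_def fun_eq_iff algebra_simps)

lemma lin_Sop: "lin cmul (Sop n g)" and lin_Top: "lin cmul (Top n nu j)"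
  and lin_Xop: "lin cmul (Xop n k lam nu j)"
  by (auto simp: lin_def Sop_def Top_def Xop_def cmul_def fun_eq_iff algebra_simps sum.distrib
       sum_distrib_left)

lemma permutes_adj: "1 \<le> i \<Longrightarrow> i < n \<Longrightarrow> swp i (Suc i) permutes {1..n}"
  by (rule permutes_swap_id) auto

lemma permutes_iff_comp_left:
  assumes "g permutes A"
  shows "g \<circ> q permutes A \<longleftrightarrow> q permutes A"
proof
  assume "g \<circ> q permutes A"
  then have "iv g \<circ> (g \<circ> q) permutes A"
    using permutes_compose permutes_inv[OF assms] by blast
  then show "q permutes A"
    using permutes_inv_o(2)[OF assms] by (simp add: comp_assoc[symmetric])
qed (use permutes_compose assms in blast)

lemma permutes_iff_comp_right:
  assumes "g permutes A"
  shows "q \<circ> g permutes A \<longleftrightarrow> q permutes A"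
proof
  assume "q \<circ> g permutes A"
  then have "(q \<circ> g) \<circ> iv g permutes A"
    using permutes_compose permutes_inv[OF assms] by blast
  then show "q permutes A"
    using permutes_inv_o(1)[OF assms] by (simp add: comp_assoc)
qed (use permutes_compose assms in blast)

lemma iv_comp: "g permutes A \<Longrightarrow> q permutes B \<Longrightarrow> iv (g \<circ> q) = iv q \<circ> iv g"
  using o_inv_distrib permutes_bij by blast

lemma Sop_Sop:
  assumes "g permutes {1..n}" "h permutes {1..n}"
  shows "Sop n g (Sop n h f) = Sop n (g \<circ> h) f"
  using permutes_iff_comp_left[OF permutes_inv[OF assms(1)]]
  by (intro ext) (simp add: Sop_def comp_assoc iv_comp[OF assms])

lemma Sop_id [simp]: "Sop n id f = f"
  by (auto simp: Sop_def fun_eq_iff inv_id)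

lemma Sop_delta:
  assumes "g permutes {1..n}" "p permutes {1..n}"
  shows "Sop n g (delta p) = delta (g \<circ> p)"
proof
  fix q
  have "iv g \<circ> q = p \<longleftrightarrow> q = g \<circ> p"
    using permutes_inv_o[OF assms(1)] by (metis comp_assoc id_comp)
  then show "Sop n g (delta p) q = delta (g \<circ> p) q"
    using permutes_compose[OF assms(2,1)] assms(2) by (auto simp: Sop_def delta_def)
qed

text \<open>The transposition of \<open>a\<close> and \<open>b\<close> is a product of adjacent
  ones, by conjugating with \<open>(b-1 b)\<close> and induction on \<open>b -
  a\<close>.\<close>

lemma permutes_adj_induct [consumes 1, case_names id adj]:
  assumes "p permutes {1..n}"
    and "P id"
    and adj: "\<And>i q. 1 \<le> i \<Longrightarrow> i < n \<Longrightarrow> q permutes {1..n} \<Longrightarrow> P q \<Longrightarrow> P (swp i (Suc i) \<circ> q)"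
  shows "P p"
proof -
  \<comment> \<open>\<open>(a b+1) = (b b+1) (a b) (b b+1)\<close>\<close>
  have step: "P (swp a (Suc (a + d)) \<circ> q)" if "P q" "q permutes {1..n}" "1 \<le> a" "a + d < n" for a d q
    using that
  proof (induction d arbitrary: q)
    case 0
    then show ?case using adj[of a q] by (simp add: comp_def)
  next
    case (Suc d)
    let ?b = "Suc (a + d)"
    have b: "1 \<le> ?b" "?b < n" using Suc.prems by auto
    have "P (swp ?b (Suc ?b) \<circ> q)"
      using adj b Suc.prems by blast
    then have "P (swp a (Suc (a + d)) \<circ> (swp ?b (Suc ?b) \<circ> q))"
      using Suc.IH[of "swp ?b (Suc ?b) \<circ> q"] Suc.prems permutes_compose[OF Suc.prems(2) permutes_adj[OF b]] b by (metis Suc_lessD)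
    moreover have "swp a ?b \<circ> (swp ?b (Suc ?b) \<circ> q) permutes {1..n}"
      using Suc.prems b by (intro permutes_compose[OF permutes_compose] permutes_swap_id) auto
    ultimately have "P (swp ?b (Suc ?b) \<circ> (swp a ?b \<circ> (swp ?b (Suc ?b) \<circ> q)))"
      using adj[OF b] by blast
    moreover have "swp ?b (Suc ?b) \<circ> (swp a ?b \<circ> (swp ?b (Suc ?b) \<circ> q)) = swp a (Suc (a + Suc d)) \<circ> q"
      by (auto simp: fun_eq_iff Transposition.transpose_def)
    ultimately show ?case by metis
  qed
  have "finite {1..n}" by simp
  from assms(1) this show ?thesis
  proof (induction rule: permutes_induct)
    case id
    show ?case by (rule assms(2))
  next
    case (swap a b p)
    have *: "P (swp a b \<circ> p)" if "a < b" "1 \<le> a" "b \<le> n" for a b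
    proof -
      have "Suc (a + (b - Suc a)) = b" using that by simp
      with step[of p a "b - Suc a"] that swap show ?thesis by (metis Suc_le_eq add_Suc)
    qed
    consider "a < b" | "b < a" using swap by fastforce
    then show ?case
    proof cases
      case 1
      with * swap show ?thesis by (metis atLeastAtMost_iff)
    next
      case 2
      with * swap show ?thesis by (metis atLeastAtMost_iff transpose_commute)
    qed
  qed
qed

lemma supp_0 [simp]: "0 \<in> supp m" and supp_add [intro]: "f \<in> supp m \<Longrightarrow> g \<in> supp m \<Longrightarrow> f + g \<in> supp m"
  and supp_cmul [intro]: "f \<in> supp m \<Longrightarrow> cmul c f \<in> supp m"
  by (auto simp: supp_def cmul_def) force

lemma supp_delta [simp]: "p permutes {1..m} \<Longrightarrow> delta p \<in> supp m"
  by (auto simp: supp_def delta_def)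

lemma supp_expand:
  assumes "f \<in> supp m"
  shows "f = (\<Sum>p\<in>{p. p permutes {1..m}}. cmul (f p) (delta p))"
proof
  fix q
  have fin: "finite {p. p permutes {1..m}}" by (simp add: finite_permutations)
  have ev: "(\<Sum>p\<in>A. g p) q = (\<Sum>p\<in>A. g p q)" for A :: "(nat \<Rightarrow> nat) set" and g :: "(nat \<Rightarrow> nat) \<Rightarrow> pfun"
    by (induction A rule: infinite_finite_induct) auto
  show "f q = (\<Sum>p\<in>{p. p permutes {1..m}}. cmul (f p) (delta p)) q"
    using assms fin
    by (auto simp: ev cmul_def delta_def supp_def mult_delta_right)
qed

lemma supp_induct [consumes 1, case_names zero add cmul delta]:
  assumes "f \<in> supp m" and "P 0"
    and "\<And>f g. P f \<Longrightarrow> P g \<Longrightarrow> P (f + g)" and "\<And>c f. P f \<Longrightarrow> P (cmul c f)"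
    and "\<And>p. p permutes {1..m} \<Longrightarrow> P (delta p)"
  shows "P f"
proof -
  have "P (\<Sum>p\<in>A. cmul (f p) (delta p))" if "A \<subseteq> {p. p permutes {1..m}}" for A
    using that by (induction A rule: infinite_finite_induct) (auto intro!: assms(2-))
  then show ?thesis using supp_expand[OF assms(1)] by (metis subset_refl)
qed

lemma supp_adj_induct [consumes 2, case_names add cmul id adj]:
  assumes "f \<in> supp m" "m \<le> n"
    and add: "\<And>f g. P f \<Longrightarrow> P g \<Longrightarrow> P (f + g)" and cm: "\<And>c f. P f \<Longrightarrow> P (cmul c f)"
    and id: "P (delta id)"
    and adj: "\<And>i f. 1 \<le> i \<Longrightarrow> i < m \<Longrightarrow> f \<in> supp m \<Longrightarrow> P f \<Longrightarrow> P (Sop n (swp i (Suc i)) f)"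
  shows "P f"
  using assms(1)
proof (induction rule: supp_induct)
  case zero
  have "cmul 0 (delta id) = 0" by (rule cmul_simps)
  then show ?case using cm[OF id, of 0] by metis
next
  case (delta p)
  then show ?case
  proof (induction rule: permutes_adj_induct)
    case id
    show ?case by (rule assms)
  next
    case (adj i q)
    have "q permutes {1..n}" using adj(3) \<open>m \<le> n\<close> by (meson atLeastatMost_subset_iff order_refl permutes_subset)
    then have "Sop n (swp i (Suc i)) (delta q) = delta (swp i (Suc i) \<circ> q)"
      using adj \<open>m \<le> n\<close> by (intro Sop_delta permutes_adj) auto
    then show ?case using assms(6)[OF adj(1,2) supp_delta[OF adj(3)] adj(4)] by metis
  qed
next
  case (add f g)
  show ?case by (rule assms(3)[OF add])
next
  case (cmul c f)
  show ?case by (rule cm[OF cmul])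
qed

section \<open>The Hecke relations in the model\<close>

locale hecke_model =
  fixes n :: nat and k :: complex and lam nu :: "nat \<Rightarrow> complex"
  assumes nu: "\<And>j. 1 \<le> j \<Longrightarrow> j \<le> n \<Longrightarrow> nu j = 1 \<or> nu j = -1"
begin

abbreviation s :: "nat \<Rightarrow> pfun \<Rightarrow> pfun" where "s i \<equiv> Sop n (swp i (Suc i))"
abbreviation t :: "nat \<Rightarrow> pfun \<Rightarrow> pfun" where "t \<equiv> Top n nu"
abbreviation x :: "nat \<Rightarrow> pfun \<Rightarrow> pfun" where "x \<equiv> Xop n k lam nu"

lemma iv_in: "q permutes {1..n} \<Longrightarrow> 1 \<le> j \<Longrightarrow> j \<le> n \<Longrightarrow> 1 \<le> iv q j \<and> iv q j \<le> n"
  using permutes_in_image[OF permutes_inv, of q "{1..n}" j] by simp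

lemma nu_sq: "1 \<le> j \<Longrightarrow> j \<le> n \<Longrightarrow> nu j * nu j = 1"
  using nu[of j] by auto

lemma t_t: "t i (t j f) = t j (t i f)"
  by (auto simp: Top_def fun_eq_iff)

lemma t_sq [simp]: "1 \<le> j \<Longrightarrow> j \<le> n \<Longrightarrow> t j (t j f) = f"
  using iv_in nu_sq by (auto simp: Top_def fun_eq_iff mult.assoc[symmetric])

lemma Sop_t:
  assumes g: "g permutes {1..n}"
  shows "Sop n g (t j f) = t (g j) (Sop n g f)"
proof
  fix q
  show "Sop n g (t j f) q = t (g j) (Sop n g f) q"
  proof (cases "q permutes {1..n}")
    case True
    have "iv (iv g \<circ> q) j = iv q (g j)"
      using iv_comp[OF permutes_inv[OF g] True] permutes_inv_inv[OF g] by simp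
    moreover have "iv g \<circ> q permutes {1..n}"
      using permutes_compose[OF True permutes_inv[OF g]] .
    ultimately show ?thesis by (simp add: Sop_def Top_def True)
  qed (simp add: Sop_def Top_def)
qed

lemma s_t: "1 \<le> i \<Longrightarrow> i < n \<Longrightarrow> s i (t j f) = t (swp i (Suc i) j) (s i f)"
  using Sop_t[OF permutes_adj] .

lemma s_s [simp]: "1 \<le> i \<Longrightarrow> i < n \<Longrightarrow> s i (s i f) = f"
  using Sop_Sop[OF permutes_adj permutes_adj, of i n i f] by (simp add: transpose_comp_involutory)

lemma t_x:
  assumes "1 \<le> i" "i \<le> n" "1 \<le> j" "j \<le> n"
  shows "t i (x j f) = x j (t i f)"
proof
  fix q
  show "t i (x j f) q = x j (t i f) q"
  proof (cases "q permutes {1..n}")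
    case True
    let ?b = "iv q j"
    have b: "1 \<le> ?b" "?b \<le> n" using iv_in True assms by auto
    have "(1 + nu a * nu ?b) * (nu (iv (q \<circ> swp a ?b) i)) = (1 + nu a * nu ?b) * nu (iv q i)"
      if a: "a \<in> {1..n}" for a
    proof -
      have "iv (q \<circ> swp a ?b) i = swp a ?b (iv q i)"
        using iv_comp[OF True permutes_swap_id[OF a, of ?b]] b by simp
      moreover have "nu a = nu ?b \<or> 1 + nu a * nu ?b = 0"
        using nu[of a] nu[of ?b] a b by auto
      ultimately show ?thesis
        by (auto simp: Transposition.transpose_def)
    qed
    note * = this
    have "nu (iv q i) * (\<Sum>a\<in>{1..n}. isign q a ?b * (k * (1 + nu a * nu ?b)) * f (q \<circ> swp a ?b)) =
       (\<Sum>a\<in>{1..n}. isign q a ?b * (k * (1 + nu a * nu ?b)) * t i f (q \<circ> swp a ?b))"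
      unfolding sum_distrib_left
    proof (rule sum.cong[OF refl])
      fix a assume a: "a \<in> {1..n}"
      have "q \<circ> swp a ?b permutes {1..n}"
        using permutes_compose[OF permutes_swap_id[OF a, of ?b] True] b by simp
      then show "nu (iv q i) * (isign q a ?b * (k * (1 + nu a * nu ?b)) * f (q \<circ> swp a ?b)) =
         isign q a ?b * (k * (1 + nu a * nu ?b)) * t i f (q \<circ> swp a ?b)"
        unfolding Top_def if_P[OF \<open>q \<circ> swp a ?b permutes {1..n}\<close>]
        using *[OF a] by (simp only: mult.assoc mult.commute mult.left_commute)
    qed
    moreover have "t i (x j f) q = nu (iv q i) * x j f q" "t i f q = nu (iv q i) * f q"
      using True by (simp_all add: Top_def)
    ultimately show ?thesis
      using True by (simp only: Xop_def if_True distrib_left mult.left_commute)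
  qed (simp add: Top_def Xop_def)
qed

text \<open>Replacing \<open>q\<close> by \<open>s\<^sub>i q\<close> changes the relative order
  of the values only for the pair of positions carrying \<open>i\<close> and \<open>i+1\<close>.
  So all terms of the sums for \<open>x\<^sub>j\<close> match except the one for this pair, and
  that term is the correction \<open>\<kappa>\<close>.\<close>

lemma cross_aux:
  assumes i: "1 \<le> i" "i < n" and j: "1 \<le> j" "j \<le> n"
  shows "s i (x j f) = x (swp i (Suc i) j) (s i f) +
     cmul (if j = i then -1 else if j = Suc i then 1 else 0) (Kop n k nu i (Suc i) f)"
proof
  fix q
  let ?s = "swp i (Suc i)"
  let ?e = "(if j = i then -1 else if j = Suc i then 1 else 0) :: complex"
  show "s i (x j f) q = (x (?s j) (s i f) + cmul ?e (Kop n k nu i (Suc i) f)) q"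
  proof (cases "q permutes {1..n}")
    case False
    then show ?thesis
      by (auto simp: Sop_def Xop_def Kop_def Top_def cmul_def Transposition.transpose_def algebra_simps)
  next
    case True
    have sp: "?s permutes {1..n}" by (rule permutes_adj[OF i])
    have sq: "?s \<circ> q permutes {1..n}" by (rule permutes_compose[OF True sp])
    define b where "b = iv q (?s j)"
    have qb: "q b = ?s j" unfolding b_def using permutes_inverses(1)[OF True] by simp
    have iv1: "iv (?s \<circ> q) j = b"
      using iv_comp[OF sp True] by (simp add: b_def)
    have sj: "?s j \<in> {1..n}" using permutes_in_image[OF sp] j by simp
    have b: "b \<in> {1..n}" unfolding b_def using iv_in[OF True] sj by simp
    have inj: "q u = q v \<longleftrightarrow> u = v" for u v using permutes_inj[OF True] by (meson injD)
    let ?g = "\<lambda>a. (k * (1 + nu a * nu b)) * f (?s \<circ> q \<circ> swp a b)"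
    have "(\<Sum>a\<in>{1..n}. isign (?s \<circ> q) a b * ?g a) =
          (\<Sum>a\<in>{1..n}. isign q a b * ?g a) + ?e * Kop n k nu i (Suc i) f q"
    proof -
      \<comment> \<open>The signs differ only at the position \<open>a\<close> with value
        \<open>j\<close>, provided that \<open>b\<close> carries the other one of
        \<open>i\<close>, \<open>i+1\<close>.\<close>
      have diff: "isign (?s \<circ> q) a b - isign q a b = (if q a = j \<and> a \<noteq> b then ?e else 0)" for a
      proof (cases "a = b")
        case False
        then have "q a \<noteq> ?s j" using inj qb by metis
        consider "j = i" | "j = Suc i" | "j \<noteq> i" "j \<noteq> Suc i" by blast
        then show ?thesis
        proof cases
          case 1
          then have "q b = Suc i" using qb by simp
          then show ?thesis using False 1 inj[of a b]
            by (auto simp: isign_def Transposition.transpose_def)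
        next
          case 2
          then have "q b = i" using qb by simp
          then show ?thesis using False 2 inj[of a b]
            by (auto simp: isign_def Transposition.transpose_def)
        next
          case 3
          then have "q b = j" using qb by (simp add: Transposition.transpose_def)
          then show ?thesis using False 3 inj[of a b]
            by (auto simp: isign_def Transposition.transpose_def)
        qed
      qed (simp add: isign_def)
      have "(\<Sum>a\<in>{1..n}. isign (?s \<circ> q) a b * ?g a) - (\<Sum>a\<in>{1..n}. isign q a b * ?g a) =
         (\<Sum>a\<in>{1..n}. (if q a = j \<and> a \<noteq> b then ?e else 0) * ?g a)"
        unfolding sum_subtractf[symmetric] diff[symmetric] by (simp add: algebra_simps)
      also have "\<dots> = (\<Sum>a\<in>{1..n}. if a = iv q j then ?e * Kop n k nu i (Suc i) f q else 0)"
      proof (rule sum.cong[OF refl])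
        fix a assume a: "a \<in> {1..n}"
        have qa: "q a = j \<longleftrightarrow> a = iv q j"
          using permutes_inv_eq[OF True] by metis
        show "(if q a = j \<and> a \<noteq> b then ?e else 0) * ?g a = (if a = iv q j then ?e * Kop n k nu i (Suc i) f q else 0)"
        proof (cases "q a = j \<and> (j = i \<or> j = Suc i)")
          case True
          then have ab: "a \<noteq> b" using qb by auto
          have "?s \<circ> q \<circ> swp a b = q"
          proof
            fix c
            have "q c = q a \<longleftrightarrow> c = a" "q c = q b \<longleftrightarrow> c = b" using inj by auto
            then show "(?s \<circ> q \<circ> swp a b) c = q c"
              using True qb by (auto simp: Transposition.transpose_def)
          qed
          moreover have "Kop n k nu i (Suc i) f q = k * (1 + nu a * nu b) * f q"
          proof -
            have "iv q (q a) = a" "iv q (q b) = b"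
              using permutes_inverses(2)[OF \<open>q permutes {1..n}\<close>] by auto
            then have "{iv q i, iv q (Suc i)} = {a, b}"
              using True qb by (elim conjE disjE) (auto simp: insert_commute)
            then have "nu (iv q i) * nu (iv q (Suc i)) = nu a * nu b"
              by (metis doubleton_eq_iff mult.commute)
            then show ?thesis
              using \<open>q permutes {1..n}\<close> by (simp add: Kop_def cmul_def Top_def algebra_simps)
          qed
          ultimately show ?thesis using True qa ab by simp
        next
          case F: False
          show ?thesis
          proof (cases "q a = j")
            case True
            with F have "q b = j" using qb by (simp add: Transposition.transpose_def)
            then have "a = b" using True inj by metis
            then show ?thesis using F True by auto
          qed (use qa in auto)
        qed
      qed
      also have "\<dots> = ?e * Kop n k nu i (Suc i) f q"
        using iv_in[OF True j] by simp
      finally show ?thesis by (simp add: algebra_simps)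
    qed
    moreover have "s i f (q \<circ> swp a b) = f (?s \<circ> q \<circ> swp a b)" if "a \<in> {1..n}" for a
      using permutes_compose[OF permutes_swap_id[OF that b] True]
      by (simp add: Sop_def comp_assoc)
    moreover have "s i (x j f) q = x j f (?s \<circ> q)"
      using True by (simp add: Sop_def)
    moreover have "x j f (?s \<circ> q) = lam b * f (?s \<circ> q) + (\<Sum>a\<in>{1..n}. isign (?s \<circ> q) a b * ?g a)"
      unfolding Xop_def iv1 using sq by (simp add: mult.assoc)
    moreover have "x (?s j) (s i f) q = lam b * s i f q +
         (\<Sum>a\<in>{1..n}. isign q a b * (k * (1 + nu a * nu b) * s i f (q \<circ> swp a b)))"
      unfolding Xop_def b_def using True by (simp add: mult.assoc)
    moreover have "s i f q = f (?s \<circ> q)" using True by (simp add: Sop_def)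
    ultimately show ?thesis by (simp add: cmul_def)
  qed
qed

lemma cross1:
  assumes "1 \<le> i" "i < n"
  shows "s i (x i f) = x (Suc i) (s i f) - cmul k (f + t i (t (Suc i) f))"
  using cross_aux[of i i f] assms by (auto simp: Kop_def cmul_def fun_eq_iff)

lemma cross3:
  "1 \<le> i \<Longrightarrow> i < n \<Longrightarrow> 1 \<le> j \<Longrightarrow> j \<le> n \<Longrightarrow> j \<noteq> i \<Longrightarrow> j \<noteq> Suc i \<Longrightarrow> s i (x j f) = x j (s i f)"
  using cross_aux[of i j f] by (simp add: Transposition.transpose_def)

lemma t_delta: "t j (delta id) = cmul (nu j) (delta id)"
  by (rule ext) (auto simp: Top_def cmul_def delta_def)

lemma x_delta:
  assumes "1 \<le> j" "j \<le> n"
  shows "x j (delta id) = cmul (lam j) (delta id)"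
proof
  fix q
  show "x j (delta id) q = cmul (lam j) (delta id) q"
  proof (cases "q permutes {1..n}")
    case True
    have "isign q a (iv q j) * (k * (1 + nu a * nu (iv q j))) * delta id (q \<circ> swp a (iv q j)) = 0" for a
    proof (cases "q \<circ> swp a (iv q j) = id")
      case e: True
      then have q: "q = swp a (iv q j)"
        by (metis comp_assoc comp_id id_comp transpose_comp_involutory)
      have "q a = iv q j" "q (iv q j) = a" by (subst q, simp)+
      then show ?thesis by (auto simp: isign_def)
    qed (simp add: delta_def)
    then have "x j (delta id) q = lam (iv q j) * delta id q"
      using True unfolding Xop_def by (simp only: sum.neutral_const if_True add_0_right)
    then show ?thesis by (auto simp: delta_def cmul_def inv_id)
  qed (auto simp: Xop_def cmul_def delta_def permutes_id)
qed

sublocale hecke_cross n k cmul s t x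
proof
  show "cmul (c + d) f = cmul c f + cmul d f" for c d f
    by (auto simp: cmul_def fun_eq_iff algebra_simps)
qed (rule cmul_simps lin_Sop lin_Top lin_Xop t_t t_sq t_x s_s s_t cross1 cross3; assumption)+

text \<open>The element \<open>delta id\<close> plays the part of the generator \<open>1
  \<otimes> v\<close>.\<close>

lemma supp_le_span: "f \<in> supp m \<Longrightarrow> m \<le> n \<Longrightarrow> f \<in> span_s (delta id) m"
  by (induction rule: supp_adj_induct) (rule span_s.intros; assumption)+

sublocale hecke_rep n k cmul s t x
proof
  fix a b f assume ab: "1 \<le> a" "a \<le> n" "1 \<le> b" "b \<le> n"
  show "x a (x b f) = x b (x a f)"
  proof
    fix q
    show "x a (x b f) q = x b (x a f) q"
    proof (cases "q permutes {1..n}")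
      case False
      then show ?thesis by (simp add: Xop_def)
    next
      case True
      \<comment> \<open>Truncation to permutations of \<open>1..n\<close> commutes with the
        operators, which reduces the claim to functions generated from the joint eigenvector
        \<open>delta id\<close>.\<close>
      define r where "r g = (\<lambda>q. if q permutes {1..n} then g q else 0)" for g :: pfun
      have swp_perm: "q \<circ> swp c (iv q j) permutes {1..n}"
        if "q permutes {1..n}" "c \<in> {1..n}" "1 \<le> j" "j \<le> n" for q c j
        using iv_in[OF that(1,3,4)] that by (intro permutes_compose permutes_swap_id) auto
      have rx: "r (x j g) = x j (r g)" if "1 \<le> j" "j \<le> n" for j g
      proof
        fix q show "r (x j g) q = x j (r g) q"
          using swp_perm[OF _ _ that] by (auto simp: r_def Xop_def intro!: sum.cong)
      qed
      have "r f \<in> supp n" by (auto simp: r_def supp_def)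
      then have "x a (x b (r f)) = x b (x a (r f))"
        using x_comm_span[OF x_delta supp_le_span[OF _ order_refl]] ab by blast
      then have "r (x a (x b f)) = r (x b (x a f))"
        using ab by (simp only: rx)
      moreover have "r g q = g q" for g using True by (simp add: r_def)
      ultimately show ?thesis by metis
    qed
  qed
qed

end

section \<open>Simplicity away from the critical hyperplanes\<close>

definition invsub :: "nat \<Rightarrow> complex \<Rightarrow> (nat \<Rightarrow> complex) \<Rightarrow> (nat \<Rightarrow> complex) \<Rightarrow> pfun set \<Rightarrow> bool" where
  "invsub n k lam nu N \<longleftrightarrow> N \<subseteq> supp n \<and> 0 \<in> N \<and> (\<forall>f\<in>N. \<forall>g\<in>N. f + g \<in> N) \<and>
     (\<forall>c. \<forall>f\<in>N. cmul c f \<in> N) \<and>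
     (\<forall>i f. 1 \<le> i \<longrightarrow> i < n \<longrightarrow> f \<in> N \<longrightarrow> Sop n (swp i (Suc i)) f \<in> N) \<and>
     (\<forall>j f. 1 \<le> j \<longrightarrow> j \<le> n \<longrightarrow> f \<in> N \<longrightarrow> Xop n k lam nu j f \<in> N \<and> Top n nu j f \<in> N)"

definition simple_model :: "nat \<Rightarrow> complex \<Rightarrow> (nat \<Rightarrow> complex) \<Rightarrow> (nat \<Rightarrow> complex) \<Rightarrow> bool" where
  "simple_model n k lam nu \<longleftrightarrow> (\<forall>N. invsub n k lam nu N \<longrightarrow> N = {0} \<or> N = supp n)"

lemma invsubD:
  assumes "invsub n k lam nu N"
  shows "N \<subseteq> supp n" "0 \<in> N" "f \<in> N \<Longrightarrow> g \<in> N \<Longrightarrow> f + g \<in> N" "f \<in> N \<Longrightarrow> cmul c f \<in> N"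
    "1 \<le> i \<Longrightarrow> i < n \<Longrightarrow> f \<in> N \<Longrightarrow> Sop n (swp i (Suc i)) f \<in> N"
    "1 \<le> j \<Longrightarrow> j \<le> n \<Longrightarrow> f \<in> N \<Longrightarrow> Xop n k lam nu j f \<in> N"
    "1 \<le> j \<Longrightarrow> j \<le> n \<Longrightarrow> f \<in> N \<Longrightarrow> Top n nu j f \<in> N"
  using assms unfolding invsub_def by blast+

lemma cmul_minus1: "cmul (-1) f = - f"
  by (auto simp: cmul_def fun_eq_iff)

lemma invsub_diff: "invsub n k lam nu N \<Longrightarrow> f \<in> N \<Longrightarrow> g \<in> N \<Longrightarrow> f - g \<in> N"
  using invsubD(3)[of n k lam nu N f "cmul (-1) g"] invsubD(4)[of n k lam nu N g "-1"]
  by (simp only: cmul_minus1 add_uminus_conv_diff)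

lemma invsub_Sop:
  assumes "invsub n k lam nu N" "f \<in> N" "g permutes {1..n}"
  shows "Sop n g f \<in> N"
  using assms(3)
proof (induction rule: permutes_adj_induct)
  case id
  show ?case using assms(2) by (metis Sop_id)
next
  case (adj i q)
  show ?case
    using invsubD(5)[OF assms(1) adj(1,2,4)] Sop_Sop[OF permutes_adj[OF adj(1,2)] adj(3)] by metis
qed

lemma invsub_full:
  assumes "invsub n k lam nu N" "delta id \<in> N"
  shows "N = supp n"
proof
  show "supp n \<subseteq> N"
  proof
    fix f assume "f \<in> supp n"
    from this order_refl[of n] show "f \<in> N"
      by (induction rule: supp_adj_induct) (rule invsubD[OF assms(1)] assms(2); assumption)+
  qed
qed (rule invsubD[OF assms(1)])

context hecke_model
begin

text \<open>The cycle \<open>s\<^sub>l s\<^sub>l\<^sub>+\<^sub>1 \<dots>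
  s\<^sub>m\<^sub>-\<^sub>1\<close>, representing the coset of permutations of
  \<open>1..m\<close> that map \<open>m\<close> to \<open>l\<close>.\<close>

definition cyc :: "nat \<Rightarrow> nat \<Rightarrow> nat \<Rightarrow> nat" where
  "cyc l m = foldr (\<lambda>i p. swp i (Suc i) \<circ> p) [l..<m] id"

lemma cyc:
  assumes "1 \<le> l" "l \<le> m" "m \<le> n"
  shows "cyc l m permutes {1..m} \<and> cyc l m m = l \<and> ss l m f = Sop n (cyc l m) f"
  using assms(2,1)
proof (induction rule: inc_induct)
  case base
  have "cyc m m = id" by (simp add: cyc_def)
  moreover have "ss m m f = f" by simp
  ultimately show ?case by (metis permutes_id id_apply Sop_id)
next
  case (step l)
  have e: "cyc l m = swp l (Suc l) \<circ> cyc (Suc l) m"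
    using step by (simp add: cyc_def upt_conv_Cons)
  have IH: "cyc (Suc l) m permutes {1..m}" "cyc (Suc l) m m = Suc l" "ss (Suc l) m f = Sop n (cyc (Suc l) m) f"
    using step by auto
  have "cyc (Suc l) m permutes {1..n}"
    using IH(1) assms(3) by (meson atLeastatMost_subset_iff order_refl permutes_subset)
  note c1 = this
  have s1: "swp l (Suc l) permutes {1..n}" and s2: "swp l (Suc l) permutes {1..m}"
    by (rule permutes_adj; use step assms in simp)+
  show ?case
    unfolding e
  proof (intro conjI)
    show "swp l (Suc l) \<circ> cyc (Suc l) m permutes {1..m}"
      by (rule permutes_compose[OF IH(1) s2])
    show "(swp l (Suc l) \<circ> cyc (Suc l) m) m = l"
      using IH by simp
    show "ss l m f = Sop n (swp l (Suc l) \<circ> cyc (Suc l) m) f"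
      using ss_step[OF step(2)] IH(3) Sop_Sop[OF s1 c1] by metis
  qed
qed

lemma permutes_lower:
  fixes m :: nat
  assumes m: "1 \<le> m" and q: "q permutes {1..m}" and "q m = m"
  shows "q permutes {1..m - 1}"
proof (rule permutes_superset[OF q])
  fix c assume "c \<in> {1..m} - {1..m - 1}"
  then have "c \<le> m" "\<not> c \<le> m - 1" by auto
  then have "c = m" by linarith
  then show "q c = c" using assms by simp
qed

text \<open>The decomposition along the cosets of the symmetric group on \<open>1..m-1\<close>;
  the coset of \<open>q\<close> is determined by \<open>q m\<close>.\<close>

lemma supp_decompose:
  assumes m: "1 \<le> m" "m \<le> n" and f: "f \<in> supp m"
  obtains h where "\<And>l. 1 \<le> l \<Longrightarrow> l \<le> m \<Longrightarrow> h l \<in> supp (m - 1)"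
    and "f = (\<Sum>l\<in>{1..m}. ss l m (h l))"
    and "\<And>q. f q \<noteq> 0 \<Longrightarrow> q m = 1 \<Longrightarrow> h 1 \<noteq> 0"
proof
  define h where "h l = (\<lambda>q. if q permutes {1..m - 1} then f (cyc l m \<circ> q) else 0)" for l
  have sub: "p permutes {1..n}" if "p permutes {1..m}" for p
    using that m by (meson atLeastatMost_subset_iff order_refl permutes_subset)
  have iff: "iv (cyc l m) \<circ> q permutes {1..m - 1} \<longleftrightarrow> q permutes {1..m} \<and> q m = l"
    if l: "1 \<le> l" "l \<le> m" for l q
  proof -
    have c: "cyc l m permutes {1..m}" "cyc l m m = l" using cyc[OF l m(2)] by auto
    show ?thesis
    proof
      assume a: "iv (cyc l m) \<circ> q permutes {1..m - 1}"
      then have "iv (cyc l m) \<circ> q permutes {1..m}"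
        by (rule permutes_subset) auto
      moreover have "(iv (cyc l m) \<circ> q) m = m"
        using permutes_not_in[OF a, of m] m by simp
      ultimately show "q permutes {1..m} \<and> q m = l"
        using permutes_iff_comp_left[OF permutes_inv[OF c(1)]] permutes_inv_eq[OF c(1)] c(2) by auto
    next
      assume a: "q permutes {1..m} \<and> q m = l"
      show "iv (cyc l m) \<circ> q permutes {1..m - 1}"
      proof (rule permutes_lower[OF m(1)])
        show "iv (cyc l m) \<circ> q permutes {1..m}"
          using a c by (auto intro: permutes_compose permutes_inv)
        show "(iv (cyc l m) \<circ> q) m = m"
          using a c permutes_inv_eq[OF c(1)] by auto
      qed
    qed
  qed
  show "h l \<in> supp (m - 1)" if "1 \<le> l" "l \<le> m" for l
    by (auto simp: h_def supp_def)
  have hval: "ss l m (h l) q = (if q permutes {1..m} \<and> q m = l then f q else 0)" if l: "1 \<le> l" "l \<le> m" for l q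
  proof -
    have c: "cyc l m permutes {1..m}" "ss l m (h l) = Sop n (cyc l m) (h l)" using cyc[OF l m(2)] by auto
    have "cyc l m \<circ> (iv (cyc l m) \<circ> q) = q"
      using permutes_inv_o(1)[OF c(1)] by (simp add: comp_assoc[symmetric])
    then have "h l (iv (cyc l m) \<circ> q) = (if q permutes {1..m} \<and> q m = l then f q else 0)"
      unfolding h_def iff[OF l] by simp
    moreover have "h l q = 0" if "\<not> q permutes {1..n}"
    proof -
      have "\<not> q permutes {1..m - 1}"
        using that m by (meson atLeastatMost_subset_iff diff_le_self le_trans order_refl permutes_subset)
      then show ?thesis by (simp add: h_def)
    qed
    ultimately show ?thesis
      unfolding c(2) Sop_def using sub by auto
  qed
  show "f = (\<Sum>l\<in>{1..m}. ss l m (h l))"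
  proof
    fix q
    have ev: "(\<Sum>p\<in>A. g p) q = (\<Sum>p\<in>A. g p q)" for A :: "nat set" and g :: "nat \<Rightarrow> pfun"
      by (induction A rule: infinite_finite_induct) auto
    have "(\<Sum>l\<in>{1..m}. ss l m (h l)) q = (\<Sum>l\<in>{1..m}. if l = q m then (if q permutes {1..m} then f q else 0) else 0)"
      unfolding ev by (rule sum.cong) (auto simp: hval)
    also have "\<dots> = f q"
      using f permutes_in_image[of q "{1..m}" m] m by (auto simp: supp_def)
    finally show "f q = (\<Sum>l\<in>{1..m}. ss l m (h l)) q" ..
  qed
  show "h 1 \<noteq> 0" if "f q \<noteq> 0" "q m = 1" for q
  proof
    assume "h 1 = 0"
    then have "ss 1 m (h 1) q = 0" using lin_0[OF lin_ss] by simp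
    moreover have "q permutes {1..m}" using that f by (auto simp: supp_def)
    ultimately show False using hval[of 1 q] that m by simp
  qed
qed

lemma invsub_Qop: "invsub n k lam nu N \<Longrightarrow> 1 \<le> n \<Longrightarrow> f \<in> N \<Longrightarrow> Qop lam m f \<in> N"
proof -
  assume N: "invsub n k lam nu N" and n: "1 \<le> n" and "f \<in> N"
  then have "fold (\<lambda>j g. x 1 g - cmul (lam j) g) xs f \<in> N" for xs
  proof (induction xs arbitrary: f)
    case (Cons j xs)
    then have "x 1 f - cmul (lam j) f \<in> N"
      by (intro invsub_diff[OF N] invsubD[OF N]) auto
    with Cons.IH[OF Cons.prems(1,2)] show ?case by (simp only: fold_simps)
  qed simp
  then show ?thesis by (simp add: Qop_def)
qed

lemma invsub_tau:
  assumes N: "invsub n k lam nu N" and i: "1 \<le> i" "i < n" and "f \<in> N"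
  shows "tau i f \<in> N"
  unfolding tau_def kap_def using assms
  by (intro invsubD(3-7)[OF N] invsub_diff[OF N]) auto

text \<open>This is the step of the descent: the polynomial \<open>Qop\<close> isolates the
  coset of \<open>s\<^sub>1 \<dots> s\<^sub>m\<^sub>-\<^sub>1\<close> and turns it into a chain
  of intertwining operators, which is then cancelled at the cost of a scalar that is nonzero by
  assumption.\<close>

lemma descend:
  assumes N: "invsub n k lam nu N" and f: "f \<in> N" "f \<noteq> 0" "f \<in> supp m" and m: "2 \<le> m" "m \<le> n"
    and crit: "\<And>j. 1 \<le> j \<Longrightarrow> j < m \<Longrightarrow> (lam j - lam m)\<^sup>2 \<noteq> (k * (1 + nu j * nu m))\<^sup>2"
  shows "\<exists>h\<in>N. h \<noteq> 0 \<and> h \<in> supp (m - 1)"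
proof -
  obtain q0 where q0: "f q0 \<noteq> 0" using f(2) by (auto simp: fun_eq_iff)
  then have q0p: "q0 permutes {1..m}" using f(3) by (auto simp: supp_def)
  \<comment> \<open>A translation ensures that the coset of \<open>s\<^sub>1 \<dots>
    s\<^sub>m\<^sub>-\<^sub>1\<close>, where \<open>q m = 1\<close>, meets the support.\<close>
  define g where "g = swp (q0 m) 1"
  have gm: "g permutes {1..m}"
    unfolding g_def using permutes_in_image[OF q0p, of m] m by (intro permutes_swap_id) auto
  then have gn: "g permutes {1..n}"
    using m by (meson atLeastatMost_subset_iff order_refl permutes_subset)
  define f' where "f' = Sop n g f"
  have "f' \<in> N" unfolding f'_def by (rule invsub_Sop[OF N f(1) gn])
  have f'm: "f' \<in> supp m"
    using f(3) permutes_iff_comp_left[OF permutes_inv[OF gm]]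
    by (auto simp: f'_def Sop_def supp_def split: if_splits)
  have "iv g \<circ> (g \<circ> q0) = q0"
    using permutes_inv_o(2)[OF gm] by (simp add: comp_assoc[symmetric])
  moreover have "g \<circ> q0 permutes {1..n}"
    using q0p gm m by (meson atLeastatMost_subset_iff order_refl permutes_subset permutes_compose)
  ultimately have f'q: "f' (g \<circ> q0) \<noteq> 0" using q0 by (simp add: f'_def Sop_def)
  have m1: "1 \<le> m" using m by simp
  obtain h where h: "\<And>l. 1 \<le> l \<Longrightarrow> l \<le> m \<Longrightarrow> h l \<in> supp (m - 1)"
    and f'h: "f' = (\<Sum>l\<in>{1..m}. ss l m (h l))"
    and h1: "\<And>q. f' q \<noteq> 0 \<Longrightarrow> q m = 1 \<Longrightarrow> h 1 \<noteq> 0"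
    using supp_decompose[OF m1 m(2) f'm] by blast
  have h1_0: "h 1 \<noteq> 0" using h1[OF f'q] by (simp add: g_def)
  have hs: "h l \<in> span_s (delta id) (m - 1)" if "1 \<le> l" "l \<le> m" for l
    using supp_le_span[OF h[OF that]] m by simp
  \<comment> \<open>For \<open>l \<ge> 2\<close> the cycle \<open>s\<^sub>l \<dots>
    s\<^sub>m\<^sub>-\<^sub>1\<close> commutes with \<open>x\<^sub>1\<close>.\<close>
  have Q0: "Qop lam m (ss l m (h l)) = 0" if "2 \<le> l" "l \<le> m" for l
  proof -
    have "Qop lam m (h l) = 0"
      using Qop_span[OF x_delta m hs[of l]] that by simp
    then show ?thesis
      using Qop_ss[OF that(1) m(2)] lin_0[OF lin_ss] by simp
  qed
  have "Qop lam m f' = (\<Sum>l\<in>{1..m}. Qop lam m (ss l m (h l)))"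
    unfolding f'h by (rule lin_sum[OF lin_Qop])
  also have "\<dots> = (\<Sum>l\<in>{1}. Qop lam m (ss l m (h l)))"
    by (rule sum.mono_neutral_right) (use m Q0 in auto)
  also have "\<dots> = cmul ((-1) ^ (m - 1)) (taus 1 m (h 1))"
    using Qop_ss_1[OF x_delta m1 m(2) hs[of 1]] m by simp
  finally have Qf: "Qop lam m f' = cmul ((-1) ^ (m - 1)) (taus 1 m (h 1))" .
  have "cmul ((-1) ^ (m - 1)) (Qop lam m f') \<in> N"
    using m by (intro invsubD(4)[OF N] invsub_Qop[OF N] \<open>f' \<in> N\<close>) auto
  then have "taus 1 m (h 1) \<in> N"
    unfolding Qf cmul_simps by (simp add: power_mult_distrib[symmetric])
  \<comment> \<open>Applying \<open>\<tau>\<^sub>1, \<dots>,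
    \<tau>\<^sub>r\<^sub>-\<^sub>1\<close> removes the first factors of the chain.\<close>
  have "taus r m (fold (Gop m) [1..<r] (h 1)) \<in> N" if "1 \<le> r" "r \<le> m" for r
    using that
  proof (induction rule: dec_induct)
    case base
    show ?case using \<open>taus 1 m (h 1) \<in> N\<close> by simp
  next
    case (step r)
    then have r: "1 \<le> r" "r < m" "r < n" using m by auto
    have "tau r (taus r m (fold (Gop m) [1..<r] (h 1))) \<in> N"
      using step r by (intro invsub_tau[OF N]) auto
    then show ?case
      unfolding tau_taus[OF r(1,2) m(2)] using r by simp
  qed
  from this[of m] have "fold (Gop m) [1..<m] (h 1) \<in> N" using m by simp
  then have "cmul (\<Prod>j\<in>{1..<m}. (k * (1 + nu j * nu m))\<^sup>2 - (lam j - lam m)\<^sup>2) (h 1) \<in> N"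
    using fold_Gop_span[OF x_delta t_delta m1 m(2) hs[of 1]] m by simp
  moreover define c where "c = (\<Prod>j\<in>{1..<m}. (k * (1 + nu j * nu m))\<^sup>2 - (lam j - lam m)\<^sup>2)"
  ultimately have "cmul c (h 1) \<in> N" by simp
  have "c \<noteq> 0"
    unfolding c_def prod_zero_iff[OF finite_atLeastLessThan] using crit by force
  then have "h 1 = cmul (inverse c) (cmul c (h 1))" unfolding cmul_simps by simp
  then have "h 1 \<in> N" using invsubD(4)[OF N \<open>cmul c (h 1) \<in> N\<close>] by metis
  then show ?thesis using h1_0 h[of 1] m by (intro bexI[of _ "h 1"]) auto
qed

lemma simple_of_noncritical:
  assumes crit: "\<And>a b. 1 \<le> a \<Longrightarrow> a < b \<Longrightarrow> b \<le> n \<Longrightarrow> (lam a - lam b)\<^sup>2 \<noteq> (k * (1 + nu a * nu b))\<^sup>2"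
    and n: "1 \<le> n"
  shows "simple_model n k lam nu"
  unfolding simple_model_def
proof (intro allI impI)
  fix N assume N: "invsub n k lam nu N"
  show "N = {0} \<or> N = supp n"
  proof (cases "N = {0}")
    case False
    then obtain f0 where f0: "f0 \<in> N" "f0 \<noteq> 0" "f0 \<in> supp n" using invsubD(1,2)[OF N] by blast
    have "\<exists>h\<in>N. h \<noteq> 0 \<and> h \<in> supp m" if "1 \<le> m" "m \<le> n" for m
      using that(2,1)
    proof (induction rule: inc_induct)
      case base
      show ?case using f0 by blast
    next
      case (step m)
      have "1 \<le> Suc m" by simp
      from step.IH[OF this] obtain h where h: "h \<in> N" "h \<noteq> 0" "h \<in> supp (Suc m)" by blast
      have "\<exists>h\<in>N. h \<noteq> 0 \<and> h \<in> supp (Suc m - 1)"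
        by (rule descend[OF N h]) (use step crit in auto)
      then show ?case by (simp only: diff_Suc_1)
    qed
    from this[of 1] obtain h where h: "h \<in> N" "h \<noteq> 0" "h \<in> supp 1" using n by auto
    obtain q where q: "h q \<noteq> 0" using h(2) by (auto simp: fun_eq_iff)
    then have "q permutes {1..1}" using h(3) unfolding supp_def by blast
    have p1: "p permutes {1..1} \<longleftrightarrow> p = id" for p :: "nat \<Rightarrow> nat"
      by (simp add: permutes_sing)
    have "h = cmul (h id) (delta id)"
    proof
      fix p show "h p = cmul (h id) (delta id) p"
        using h(3) p1[of p] unfolding supp_def cmul_def delta_def by auto
    qed
    moreover have "h id \<noteq> 0" using q \<open>q permutes {1..1}\<close> p1 by simp
    ultimately have "delta id = cmul (inverse (h id)) h"
      by (metis cmul_simps(4,5) left_inverse)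
    then have "delta id \<in> N" using invsubD(4)[OF N h(1)] by metis
    then show ?thesis using invsub_full[OF N] by simp
  qed simp
qed

lemma Top_supp: "f \<in> supp n \<Longrightarrow> t j f \<in> supp n"
  by (auto simp: supp_def Top_def)

lemma x_supp: "1 \<le> j \<Longrightarrow> j \<le> n \<Longrightarrow> f \<in> supp n \<Longrightarrow> x j f \<in> supp n"
  by (auto simp: supp_def Xop_def)

lemma s_supp: "g permutes {1..n} \<Longrightarrow> f \<in> supp n \<Longrightarrow> Sop n g f \<in> supp n"
  using permutes_iff_comp_left[OF permutes_inv] by (auto simp: supp_def Sop_def split: if_splits)

end

text \<open>On functions supported on permutations of \<open>1..n\<close>, adding \<open>c
  nu\<close> to \<open>lam\<close> adds \<open>c t\<^sub>j\<close> to \<open>x\<^sub>j\<close>,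
  and \<open>t\<^sub>j\<close> preserves invariant subspaces anyway.\<close>

lemma invsub_shift:
  "invsub n k (\<lambda>j. lam j + c * nu j) nu N \<longleftrightarrow> invsub n k lam nu N"
proof -
  have eq: "Xop n k (\<lambda>j. lam j + c * nu j) nu j f = Xop n k lam nu j f + cmul c (Top n nu j f)"
    if "f \<in> supp n" for f j lam c
    using that by (auto simp: Xop_def Top_def cmul_def supp_def fun_eq_iff algebra_simps)
  have imp: "invsub n k (\<lambda>j. lam j + c * nu j) nu N" if N: "invsub n k lam nu N" for c lam
    unfolding invsub_def
  proof (intro conjI ballI allI impI)
    fix j f assume j: "1 \<le> j" "j \<le> n" "f \<in> N"
    then have "f \<in> supp n" using invsubD(1)[OF N] by blast
    have "Xop n k lam nu j f + cmul c (Top n nu j f) \<in> N"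
      using j by (intro invsubD(3,4,6,7)[OF N]) auto
    then show "Xop n k (\<lambda>j. lam j + c * nu j) nu j f \<in> N"
      unfolding eq[OF \<open>f \<in> supp n\<close>] .
  qed (rule invsubD[OF N]; assumption)+
  have "(\<lambda>j. lam j + c * nu j + (- c) * nu j) = lam" by auto
  then show ?thesis using imp[of lam c] imp[of "\<lambda>j. lam j + c * nu j" "- c"] by metis
qed

section \<open>Right multiplication\<close>

text \<open>Right multiplication by \<open>a s\<^sub>i + b\<close> in the group algebra of the
  symmetric group.\<close>

definition Rop :: "nat \<Rightarrow> complex \<Rightarrow> complex \<Rightarrow> pfun \<Rightarrow> pfun" where
  "Rop i a b f = (\<lambda>q. a * f (q \<circ> swp i (Suc i)) + b * f q)"

lemma lin_Rop: "lin cmul (Rop i a b)"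
  by (auto simp: lin_def Rop_def cmul_def fun_eq_iff algebra_simps)

lemma Rop_supp:
  assumes "1 \<le> i" "i < n" "f \<in> supp n"
  shows "Rop i a b f \<in> supp n"
  unfolding supp_def
proof (intro CollectI allI impI)
  fix q assume "Rop i a b f q \<noteq> 0"
  then have "f (q \<circ> swp i (Suc i)) \<noteq> 0 \<or> f q \<noteq> 0" by (auto simp: Rop_def)
  then show "q permutes {1..n}"
    using assms(3) permutes_iff_comp_right[OF permutes_adj[OF assms(1,2)]] unfolding supp_def by blast
qed

lemma Rop_Sop:
  assumes "1 \<le> i" "i < n"
  shows "Rop i a b (Sop n g f) = Sop n g (Rop i a b f)"
  using permutes_iff_comp_right[OF permutes_adj[OF assms]]
  by (intro ext) (simp add: Rop_def Sop_def comp_assoc)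

lemma Rop_Rop:
  "Rop i a' b' (Rop i a b f) = Rop i (a' * b + b' * a) (a' * a + b' * b) f"
  by (intro ext) (simp add: Rop_def comp_assoc transpose_comp_involutory algebra_simps)

lemma Rop_0: "Rop i 0 c f = cmul c f"
  by (simp add: Rop_def cmul_def)

context hecke_model
begin

text \<open>A homomorphism from the module with parameters \<open>lam\<close>, \<open>nu\<close>
  to the one with the entries \<open>i\<close> and \<open>i+1\<close> exchanged amounts to a
  vector with the weights \<open>lam\<close>, \<open>nu\<close> in the target. The relation
  between \<open>a\<close> and \<open>b\<close> says that \<open>(a s\<^sub>i + b) v\<close> is
  such a vector; if \<open>nu i \<noteq> nu (i+1)\<close>, then the \<open>t\<close>-weights of
  \<open>v\<close> and \<open>s\<^sub>i v\<close> differ, which forces \<open>b =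
  0\<close>.\<close>

lemma Rop_intertwines:
  fixes i :: nat and a b :: complex
  defines "\<sigma> \<equiv> swp i (Suc i)"
  assumes i: "1 \<le> i" "i < n" and f: "f \<in> supp n"
    and b: "b \<noteq> 0 \<Longrightarrow> nu i = nu (Suc i)"
    and ab: "a * (k * (1 + nu i * nu (Suc i))) = - b * (lam i - lam (Suc i))"
    and j: "1 \<le> j" "j \<le> n"
  shows "Rop i a b (Top n nu j f) = Top n (nu \<circ> \<sigma>) j (Rop i a b f)"
    and "Rop i a b (Xop n k lam nu j f) = Xop n k (lam \<circ> \<sigma>) (nu \<circ> \<sigma>) j (Rop i a b f)"
proof -
  interpret M: hecke_model n k "lam \<circ> \<sigma>" "nu \<circ> \<sigma>"
  proof
    fix j assume "1 \<le> j" "j \<le> n"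
    then have "1 \<le> \<sigma> j" "\<sigma> j \<le> n" using i by (auto simp: \<sigma>_def Transposition.transpose_def)
    then show "(nu \<circ> \<sigma>) j = 1 \<or> (nu \<circ> \<sigma>) j = -1" using nu by simp
  qed
  have sp: "\<sigma> permutes {1..n}" unfolding \<sigma>_def by (rule permutes_adj[OF i])
  have T: "Rop i a b (t j f) = M.t j (Rop i a b f)" for j f
  proof
    fix q
    show "Rop i a b (t j f) q = M.t j (Rop i a b f) q"
    proof (cases "q permutes {1..n}")
      case True
      have "iv (q \<circ> \<sigma>) j = \<sigma> (iv q j)"
        using iv_comp[OF True sp] by (simp add: \<sigma>_def)
      moreover have "nu (\<sigma> c) = nu c" if "b \<noteq> 0" for c
        using b[OF that] by (auto simp: \<sigma>_def Transposition.transpose_def)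
      moreover have "q \<circ> \<sigma> permutes {1..n}" using permutes_iff_comp_right[OF sp] True by simp
      ultimately show ?thesis
        using True by (cases "b = 0") (auto simp: Rop_def Top_def \<sigma>_def algebra_simps)
    next
      case False
      then have "\<not> q \<circ> \<sigma> permutes {1..n}" using permutes_iff_comp_right[OF sp] by simp
      then show ?thesis using False by (simp add: Rop_def Top_def \<sigma>_def)
    qed
  qed
  then show "Rop i a b (Top n nu j f) = Top n (nu \<circ> \<sigma>) j (Rop i a b f)" .
  have kapR: "Rop i a b (kap l l' f) = M.kap l l' (Rop i a b f)" for l l' f
    unfolding kap_def M.kap_def by (simp only: T[symmetric] lin_add[OF lin_Rop] lin_cm[OF lin_Rop])
  \<comment> \<open>Both modules satisfy the same crossing relations, so it suffices to compare at
    \<open>delta id\<close>.\<close>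
  have "\<forall>j. 1 \<le> j \<longrightarrow> j \<le> n \<longrightarrow> Rop i a b (x j f) = M.x j (Rop i a b f)"
    using supp_le_span[OF f order_refl]
  proof induction
    case base
    have R: "Rop i a b (delta id) = cmul a (s i (delta id)) + cmul b (delta id)"
    proof -
      have "Rop i a b (delta id) = cmul a (delta \<sigma>) + cmul b (delta id)"
      proof
        fix q :: "nat \<Rightarrow> nat"
        have "q \<circ> \<sigma> = id \<longleftrightarrow> q = \<sigma>"
          unfolding \<sigma>_def by (metis comp_assoc comp_id id_comp transpose_comp_involutory)
        then show "Rop i a b (delta id) q = (cmul a (delta \<sigma>) + cmul b (delta id)) q"
          by (simp add: Rop_def cmul_def delta_def \<sigma>_def)
      qed
      also have "delta \<sigma> = s i (delta id)"
        using Sop_delta[OF sp permutes_id] unfolding \<sigma>_def by simp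
      finally show ?thesis .
    qed
    show ?case
    proof (intro allI impI)
      fix j assume j: "1 \<le> j" "j \<le> n"
      let ?v = "delta id" let ?w = "s i (delta id)"
      define e :: complex where "e = (if j = i then -1 else if j = Suc i then 1 else 0)"
      define c where "c = k * (1 + nu i * nu (Suc i))"
      have si: "\<sigma> i = Suc i" "\<sigma> (Suc i) = i" by (simp_all add: \<sigma>_def)
      have sj: "1 \<le> \<sigma> j" "\<sigma> j \<le> n" using i j by (auto simp: \<sigma>_def Transposition.transpose_def)
      have tt: "M.t i (M.t (Suc i) ?v) = cmul (nu i * nu (Suc i)) ?v"
        unfolding M.t_delta M.lin_rules by (simp add: si)
      have kv: "M.kap i (Suc i) ?v = cmul c ?v"
        unfolding M.kap_def tt by (simp add: cmul_def c_def fun_eq_iff algebra_simps)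
      have "M.x j (Rop i a b ?v) = cmul a (M.x j ?w) + cmul b (M.x j ?v)"
        unfolding R M.lin_rules ..
      also have "M.x j ?w = s i (M.x (\<sigma> j) ?v) + cmul e (cmul c ?v)"
        unfolding kv[symmetric] e_def using M.x_s[OF i j, of ?v] unfolding \<sigma>_def .
      also have "M.x (\<sigma> j) ?v = cmul (lam j) ?v"
        using M.x_delta[OF sj] by (simp add: \<sigma>_def)
      also have "M.x j ?v = cmul (lam (\<sigma> j)) ?v"
        using M.x_delta[OF j] by simp
      also have "cmul a (s i (cmul (lam j) ?v) + cmul e (cmul c ?v)) + cmul b (cmul (lam (\<sigma> j)) ?v) =
          cmul (lam j * a) ?w + cmul (e * (a * c) + b * lam (\<sigma> j)) ?v"
        unfolding lin_rules by (simp add: cmul_def fun_eq_iff algebra_simps)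
      also have "e * (a * c) + b * lam (\<sigma> j) = lam j * b"
        unfolding c_def ab e_def by (auto simp: \<sigma>_def Transposition.transpose_def algebra_simps)
      also have "cmul (lam j * a) ?w + cmul (lam j * b) ?v = cmul (lam j) (Rop i a b ?v)"
        unfolding R by simp
      finally have "M.x j (Rop i a b ?v) = cmul (lam j) (Rop i a b ?v)" .
      then show "Rop i a b (x j ?v) = M.x j (Rop i a b ?v)"
        unfolding x_delta[OF j] lin_cm[OF lin_Rop] by simp
    qed
  next
    case (add f g)
    show ?case
      unfolding lin_rules M.lin_rules lin_add[OF lin_Rop] using add.IH by metis
  next
    case (cm f c)
    show ?case
      unfolding lin_rules M.lin_rules lin_cm[OF lin_Rop] using cm.IH by metis
  next
    case (s l f)
    show ?case
    proof (intro allI impI)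
      fix j assume j: "1 \<le> j" "j \<le> n"
      have sj: "1 \<le> swp l (Suc l) j" "swp l (Suc l) j \<le> n"
        using s(1,2) j by (auto simp: Transposition.transpose_def)
      have IH: "Rop i a b (x (swp l (Suc l) j) f) = M.x (swp l (Suc l) j) (Rop i a b f)"
        using s.IH sj by blast
      show "Rop i a b (x j (Sop n (swp l (Suc l)) f)) = M.x j (Rop i a b (Sop n (swp l (Suc l)) f))"
        unfolding x_s[OF s(1,2) j] Rop_Sop[OF i] M.x_s[OF s(1,2) j]
          lin_add[OF lin_Rop] lin_cm[OF lin_Rop] IH kapR ..
    qed
  qed
  then show "Rop i a b (Xop n k lam nu j f) = Xop n k (lam \<circ> \<sigma>) (nu \<circ> \<sigma>) j (Rop i a b f)"
    using j by blast
qed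

end

lemma Rop_delta_neq_0:
  assumes "a \<noteq> 0 \<or> b \<noteq> 0"
  shows "Rop i a b (delta id) \<noteq> 0"
proof
  assume "Rop i a b (delta id) = 0"
  then have *: "Rop i a b (delta id) q = 0" for q by simp
  have ne: "swp i (Suc i) \<noteq> id" by (metis id_apply n_not_Suc_n transpose_apply_first)
  have "b = 0" using *[of id] ne by (simp add: Rop_def delta_def)
  moreover have "a = 0" using *[of "swp i (Suc i)"] ne by (simp add: Rop_def delta_def)
  ultimately show False using assms by simp
qed

context hecke_model
begin

lemma invsub_vimage:
  fixes i :: nat and a b :: complex
  defines "\<sigma> \<equiv> swp i (Suc i)"
  assumes i: "1 \<le> i" "i < n" and b: "b \<noteq> 0 \<Longrightarrow> nu i = nu (Suc i)"
    and ab: "a * (k * (1 + nu i * nu (Suc i))) = - b * (lam i - lam (Suc i))"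
    and N: "invsub n k (lam \<circ> \<sigma>) (nu \<circ> \<sigma>) N"
  shows "invsub n k lam nu {f \<in> supp n. Rop i a b f \<in> N}"
  unfolding invsub_def
proof (intro conjI ballI allI impI subsetI; (elim CollectE conjE)?; (intro CollectI conjI)?)
  show "0 \<in> supp n" "Rop i a b 0 \<in> N" using invsubD(2)[OF N] lin_0[OF lin_Rop] by simp_all
next
  fix f g assume "f \<in> supp n" "g \<in> supp n" "Rop i a b f \<in> N" "Rop i a b g \<in> N"
  then show "f + g \<in> supp n" "Rop i a b (f + g) \<in> N"
    unfolding lin_add[OF lin_Rop] by (blast intro: invsubD(3)[OF N])+
next
  fix c f assume "f \<in> supp n" "Rop i a b f \<in> N"
  then show "cmul c f \<in> supp n" "Rop i a b (cmul c f) \<in> N"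
    unfolding lin_cm[OF lin_Rop] by (blast intro: invsubD(4)[OF N])+
next
  fix l f assume l: "1 \<le> l" "l < n" and f: "f \<in> supp n" "Rop i a b f \<in> N"
  show "s l f \<in> supp n" by (rule s_supp[OF permutes_adj[OF l] f(1)])
  show "Rop i a b (s l f) \<in> N" unfolding Rop_Sop[OF i] by (rule invsubD(5)[OF N l f(2)])
next
  fix j f assume j: "1 \<le> j" "j \<le> n" and f: "f \<in> supp n" "Rop i a b f \<in> N"
  have R: "Rop i a b (t j f) = Top n (nu \<circ> \<sigma>) j (Rop i a b f)"
    "Rop i a b (x j f) = Xop n k (lam \<circ> \<sigma>) (nu \<circ> \<sigma>) j (Rop i a b f)"
    unfolding \<sigma>_def by (rule Rop_intertwines[OF i f(1) _ ab j]; erule b)+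
  show "x j f \<in> supp n" "t j f \<in> supp n" using x_supp[OF j f(1)] Top_supp[OF f(1)] .
  show "Rop i a b (x j f) \<in> N" "Rop i a b (t j f) \<in> N"
    unfolding R using invsubD(6,7)[OF N j f(2)] .
qed auto

text \<open>Up to normalisation there are homomorphisms in both directions whose composites are
  the scalar \<open>c\<close>. If \<open>c\<close> were \<open>0\<close>, the image of one would
  lie in the kernel of the other, a proper nonzero submodule; so \<open>c \<noteq> 0\<close> and
  the homomorphisms are bijective.\<close>

lemma simple_swap:
  fixes i :: nat
  defines "\<sigma> \<equiv> swp i (Suc i)"
  assumes i: "1 \<le> i" "i < n" and k: "k \<noteq> 0" and S: "simple_model n k lam nu"
  shows "simple_model n k (lam \<circ> \<sigma>) (nu \<circ> \<sigma>)"
    and "nu i = nu (Suc i) \<Longrightarrow> (lam i - lam (Suc i))\<^sup>2 \<noteq> (2 * k)\<^sup>2"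
proof -
  \<comment> \<open>The maps are \<open>Rop i a e\<close> and \<open>Rop i a' e\<close>. For equal
    signs \<open>e\<close> is the value of \<open>\<kappa>\<close>, and \<open>a = -d\<close>,
    \<open>a' = d\<close> solve the equations for intertwining. For different signs
    \<open>\<kappa> = 0\<close>, and right multiplication by \<open>s\<^sub>i\<close> alone
    intertwines.\<close>
  define d where "d = lam i - lam (Suc i)"
  define e where "e = (if nu i = nu (Suc i) then 2 * k else 0)"
  define a where "a = (if nu i = nu (Suc i) then - d else 1)"
  define a' where "a' = (if nu i = nu (Suc i) then d else 1)"
  define c where "c = a' * a + e * e"
  have e: "k * (1 + nu i * nu (Suc i)) = e"
    using nu[of i] nu[of "Suc i"] i by (auto simp: e_def)
  interpret M: hecke_model n k "lam \<circ> \<sigma>" "nu \<circ> \<sigma>"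
  proof
    fix j assume "1 \<le> j" "j \<le> n"
    then have "1 \<le> \<sigma> j" "\<sigma> j \<le> n" using i by (auto simp: \<sigma>_def Transposition.transpose_def)
    then show "(nu \<circ> \<sigma>) j = 1 \<or> (nu \<circ> \<sigma>) j = -1" using nu by simp
  qed
  have si: "\<sigma> i = Suc i" "\<sigma> (Suc i) = i" by (simp_all add: \<sigma>_def)
  have inv: "(lam \<circ> \<sigma>) \<circ> \<sigma> = lam" "(nu \<circ> \<sigma>) \<circ> \<sigma> = nu"
    by (simp_all add: \<sigma>_def comp_assoc)
  have pre: "invsub n k lam nu {f \<in> supp n. Rop i a e f \<in> N}" if "invsub n k (lam \<circ> \<sigma>) (nu \<circ> \<sigma>) N" for N
  proof (rule invsub_vimage[OF i _ _ that[unfolded \<sigma>_def]])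
    show "nu i = nu (Suc i)" if "e \<noteq> 0" using that by (auto simp: e_def split: if_splits)
    show "a * (k * (1 + nu i * nu (Suc i))) = - e * (lam i - lam (Suc i))"
      unfolding e unfolding d_def[symmetric] by (auto simp: a_def e_def)
  qed
  have pre': "invsub n k (lam \<circ> \<sigma>) (nu \<circ> \<sigma>) {f \<in> supp n. Rop i a' e f \<in> N}" if "invsub n k lam nu N" for N
  proof (rule M.invsub_vimage[OF i])
    show "(nu \<circ> \<sigma>) i = (nu \<circ> \<sigma>) (Suc i)" if "e \<noteq> 0" using that by (auto simp: e_def si split: if_splits)
    show "a' * (k * (1 + (nu \<circ> \<sigma>) i * (nu \<circ> \<sigma>) (Suc i))) = - e * ((lam \<circ> \<sigma>) i - (lam \<circ> \<sigma>) (Suc i))"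
    proof -
      have "k * (1 + (nu \<circ> \<sigma>) i * (nu \<circ> \<sigma>) (Suc i)) = e"
        using e by (simp only: o_apply si mult.commute[of "nu (Suc i)"])
      moreover have "(lam \<circ> \<sigma>) i - (lam \<circ> \<sigma>) (Suc i) = - d"
        by (simp add: si d_def)
      moreover have "a' * e = - e * - d" by (auto simp: a'_def e_def)
      ultimately show ?thesis by (simp only:)
    qed
    show "invsub n k (lam \<circ> \<sigma> \<circ> swp i (Suc i)) (nu \<circ> \<sigma> \<circ> swp i (Suc i)) N"
      using that inv by (simp add: \<sigma>_def)
  qed
  have RR: "Rop i a' e (Rop i a e f) = cmul c f" "Rop i a e (Rop i a' e f) = cmul c f" for f
  proof -
    have z: "a' * e + e * a = 0" "a * e + e * a' = 0" by (auto simp: a_def a'_def e_def)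
    have "a * a' + e * e = c" by (simp add: c_def mult.commute)
    then show "Rop i a' e (Rop i a e f) = cmul c f" "Rop i a e (Rop i a' e f) = cmul c f"
      unfolding Rop_Rop z Rop_0 c_def by (simp_all only: mult.commute)
  qed
  have ne: "Rop i a e (delta id) \<noteq> 0" "Rop i a' e (delta id) \<noteq> 0"
    using k by (intro Rop_delta_neq_0; simp add: a_def a'_def e_def)+
  have v: "delta id \<in> supp n" by (simp add: permutes_id)
  have zero: "invsub n k (lam \<circ> \<sigma>) (nu \<circ> \<sigma>) {0}"
    unfolding invsub_def using lin_0[OF lin_Sop] lin_0[OF lin_Xop] lin_0[OF lin_Top] cmul_simps
    by auto
  have "c \<noteq> 0"
  proof
    assume "c = 0"
    let ?N = "{f \<in> supp n. Rop i a e f \<in> {0}}"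
    have "?N = {0} \<or> ?N = supp n"
      using S pre[OF zero] unfolding simple_model_def by blast
    moreover have "delta id \<notin> ?N" using ne by simp
    moreover have "Rop i a' e (delta id) \<in> ?N"
      using RR(2) \<open>c = 0\<close> Rop_supp[OF i v] by simp
    ultimately show False using v ne by blast
  qed
  show "simple_model n k (lam \<circ> \<sigma>) (nu \<circ> \<sigma>)"
    unfolding simple_model_def
  proof (intro allI impI)
    fix N assume N: "invsub n k (lam \<circ> \<sigma>) (nu \<circ> \<sigma>) N"
    let ?N = "{f \<in> supp n. Rop i a e f \<in> N}"
    have inN: "Rop i a' e g \<in> ?N" if "g \<in> N" for g
      using that RR(2) invsubD(4)[OF N that] invsubD(1)[OF N] Rop_supp[OF i] by auto
    have recover: "g = cmul (inverse c) (Rop i a e (Rop i a' e g))" for g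
      using \<open>c \<noteq> 0\<close> by (simp add: RR)
    have "?N = {0} \<or> ?N = supp n"
      using S pre[OF N] unfolding simple_model_def by blast
    then show "N = {0} \<or> N = supp n"
    proof
      assume "?N = {0}"
      have "g = 0" if "g \<in> N" for g
      proof -
        have "Rop i a' e g = 0" using inN[OF that] \<open>?N = {0}\<close> by blast
        then show ?thesis using recover[of g] lin_0[OF lin_Rop] by simp
      qed
      then show ?thesis using invsubD(2)[OF N] by blast
    next
      assume full: "?N = supp n"
      have "g \<in> N" if "g \<in> supp n" for g
      proof -
        have "Rop i a' e g \<in> ?N" using Rop_supp[OF i that] full by blast
        then have "Rop i a e (Rop i a' e g) \<in> N" by blast
        then show ?thesis using recover[of g] invsubD(4)[OF N] by metis
      qed
      then show ?thesis using invsubD(1)[OF N] by blast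
    qed
  qed
  show "(lam i - lam (Suc i))\<^sup>2 \<noteq> (2 * k)\<^sup>2" if "nu i = nu (Suc i)"
  proof -
    have "c = (2 * k)\<^sup>2 - d\<^sup>2"
      using that by (simp add: c_def a_def a'_def e_def power2_eq_square)
    then show ?thesis using \<open>c \<noteq> 0\<close> by (simp add: d_def)
  qed
qed

end

section \<open>The simplicity criterion in the model\<close>

lemma simple_permute:
  assumes h: "hecke_model n nu" and k: "k \<noteq> 0" and S: "simple_model n k lam nu" and p: "p permutes {1..n}"
  shows "simple_model n k (lam \<circ> p) (nu \<circ> p)"
proof -
  \<comment> \<open>Inverses turn the induction, which multiplies by adjacent transpositions on
    the left, into one that precomposes the parameters with them.\<close>
  have "iv p permutes {1..n}" by (rule permutes_inv[OF p])
  then have "simple_model n k (lam \<circ> iv (iv p)) (nu \<circ> iv (iv p))"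
  proof (induction rule: permutes_adj_induct)
    case id
    show ?case using S by (simp only: inv_id comp_id)
  next
    case (adj i q)
    interpret hecke_model n k "lam \<circ> iv q" "nu \<circ> iv q"
    proof
      fix j assume "1 \<le> j" "j \<le> n"
      then have "iv q j \<in> {1..n}" using permutes_in_image[OF permutes_inv[OF adj(3)]] by simp
      then show "(nu \<circ> iv q) j = 1 \<or> (nu \<circ> iv q) j = - 1"
        using hecke_model.nu[OF h, of "iv q j"] by simp
    qed
    have "iv (swp i (Suc i) \<circ> q) = iv q \<circ> swp i (Suc i)"
      using iv_comp[OF permutes_adj[OF adj(1,2)] adj(3)] by simp
    then show ?case
      using simple_swap(1)[OF adj(1,2) k adj(4)] by (simp only: comp_assoc)
  qed
  then show ?thesis using permutes_inv_inv[OF p] by simp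
qed

text \<open>Necessity moves a pair \<open>a < b\<close> to the adjacent positions
  \<open>a\<close>, \<open>a+1\<close>. For sufficiency, \<open>lam\<close> is shifted by a
  multiple of \<open>nu\<close> which separates the weights of indices with different signs: for
  those \<open>\<kappa> = 0\<close>, and the condition required by the descent is that the
  weights be different.\<close>

theorem simple_model_iff:
  assumes h: "hecke_model n nu" and k: "k \<noteq> 0" and n: "1 \<le> n"
  shows "simple_model n k lam nu \<longleftrightarrow>
    (\<forall>a b. 1 \<le> a \<and> a < b \<and> b \<le> n \<and> nu a = nu b \<longrightarrow> (lam a - lam b)\<^sup>2 \<noteq> (2 * k)\<^sup>2)"
proof
  assume S: "simple_model n k lam nu"
  show "\<forall>a b. 1 \<le> a \<and> a < b \<and> b \<le> n \<and> nu a = nu b \<longrightarrow> (lam a - lam b)\<^sup>2 \<noteq> (2 * k)\<^sup>2"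
  proof (intro allI impI)
    fix a b assume ab: "1 \<le> a \<and> a < b \<and> b \<le> n \<and> nu a = nu b"
    define p where "p = swp (Suc a) b"
    have p: "p permutes {1..n}" unfolding p_def using ab by (intro permutes_swap_id) auto
    have pv: "p a = a" "p (Suc a) = b" using ab by (auto simp: p_def Transposition.transpose_def)
    interpret hecke_model n k "lam \<circ> p" "nu \<circ> p"
    proof
      fix j assume "1 \<le> j" "j \<le> n"
      then have "p j \<in> {1..n}" using permutes_in_image[OF p] by simp
      then show "(nu \<circ> p) j = 1 \<or> (nu \<circ> p) j = - 1"
        using hecke_model.nu[OF h, of "p j"] by simp
    qed
    show "(lam a - lam b)\<^sup>2 \<noteq> (2 * k)\<^sup>2"
      using simple_swap(2)[of a, OF _ _ k simple_permute[OF h k S p]] ab pv by simp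
  qed
next
  assume C: "\<forall>a b. 1 \<le> a \<and> a < b \<and> b \<le> n \<and> nu a = nu b \<longrightarrow> (lam a - lam b)\<^sup>2 \<noteq> (2 * k)\<^sup>2"
  \<comment> \<open>The finitely many shifts for which two indices with different signs get equal
    weights; for equal signs the quotient is \<open>0\<close> by convention, which only excludes
    one more value.\<close>
  define bad where "bad = (\<lambda>(a, b). (lam b - lam a) / (nu a - nu b)) ` ({1..n} \<times> {1..n})"
  have "finite bad" unfolding bad_def by simp
  then obtain c where c: "c \<notin> bad"
    using ex_new_if_finite[OF infinite_UNIV_char_0] by blast
  interpret hecke_model n k "\<lambda>j. lam j + c * nu j" nu by (rule h)
  have "simple_model n k (\<lambda>j. lam j + c * nu j) nu"
  proof (rule simple_of_noncritical[OF _ n])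
    fix a b assume ab: "1 \<le> a" "a < b" "b \<le> n"
    show "(lam a + c * nu a - (lam b + c * nu b))\<^sup>2 \<noteq> (k * (1 + nu a * nu b))\<^sup>2"
    proof (cases "nu a = nu b")
      case True
      have "nu b * nu b = 1" using nu_sq ab by simp
      then have "k * (1 + nu a * nu b) = 2 * k" using True by simp
      then show ?thesis using C ab True by (auto simp: algebra_simps)
    next
      case False
      then have z: "k * (1 + nu a * nu b) = 0" using nu[of a] nu[of b] ab by auto
      have "lam a + c * nu a - (lam b + c * nu b) \<noteq> 0"
      proof
        assume "lam a + c * nu a - (lam b + c * nu b) = 0"
        then have "c * (nu a - nu b) = lam b - lam a" by (simp add: algebra_simps)
        then have "c = (lam b - lam a) / (nu a - nu b)" using False by (simp add: field_simps)
        then show False using c ab unfolding bad_def by force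
      qed
      then show ?thesis unfolding z by simp
    qed
  qed
  then show "simple_model n k lam nu" by (simp only: simple_model_def invsub_shift)
qed

section \<open>Modules induced from a character\<close>

text \<open>Induction of the one-dimensional module given by \<open>\<psi>\<close>, handled
  through representatives: \<open>F\<close> is the free abelian group, \<open>K\<close> the
  subgroup of balancing relations, and \<open>cl\<close> the passage to cosets.\<close>

locale induced_char = R?: ring H for H :: "('a, 'm) ring_scheme" (structure) +
  fixes A :: "'a set" and \<psi> :: "'a \<Rightarrow> complex"
  assumes A_sub: "A \<subseteq> carrier H"
begin

abbreviation F :: "('a \<times> complex \<Rightarrow>\<^sub>0 int) monoid" where
  "F \<equiv> free_Abelian_group (carrier H \<times> UNIV)"
abbreviation K :: "('a \<times> complex \<Rightarrow>\<^sub>0 int) set" where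
  "K \<equiv> balanced_subgroup H A (one_dim_module \<psi>)"
abbreviation M :: "('a, ('a \<times> complex \<Rightarrow>\<^sub>0 int) set) module" where
  "M \<equiv> induced_module H A (one_dim_module \<psi>)"

definition cl :: "('a \<times> complex \<Rightarrow>\<^sub>0 int) \<Rightarrow> ('a \<times> complex \<Rightarrow>\<^sub>0 int) set" where
  "cl c = K #>\<^bsub>F\<^esub> c"

text \<open>The action of \<open>h\<close> on representatives.\<close>

definition L :: "'a \<Rightarrow> ('a \<times> complex \<Rightarrow>\<^sub>0 int) \<Rightarrow> ('a \<times> complex \<Rightarrow>\<^sub>0 int)" where
  "L h = frag_extend (\<lambda>(x, z). frag_of (h \<otimes> x, z))"

lemma N_simps [simp]: "carrier (one_dim_module \<psi>) = UNIV" "x \<oplus>\<^bsub>one_dim_module \<psi>\<^esub> y = x + y"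
  "a \<odot>\<^bsub>one_dim_module \<psi>\<^esub> z = \<psi> a * z"
  by (simp_all add: one_dim_module_def)

lemma F_iff: "c \<in> carrier F \<longleftrightarrow> Poly_Mapping.keys c \<subseteq> carrier H \<times> UNIV"
  by simp

lemma F_add [intro]: "c \<in> carrier F \<Longrightarrow> d \<in> carrier F \<Longrightarrow> c + d \<in> carrier F"
  and F_diff [intro]: "c \<in> carrier F \<Longrightarrow> d \<in> carrier F \<Longrightarrow> c - d \<in> carrier F"
  and F_0 [intro]: "0 \<in> carrier F"
  unfolding F_iff using Poly_Mapping.keys_add[of c d] keys_diff[of c d] by (blast, blast, simp)

lemma F_of [intro]: "x \<in> carrier H \<Longrightarrow> frag_of (x, z) \<in> carrier F"
  by simp

lemma rels_sub: "balanced_rels H A (one_dim_module \<psi>) \<subseteq> carrier F"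
proof -
  have "a \<in> carrier H" if "a \<in> A" for a using that A_sub by auto
  then show ?thesis
    unfolding balanced_rels_def
    by (intro Un_least subsetI; clarsimp simp del: carrier_free_Abelian_group_iff simp: N_simps)
       (intro F_diff F_of; simp)+
qed

lemma K_eq: "K = generate F (balanced_rels H A (one_dim_module \<psi>))"
  by (simp add: balanced_subgroup_def)

lemma subgroup_K: "subgroup K F"
  unfolding K_eq using rels_sub
  by (intro group.generate_is_subgroup group_free_Abelian_group)

lemma K_sub: "c \<in> K \<Longrightarrow> c \<in> carrier F"
  using subgroup.subset[OF subgroup_K] by blast

lemma K_0 [simp]: "0 \<in> K"
  using subgroup.one_closed[OF subgroup_K] by simp

lemma K_add: "c \<in> K \<Longrightarrow> d \<in> K \<Longrightarrow> c + d \<in> K"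
  using subgroup.m_closed[OF subgroup_K, of c d] by simp

lemma K_minus: "c \<in> K \<Longrightarrow> - c \<in> K"
  using subgroup.m_inv_closed[OF subgroup_K, of c] K_sub[of c] by simp

lemma K_diff: "c \<in> K \<Longrightarrow> d \<in> K \<Longrightarrow> c - d \<in> K"
  using K_add[of c "- d"] K_minus by simp

lemma K_sum: "(\<And>i. i \<in> I \<Longrightarrow> c i \<in> K) \<Longrightarrow> sum c I \<in> K"
  by (induction I rule: infinite_finite_induct) (auto intro: K_add)

lemma K_rels:
  "x \<in> carrier H \<Longrightarrow> y \<in> carrier H \<Longrightarrow> frag_of (x \<oplus> y, z) - frag_of (x, z) - frag_of (y, z) \<in> K"
  "x \<in> carrier H \<Longrightarrow> frag_of (x, z + w) - frag_of (x, z) - frag_of (x, w) \<in> K"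
  "x \<in> carrier H \<Longrightarrow> a \<in> A \<Longrightarrow> frag_of (x \<otimes> a, z) - frag_of (x, \<psi> a * z) \<in> K"
  unfolding K_eq by (rule generate.incl; unfold balanced_rels_def N_simps; blast)+

lemma L_add: "L h (c + d) = L h c + L h d" and L_diff: "L h (c - d) = L h c - L h d"
  and L_of [simp]: "L h (frag_of (x, z)) = frag_of (h \<otimes> x, z)" and L_0 [simp]: "L h 0 = 0"
  by (simp_all add: L_def frag_extend_add frag_extend_diff)

lemma L_minus: "L h (- c) = - L h c"
  by (simp add: L_def frag_extend_minus)

lemma L_sum: "L h (sum c I) = (\<Sum>i\<in>I. L h (c i))"
  by (induction I rule: infinite_finite_induct) (auto simp: L_add)

lemma F_induct [consumes 1, case_names zero diff of]:
  assumes "c \<in> carrier F" "P 0" "\<And>c d. c \<in> carrier F \<Longrightarrow> d \<in> carrier F \<Longrightarrow> P c \<Longrightarrow> P d \<Longrightarrow> P (c - d)"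
    "\<And>x z. x \<in> carrier H \<Longrightarrow> P (frag_of (x, z))"
  shows "P c"
  using assms(1)[unfolded F_iff]
  by (rule free_Abelian_group_induct) (use assms(2-) in auto)

lemma L_F: "h \<in> carrier H \<Longrightarrow> c \<in> carrier F \<Longrightarrow> L h c \<in> carrier F"
  by (rotate_tac, induction rule: F_induct) (auto simp: L_diff simp del: carrier_free_Abelian_group_iff)

text \<open>The balancing relations involve the first tensor factor only through addition and
  multiplication from the right, and left multiplication respects both.\<close>

lemma L_K:
  assumes h: "h \<in> carrier H" and c: "c \<in> K"
  shows "L h c \<in> K"
proof -
  have rel: "L h c \<in> K" if "c \<in> balanced_rels H A (one_dim_module \<psi>)" for c
  proof -
    have "h \<otimes> (x \<oplus> y) = h \<otimes> x \<oplus> h \<otimes> y" if "x \<in> carrier H" "y \<in> carrier H" for x y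
      using that h by (simp add: R.r_distr)
    moreover have "h \<otimes> (x \<otimes> a) = h \<otimes> x \<otimes> a" if "x \<in> carrier H" "a \<in> A" for x a
      using that h A_sub by (auto simp: R.m_assoc)
    ultimately show ?thesis
      using that h unfolding balanced_rels_def
      by (auto simp: L_diff intro!: K_rels)
  qed
  show ?thesis
    using c unfolding K_eq
  proof induction
    case one
    show ?case using K_0 by (simp add: K_eq)
  next
    case (incl c)
    then show ?case using rel by (simp add: K_eq)
  next
    case (inv c)
    then have "inv\<^bsub>F\<^esub> c = - c" using rels_sub by (intro inv_free_Abelian_group) (unfold F_iff[symmetric], blast)
    then show ?case using K_minus[OF rel[OF inv]] by (simp add: L_minus K_eq)
  next
    case (eng c d)
    then show ?case using K_add[of "L h c" "L h d"] by (simp add: L_add K_eq)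
  qed
qed

lemma cl_eq: "cl c = {d + c | d. d \<in> K}"
  by (auto simp: cl_def r_coset_def)

lemma cl_self: "c \<in> cl c"
  unfolding cl_eq by (rule CollectI, rule exI[of _ 0]) simp

lemma cl_eq_iff: "cl c = cl d \<longleftrightarrow> c - d \<in> K"
proof
  assume "cl c = cl d"
  then have "c \<in> cl d" using cl_self by blast
  then show "c - d \<in> K" unfolding cl_eq by auto
next
  assume a: "c - d \<in> K"
  show "cl c = cl d"
  proof (intro equalityI subsetI)
    fix e assume "e \<in> cl c"
    then obtain u where "u \<in> K" "e = u + c" by (auto simp: cl_eq)
    then have "e = (u + (c - d)) + d" "u + (c - d) \<in> K" using a K_add by auto
    then show "e \<in> cl d" unfolding cl_eq by blast
  next
    fix e assume "e \<in> cl d"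
    then obtain u where "u \<in> K" "e = u + d" by (auto simp: cl_eq)
    then have "e = (u - (c - d)) + c" "u - (c - d) \<in> K" using a K_diff by auto
    then show "e \<in> cl c" unfolding cl_eq by blast
  qed
qed

lemma M_carrier: "carrier M = cl ` carrier F"
  by (auto simp: induced_module_def Let_def FactGroup_def RCOSETS_def cl_def)

lemma M_add: "c \<in> carrier F \<Longrightarrow> d \<in> carrier F \<Longrightarrow> cl c \<oplus>\<^bsub>M\<^esub> cl d = cl (c + d)"
proof -
  interpret normal K F
    using comm_group.subgroup_imp_normal[OF abelian_free_Abelian_group subgroup_K] .
  assume "c \<in> carrier F" "d \<in> carrier F"
  then show ?thesis
    using rcos_sum[of c d] by (simp add: induced_module_def Let_def cl_def)
qed

lemma M_zero: "\<zero>\<^bsub>M\<^esub> = cl 0"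
  by (auto simp: induced_module_def Let_def FactGroup_def cl_eq)

lemma M_smult:
  assumes h: "h \<in> carrier H" and c: "c \<in> carrier F"
  shows "h \<odot>\<^bsub>M\<^esub> cl c = cl (L h c)"
proof -
  have "h \<odot>\<^bsub>M\<^esub> cl c = (\<Union>d\<in>cl c. cl (L h d))"
    by (simp add: induced_module_def Let_def cl_def L_def)
  moreover have "cl (L h d) = cl (L h c)" if "d \<in> cl c" for d
  proof -
    obtain u where "u \<in> K" "d = u + c" using \<open>d \<in> cl c\<close> by (auto simp: cl_eq)
    then show ?thesis unfolding cl_eq_iff by (simp add: L_add L_K[OF h])
  qed
  moreover have "cl c \<noteq> {}" using cl_self by blast
  ultimately show ?thesis using SUP_eq_const[of "cl c" "\<lambda>d. cl (L h d)" "cl (L h c)"] by simp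
qed

lemma abelian_group_M: "abelian_group M"
proof (rule abelian_groupI)
  fix x y assume "x \<in> carrier M" "y \<in> carrier M"
  then show "x \<oplus>\<^bsub>M\<^esub> y \<in> carrier M" "x \<oplus>\<^bsub>M\<^esub> y = y \<oplus>\<^bsub>M\<^esub> x"
    unfolding M_carrier using F_add by (auto simp: M_add add.commute simp del: carrier_free_Abelian_group_iff)
next
  fix x y z assume "x \<in> carrier M" "y \<in> carrier M" "z \<in> carrier M"
  then show "x \<oplus>\<^bsub>M\<^esub> y \<oplus>\<^bsub>M\<^esub> z = x \<oplus>\<^bsub>M\<^esub> (y \<oplus>\<^bsub>M\<^esub> z)"
    unfolding M_carrier using F_add by (auto simp: M_add add.assoc simp del: carrier_free_Abelian_group_iff)
next
  show "\<zero>\<^bsub>M\<^esub> \<in> carrier M" unfolding M_zero M_carrier using F_0 by blast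
next
  fix x assume "x \<in> carrier M"
  then obtain c where c: "c \<in> carrier F" "x = cl c" unfolding M_carrier by blast
  then show "\<zero>\<^bsub>M\<^esub> \<oplus>\<^bsub>M\<^esub> x = x" using M_add[OF F_0 c(1)] by (simp add: M_zero)
  have m: "- c \<in> carrier F" using F_diff[OF F_0 c(1)] by simp
  have "cl (- c) \<oplus>\<^bsub>M\<^esub> x = \<zero>\<^bsub>M\<^esub>"
    unfolding c(2) M_add[OF m c(1)] M_zero by simp
  then show "\<exists>y\<in>carrier M. y \<oplus>\<^bsub>M\<^esub> x = \<zero>\<^bsub>M\<^esub>" unfolding M_carrier using m by blast
qed

lemma left_module_M: "left_module H M"
proof -
  have L1: "L (a \<oplus> b) c - (L a c + L b c) \<in> K" if "a \<in> carrier H" "b \<in> carrier H" "c \<in> carrier F" for a b c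
    using that(3)
  proof (induction rule: F_induct)
    case zero
    show ?case by simp
  next
    case (diff c d)
    have "L (a \<oplus> b) (c - d) - (L a (c - d) + L b (c - d)) =
        (L (a \<oplus> b) c - (L a c + L b c)) - (L (a \<oplus> b) d - (L a d + L b d))"
      by (simp add: L_diff)
    then show ?case using K_diff[OF diff(3,4)] by simp
  next
    case (of x z)
    then show ?case
      using K_rels(1)[of "a \<otimes> x" "b \<otimes> x" z] that by (simp add: R.l_distr diff_diff_eq)
  qed
  have L2: "L (a \<otimes> b) c = L a (L b c)" if "a \<in> carrier H" "b \<in> carrier H" "c \<in> carrier F" for a b c
    using that(3) by (induction rule: F_induct) (use that in \<open>auto simp: L_diff R.m_assoc\<close>)
  have L3: "L \<one> c = c" if "c \<in> carrier F" for c
    using that by (induction rule: F_induct) (auto simp: L_diff)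
  interpret M: abelian_group M by (rule abelian_group_M)
  show ?thesis
  proof unfold_locales
    fix a x assume a: "a \<in> carrier H" "x \<in> carrier M"
    then show "a \<odot>\<^bsub>M\<^esub> x \<in> carrier M"
      unfolding M_carrier using L_F by (auto simp: M_smult simp del: carrier_free_Abelian_group_iff)
  next
    fix a b x assume a: "a \<in> carrier H" "b \<in> carrier H" "x \<in> carrier M"
    then obtain c where c: "c \<in> carrier F" "x = cl c" unfolding M_carrier by blast
    show "(a \<oplus> b) \<odot>\<^bsub>M\<^esub> x = (a \<odot>\<^bsub>M\<^esub> x) \<oplus>\<^bsub>M\<^esub> (b \<odot>\<^bsub>M\<^esub> x)"
      unfolding c(2) using a c L1[OF a(1,2) c(1)]
      by (simp add: M_smult M_add L_F cl_eq_iff del: carrier_free_Abelian_group_iff)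
    show "(a \<otimes> b) \<odot>\<^bsub>M\<^esub> x = a \<odot>\<^bsub>M\<^esub> (b \<odot>\<^bsub>M\<^esub> x)"
      unfolding c(2) using a c L2[OF a(1,2) c(1)]
      by (simp add: M_smult L_F del: carrier_free_Abelian_group_iff)
  next
    fix a x y assume a: "a \<in> carrier H" "x \<in> carrier M" "y \<in> carrier M"
    then obtain c d where c: "c \<in> carrier F" "x = cl c" "d \<in> carrier F" "y = cl d" unfolding M_carrier by blast
    show "a \<odot>\<^bsub>M\<^esub> (x \<oplus>\<^bsub>M\<^esub> y) = (a \<odot>\<^bsub>M\<^esub> x) \<oplus>\<^bsub>M\<^esub> (a \<odot>\<^bsub>M\<^esub> y)"
      unfolding c(2,4) using a(1) c(1,3) F_add[OF c(1,3)]
      by (simp add: M_smult M_add L_F L_add del: carrier_free_Abelian_group_iff)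
  next
    fix x assume "x \<in> carrier M"
    then obtain c where c: "c \<in> carrier F" "x = cl c" unfolding M_carrier by blast
    show "\<one> \<odot>\<^bsub>M\<^esub> x = x" unfolding c(2) using c(1) L3 M_smult[of \<one> c] by simp
  qed
qed

text \<open>The universal property of the tensor product, stated on representatives.\<close>

lemma universal:
  fixes f :: "'a \<Rightarrow> complex \<Rightarrow> 'e::ab_group_add"
  assumes add1: "\<And>x y z. x \<in> carrier H \<Longrightarrow> y \<in> carrier H \<Longrightarrow> f (x \<oplus> y) z = f x z + f y z"
    and add2: "\<And>x z w. x \<in> carrier H \<Longrightarrow> f x (z + w) = f x z + f x w"
    and bal: "\<And>x a z. x \<in> carrier H \<Longrightarrow> a \<in> A \<Longrightarrow> f (x \<otimes> a) z = f x (\<psi> a * z)"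
  shows "\<exists>\<Phi>. (\<forall>x\<in>carrier H. \<forall>z. \<Phi> (frag_of (x, z)) = f x z) \<and>
    (\<forall>c\<in>carrier F. \<forall>d\<in>carrier F. \<Phi> (c + d) = \<Phi> c + \<Phi> d) \<and> (\<forall>c\<in>K. \<Phi> c = 0)"
proof -
  define G :: "'e monoid" where "G = \<lparr>carrier = UNIV, monoid.mult = (+), one = 0\<rparr>"
  interpret G: comm_group G
    by (rule comm_groupI) (auto simp: G_def add.assoc add.commute intro: exI[of _ "- _"] left_minus)
  obtain \<Phi> where hom: "\<Phi> \<in> hom F G" and val: "\<And>x. x \<in> carrier H \<times> UNIV \<Longrightarrow> \<Phi> (frag_of x) = (\<lambda>(x, z). f x z) x"
    using G.free_Abelian_group_universal[of "\<lambda>(x, z). f x z" "carrier H \<times> UNIV"] by (auto simp: G_def)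
  have add: "\<Phi> (c + d) = \<Phi> c + \<Phi> d" if "c \<in> carrier F" "d \<in> carrier F" for c d
    using hom_mult[OF hom that] by (simp add: G_def)
  have zero: "\<Phi> 0 = 0" using add[OF F_0 F_0] by simp
  have minus: "\<Phi> (- c) = - \<Phi> c" if "c \<in> carrier F" for c
  proof -
    have "- c \<in> carrier F" using F_diff[OF F_0 that] by simp
    then show ?thesis using add[OF that, of "- c"] zero by (simp add: eq_neg_iff_add_eq_0 add.commute)
  qed
  have diff: "\<Phi> (c - d) = \<Phi> c - \<Phi> d" if "c \<in> carrier F" "d \<in> carrier F" for c d
  proof -
    have "- d \<in> carrier F" using F_diff[OF F_0 that(2)] by simp
    then show ?thesis using add[OF that(1), of "- d"] minus[OF that(2)] by simp
  qed
  have val': "\<Phi> (frag_of (x, z)) = f x z" if "x \<in> carrier H" for x z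
    using val[of "(x, z)"] that by simp
  have rel: "\<Phi> c = 0" if r: "c \<in> balanced_rels H A (one_dim_module \<psi>)" for c
  proof -
    have A: "a \<in> carrier H" if "a \<in> A" for a using that A_sub by auto
    consider (1) x y z where "c = frag_of (x \<oplus> y, z) - frag_of (x, z) - frag_of (y, z)" "x \<in> carrier H" "y \<in> carrier H"
      | (2) x z w where "c = frag_of (x, z + w) - frag_of (x, z) - frag_of (x, w)" "x \<in> carrier H"
      | (3) x a z where "c = frag_of (x \<otimes> a, z) - frag_of (x, \<psi> a * z)" "x \<in> carrier H" "a \<in> A"
      using r unfolding balanced_rels_def N_simps by blast
    then show ?thesis
    proof cases
      case 1
      have "\<Phi> c = f (x \<oplus> y) z - f x z - f y z"
        unfolding 1(1) using 1(2,3) by (simp only: diff F_diff F_of val' R.a_closed)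
      then show ?thesis using add1 1 by simp
    next
      case 2
      have "\<Phi> c = f x (z + w) - f x z - f x w"
        unfolding 2(1) using 2(2) by (simp only: diff F_diff F_of val')
      then show ?thesis using add2 2 by simp
    next
      case 3
      have "\<Phi> c = f (x \<otimes> a) z - f x (\<psi> a * z)"
        unfolding 3(1) using 3(2,3) A by (simp only: diff F_diff F_of val' R.m_closed)
      then show ?thesis using bal 3 by simp
    qed
  qed
  have "\<Phi> c = 0 \<and> c \<in> carrier F" if "c \<in> K" for c
    using that unfolding K_eq
  proof induction
    case one
    show ?case using zero F_0 by simp
  next
    case (incl c)
    then show ?case using rel rels_sub by blast
  next
    case (inv c)
    then have c: "c \<in> carrier F" using rels_sub by blast
    then have "inv\<^bsub>F\<^esub> c = - c" by simp
    then show ?case using minus[OF c] rel[OF inv] F_diff[OF F_0 c] by simp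
  next
    case (eng c d)
    then show ?case using add F_add by (simp del: carrier_free_Abelian_group_iff)
  qed
  then show ?thesis using val' add by (intro exI[of _ \<Phi>]) blast
qed

end

section \<open>Signed permutations\<close>

lemma monoid_GL: "Group.monoid (GL_group :: ('v::euclidean_space \<Rightarrow> 'v) monoid)"
  by (rule monoidI) (auto simp: GL_group_def linear_compose bij_comp comp_assoc intro: linear_compose linear_id)

lemma GL_simps: "f \<otimes>\<^bsub>GL_group\<^esub> g = f \<circ> g" "\<one>\<^bsub>GL_group\<^esub> = id"
  by (simp_all add: GL_group_def)

lemma linear_reflection: "Real_Vector_Spaces.linear (reflection \<alpha>)"
  unfolding reflection_def[abs_def] coroot_def
  by (rule linearI) (simp_all add: inner_add_right algebra_simps add_divide_distrib)

lemma reflection_reflection: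
  assumes "\<alpha> \<noteq> 0"
  shows "reflection \<alpha> (reflection \<alpha> v) = v"
  using assms by (simp add: reflection_def coroot_def inner_diff_right algebra_simps)

lemma reflection_uminus: "reflection (- \<alpha>) = reflection \<alpha>"
  by (simp add: fun_eq_iff reflection_def coroot_def)

lemma GL_inv_reflection:
  assumes "\<alpha> \<noteq> 0"
  shows "inv\<^bsub>GL_group\<^esub> (reflection \<alpha>) = reflection \<alpha>"
proof -
  have 2: "reflection \<alpha> \<circ> reflection \<alpha> = id"
    using reflection_reflection[OF assms] by auto
  then have "bij (reflection \<alpha>)" using o_bij by blast
  then have "reflection \<alpha> \<in> carrier GL_group"
    by (simp add: GL_group_def linear_reflection)
  then show ?thesis
    using monoid.inv_char[OF monoid_GL] 2 by (simp add: GL_simps)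
qed

text \<open>Reflections in nonzero vectors are involutions, so the inverses of generators are
  generators again.\<close>

lemma generate_reflection_induct [consumes 2, case_names id step comp]:
  assumes x: "x \<in> generate GL_group (reflection ` R)" and R: "0 \<notin> R"
    and id: "P id"
    and step: "\<And>\<alpha>. \<alpha> \<in> R \<Longrightarrow> P (reflection \<alpha>)"
    and comp: "\<And>x y. x \<in> generate GL_group (reflection ` R) \<Longrightarrow> y \<in> generate GL_group (reflection ` R) \<Longrightarrow> P x \<Longrightarrow> P y \<Longrightarrow> P (x \<circ> y)"
  shows "P x"
  using x
proof induction
  case one
  then show ?case using id by (simp only: GL_simps)
next
  case (incl h)
  then show ?case using step by auto
next
  case (inv h)
  then obtain \<alpha> where "\<alpha> \<in> R" "h = reflection \<alpha>" by blast
  moreover have "\<alpha> \<noteq> 0" using \<open>\<alpha> \<in> R\<close> R by auto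
  ultimately show ?case using step GL_inv_reflection by metis
next
  case (eng h1 h2)
  then show ?case using comp by (simp only: GL_simps)
qed

lemma generate_comp: "x \<in> generate GL_group S \<Longrightarrow> y \<in> generate GL_group S \<Longrightarrow> x \<circ> y \<in> generate GL_group S"
  using generate.eng[of x GL_group S y] by (simp only: GL_simps)

lemma generate_id: "id \<in> generate GL_group S"
  using generate.one[of GL_group S] by (simp only: GL_simps)

lemma generate_mono:
  assumes "0 \<notin> R" "R \<subseteq> R'"
  shows "generate GL_group (reflection ` R) \<subseteq> generate GL_group (reflection ` R')"
proof
  fix x assume "x \<in> generate GL_group (reflection ` R)"
  from this assms(1) show "x \<in> generate GL_group (reflection ` R')"
  proof (induction rule: generate_reflection_induct)
    case id
    show ?case by (rule generate_id)
  next
    case (step \<alpha>)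
    then show ?case using assms(2) by (intro generate.incl) blast
  next
    case (comp x y)
    then show ?case by (intro generate_comp)
  qed
qed

locale weyl =
  fixes n :: nat and \<epsilon> :: "nat \<Rightarrow> 'v::euclidean_space"
  assumes onb: "orthonormal_basis n \<epsilon>"
begin

lemma inner_eps: "i \<in> {1..n} \<Longrightarrow> j \<in> {1..n} \<Longrightarrow> inner (\<epsilon> i) (\<epsilon> j) = (if i = j then 1 else 0)"
  using onb by (auto simp: orthonormal_basis_def)

lemma span_eps: "Real_Vector_Spaces.span (\<epsilon> ` {1..n}) = UNIV"
  using onb by (simp add: orthonormal_basis_def)

lemma eps_neq_0: "i \<in> {1..n} \<Longrightarrow> \<epsilon> i \<noteq> 0"
  using inner_eps[of i i] by auto

lemma eps_inj: "i \<in> {1..n} \<Longrightarrow> j \<in> {1..n} \<Longrightarrow> a *\<^sub>R \<epsilon> i = b *\<^sub>R \<epsilon> j \<Longrightarrow> a \<noteq> 0 \<Longrightarrow> i = j \<and> a = b"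
  using inner_eps[of i i] inner_eps[of i j] by (metis inner_scaleR_right mult.right_neutral mult_zero_right)

lemma linear_ext:
  fixes f g :: "'v \<Rightarrow> 'b::real_vector"
  assumes "Real_Vector_Spaces.linear f" "Real_Vector_Spaces.linear g" "\<And>j. j \<in> {1..n} \<Longrightarrow> f (\<epsilon> j) = g (\<epsilon> j)"
  shows "f = g"
proof
  fix v
  show "f v = g v"
    by (rule linear_eq_on_span[OF assms(1,2), of "\<epsilon> ` {1..n}"]) (use assms(3) span_eps in auto)
qed

lemma expand: "v = (\<Sum>j\<in>{1..n}. inner v (\<epsilon> j) *\<^sub>R \<epsilon> j)"
proof -
  have "(\<lambda>v. v) = (\<lambda>v. \<Sum>j\<in>{1..n}. inner v (\<epsilon> j) *\<^sub>R \<epsilon> j)"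
  proof (rule linear_ext)
    show "Real_Vector_Spaces.linear (\<lambda>v. v :: 'v)" by (simp add: linear_id[unfolded id_def])
    show "Real_Vector_Spaces.linear (\<lambda>v. \<Sum>j\<in>{1..n}. inner v (\<epsilon> j) *\<^sub>R \<epsilon> j)"
      by (rule linearI) (simp_all add: inner_add_left scaleR_add_left sum.distrib scaleR_sum_right)
    fix i assume "i \<in> {1..n}"
    then have "(\<Sum>j\<in>{1..n}. inner (\<epsilon> i) (\<epsilon> j) *\<^sub>R \<epsilon> j) = (\<Sum>j\<in>{1..n}. if i = j then \<epsilon> i else 0)"
      by (intro sum.cong) (auto simp: inner_eps)
    then show "\<epsilon> i = (\<Sum>j\<in>{1..n}. inner (\<epsilon> i) (\<epsilon> j) *\<^sub>R \<epsilon> j)"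
      using \<open>i \<in> {1..n}\<close> by simp
  qed
  then show ?thesis by metis
qed

text \<open>The signs are normalised to \<open>1\<close> outside \<open>1..n\<close>, so that
  \<open>p\<close> and \<open>sg\<close> are determined by \<open>x\<close>
  (\<open>signed_unique\<close>).\<close>

definition signed :: "(nat \<Rightarrow> nat) \<Rightarrow> (nat \<Rightarrow> real) \<Rightarrow> ('v \<Rightarrow> 'v) \<Rightarrow> bool" where
  "signed p sg x \<longleftrightarrow> Real_Vector_Spaces.linear x \<and> p permutes {1..n} \<and>
     (\<forall>j. sg j = 1 \<or> sg j = -1) \<and> (\<forall>j. j \<notin> {1..n} \<longrightarrow> sg j = 1) \<and>
     (\<forall>j\<in>{1..n}. x (\<epsilon> j) = sg j *\<^sub>R \<epsilon> (p j))"

lemma signed_id: "signed id (\<lambda>_. 1) id"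
  by (simp add: signed_def permutes_id linear_id)

lemma signed_comp:
  assumes "signed p sg x" "signed p' sg' y"
  shows "signed (p \<circ> p') (\<lambda>j. sg' j * sg (p' j)) (x \<circ> y)"
  unfolding signed_def
proof (intro conjI ballI allI impI)
  show "Real_Vector_Spaces.linear (x \<circ> y)"
    using assms by (auto simp: signed_def intro: linear_compose)
  show "p \<circ> p' permutes {1..n}"
    using assms by (auto simp: signed_def intro: permutes_compose)
  fix j
  show "sg' j * sg (p' j) = 1 \<or> sg' j * sg (p' j) = -1"
    using assms unfolding signed_def by (metis minus_mult_minus mult.right_neutral mult_1)
  show "sg' j * sg (p' j) = 1" if "j \<notin> {1..n}"
    using assms that permutes_not_in[of p' "{1..n}" j] unfolding signed_def by simp
next
  fix j assume j: "j \<in> {1..n}"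
  then have "p' j \<in> {1..n}" using assms permutes_in_image[of p' "{1..n}" j] by (simp add: signed_def)
  then show "(x \<circ> y) (\<epsilon> j) = (sg' j * sg (p' j)) *\<^sub>R \<epsilon> ((p \<circ> p') j)"
    using assms j by (simp add: signed_def linear_scale)
qed

lemma signed_ext: "signed p sg x \<Longrightarrow> signed p sg y \<Longrightarrow> x = y"
  by (rule linear_ext) (auto simp: signed_def)

lemma signed_unique:
  assumes "signed p sg x" "signed p' sg' x"
  shows "p = p'" "sg = sg'"
proof -
  have *: "p j = p' j \<and> sg j = sg' j" for j
  proof (cases "j \<in> {1..n}")
    case True
    then have "sg j *\<^sub>R \<epsilon> (p j) = sg' j *\<^sub>R \<epsilon> (p' j)" using assms by (simp add: signed_def)
    moreover have "p j \<in> {1..n}" "p' j \<in> {1..n}" "sg j \<noteq> 0"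
      using True assms permutes_in_image[of _ "{1..n}" j] unfolding signed_def
      by (blast, blast, metis zero_neq_neg_one zero_neq_one)
    ultimately show ?thesis using eps_inj by blast
  next
    case False
    then show ?thesis using assms permutes_not_in[of _ "{1..n}" j] unfolding signed_def by metis
  qed
  show "p = p'" "sg = sg'" using * by auto
qed

definition flip :: "nat \<Rightarrow> nat \<Rightarrow> real" where "flip i j = (if j = i then -1 else 1)"

lemma signed_flip: "i \<in> {1..n} \<Longrightarrow> signed id (flip i) (reflection (\<epsilon> i))"
  by (auto simp: signed_def permutes_id linear_reflection flip_def reflection_def coroot_def inner_eps scaleR_2)

lemma root_neq_0:
  assumes "i \<in> {1..n}" "j \<in> {1..n}" "i \<noteq> j" "b = 1 \<or> b = -1"
  shows "\<epsilon> i + b *\<^sub>R \<epsilon> j \<noteq> 0"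
proof
  assume "\<epsilon> i + b *\<^sub>R \<epsilon> j = 0"
  then have "inner (\<epsilon> i) (\<epsilon> i + b *\<^sub>R \<epsilon> j) = 0" by simp
  then show False using assms by (simp add: inner_add_right inner_eps)
qed

lemma signed_root:
  assumes ij: "i \<in> {1..n}" "j \<in> {1..n}" "i \<noteq> j" and b: "b = 1 \<or> b = -1"
  shows "signed (swp i j) (\<lambda>l. if l = i \<or> l = j then - b else 1) (reflection (\<epsilon> i + b *\<^sub>R \<epsilon> j))"
  unfolding signed_def
proof (intro conjI allI ballI impI)
  show "swp i j permutes {1..n}" using ij by (intro permutes_swap_id) auto
  fix l assume l: "l \<in> {1..n}"
  have 2: "inner (\<epsilon> i + b *\<^sub>R \<epsilon> j) (\<epsilon> i + b *\<^sub>R \<epsilon> j) = 2"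
    using ij b by (auto simp: inner_add_left inner_add_right inner_diff_left inner_diff_right inner_eps)
  have "inner (\<epsilon> i + b *\<^sub>R \<epsilon> j) (\<epsilon> l) = (if l = i then 1 else if l = j then b else 0)"
    using ij l by (simp add: inner_add_left inner_eps)
  then have "reflection (\<epsilon> i + b *\<^sub>R \<epsilon> j) (\<epsilon> l) =
     \<epsilon> l - (if l = i then 1 else if l = j then b else 0) *\<^sub>R (\<epsilon> i + b *\<^sub>R \<epsilon> j)"
    by (simp add: reflection_def coroot_def 2)
  then show "reflection (\<epsilon> i + b *\<^sub>R \<epsilon> j) (\<epsilon> l) = (if l = i \<or> l = j then - b else 1) *\<^sub>R \<epsilon> (swp i j l)"
    using b ij by (auto simp: Transposition.transpose_def)
qed (use b ij linear_reflection in auto)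

lemma signed_adj:
  assumes "1 \<le> i" "i < n"
  shows "signed (swp i (Suc i)) (\<lambda>_. 1) (reflection (rootA \<epsilon> i (Suc i)))"
  using signed_root[of i "Suc i" "-1"] assms by (simp add: rootA_def cong: if_cong)

lemma R_B_cases:
  assumes "\<alpha> \<in> R_B n \<epsilon>"
  obtains i where "i \<in> {1..n}" "reflection \<alpha> = reflection (\<epsilon> i)" "\<alpha> \<noteq> 0"
  | i j b where "i \<in> {1..n}" "j \<in> {1..n}" "i < j" "b = 1 \<or> b = (-1::real)" "\<alpha> \<noteq> 0"
      "reflection \<alpha> = reflection (\<epsilon> i + b *\<^sub>R \<epsilon> j)"
proof -
  from assms consider (1) a b i j where "\<alpha> = a *\<^sub>R \<epsilon> i + b *\<^sub>R \<epsilon> j" "a \<in> {1,-1}" "b \<in> {1,-1}" "1 \<le> i" "i < j" "j \<le> n"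
    | (2) a l where "\<alpha> = a *\<^sub>R \<epsilon> l" "a \<in> {1,-1}" "l \<in> {1..n}"
    unfolding R_B_def by blast
  then show ?thesis
  proof cases
    case 1
    have e: "\<alpha> = a *\<^sub>R (\<epsilon> i + (a * b) *\<^sub>R \<epsilon> j)" using 1 by auto
    have ab: "a * b = 1 \<or> a * b = -1" using 1 by auto
    have "\<epsilon> i + (a * b) *\<^sub>R \<epsilon> j \<noteq> 0" using root_neq_0[of i j "a * b"] 1 ab by auto
    moreover from this have "\<alpha> \<noteq> 0" using e 1(2) by auto
    moreover have "reflection \<alpha> = reflection (\<epsilon> i + (a * b) *\<^sub>R \<epsilon> j)"
    proof (cases "a = 1")
      case True
      then show ?thesis using e by simp
    next
      case False
      then have "\<alpha> = - (\<epsilon> i + (a * b) *\<^sub>R \<epsilon> j)" using e 1(2) by simp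
      then show ?thesis using reflection_uminus by metis
    qed
    ultimately show ?thesis using that(2)[of i j "a * b"] 1(4-6) ab by simp
  next
    case 2
    have "reflection \<alpha> = reflection (\<epsilon> l)" using 2 reflection_uminus by auto
    then show ?thesis using that(1)[of l] 2 eps_neq_0[OF 2(3)] by auto
  qed
qed

lemma zero_notin: "0 \<notin> R_B n \<epsilon>" "0 \<notin> R_A n \<epsilon>" "0 \<notin> \<epsilon> ` {1..n}"
proof -
  show "0 \<notin> R_B n \<epsilon>" using R_B_cases by metis
  show "0 \<notin> R_A n \<epsilon>" unfolding R_A_def rootA_def using root_neq_0[of _ _ "-1"] by force
  show "0 \<notin> \<epsilon> ` {1..n}" using eps_neq_0 by force
qed

lemma W_B_signed:
  assumes "x \<in> W_B n \<epsilon>"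
  shows "\<exists>p sg. signed p sg x"
  using assms zero_notin(1) unfolding W_B_def
proof (induction rule: generate_reflection_induct)
  case (step \<alpha>)
  then show ?case
  proof (cases rule: R_B_cases)
    case (1 i)
    show ?thesis unfolding 1(2) using signed_flip[OF 1(1)] by blast
  next
    case (2 i j b)
    show ?thesis unfolding 2(6) using signed_root[OF 2(1,2) _ 2(4)] 2(3) by blast
  qed
qed (use signed_id signed_comp in blast)+

lemma W_A_signed:
  assumes "x \<in> W_A n \<epsilon>"
  shows "\<exists>p. signed p (\<lambda>_. 1) x"
  using assms zero_notin(2) unfolding W_A_def
proof (induction rule: generate_reflection_induct)
  case (step \<alpha>)
  then obtain i j where "\<alpha> = \<epsilon> i - \<epsilon> j" "i \<in> {1..n}" "j \<in> {1..n}" "i \<noteq> j" by (auto simp: R_A_def rootA_def)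
  then show ?case using signed_root[of i j "-1"] by (auto cong: if_cong)
next
  case (comp x y)
  then obtain p p' where "signed p (\<lambda>_. 1) x" "signed p' (\<lambda>_. 1) y" by blast
  from signed_comp[OF this] show ?case unfolding mult_1 by blast
qed (use signed_id in blast)

lemma R_A_sub: "R_A n \<epsilon> \<subseteq> R_B n \<epsilon>"
proof
  fix \<alpha> assume "\<alpha> \<in> R_A n \<epsilon>"
  then obtain i j where ij: "\<alpha> = \<epsilon> i - \<epsilon> j" "i \<in> {1..n}" "j \<in> {1..n}" "i \<noteq> j" by (auto simp: R_A_def rootA_def)
  have e: "\<alpha> = 1 *\<^sub>R \<epsilon> i + (-1) *\<^sub>R \<epsilon> j" "\<alpha> = (-1) *\<^sub>R \<epsilon> j + 1 *\<^sub>R \<epsilon> i" using ij by auto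
  have r: "1 \<le> i" "1 \<le> j" "i \<le> n" "j \<le> n" using ij by auto
  have "i < j \<or> j < i" using ij(4) by linarith
  then show "\<alpha> \<in> R_B n \<epsilon>"
  proof
    assume "i < j"
    then show ?thesis unfolding e(1) R_B_def using r by blast
  next
    assume "j < i"
    then show ?thesis unfolding e(2) R_B_def using r by blast
  qed
qed

lemma eps_sub: "\<epsilon> ` {1..n} \<subseteq> R_B n \<epsilon>"
proof
  fix \<alpha> assume "\<alpha> \<in> \<epsilon> ` {1..n}"
  then obtain l where "\<alpha> = 1 *\<^sub>R \<epsilon> l" "l \<in> {1..n}" by auto
  then show "\<alpha> \<in> R_B n \<epsilon>" unfolding R_B_def by blast
qed

lemma W_A_sub: "W_A n \<epsilon> \<subseteq> W_B n \<epsilon>" and T_sub: "T_grp n \<epsilon> \<subseteq> W_B n \<epsilon>"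
  unfolding W_A_def W_B_def T_grp_def
  using generate_mono[OF zero_notin(2) R_A_sub] generate_mono[OF zero_notin(3) eps_sub] by auto

lemma refl_T: "i \<in> {1..n} \<Longrightarrow> reflection (\<epsilon> i) \<in> T_grp n \<epsilon>"
  unfolding T_grp_def by (rule generate.incl) blast

lemma refl_W_A: "1 \<le> i \<Longrightarrow> i < n \<Longrightarrow> reflection (rootA \<epsilon> i (Suc i)) \<in> W_A n \<epsilon>"
  unfolding W_A_def R_A_def by (rule generate.incl) force

lemma W_comp: "x \<in> W_B n \<epsilon> \<Longrightarrow> y \<in> W_B n \<epsilon> \<Longrightarrow> x \<circ> y \<in> W_B n \<epsilon>"
  "x \<in> W_A n \<epsilon> \<Longrightarrow> y \<in> W_A n \<epsilon> \<Longrightarrow> x \<circ> y \<in> W_A n \<epsilon>"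
  "x \<in> T_grp n \<epsilon> \<Longrightarrow> y \<in> T_grp n \<epsilon> \<Longrightarrow> x \<circ> y \<in> T_grp n \<epsilon>"
  "id \<in> W_B n \<epsilon>" "id \<in> W_A n \<epsilon>" "id \<in> T_grp n \<epsilon>"
  unfolding W_B_def W_A_def T_grp_def by (auto intro: generate_comp generate_id)

lemma W_A_ex:
  assumes "p permutes {1..n}"
  shows "\<exists>x\<in>W_A n \<epsilon>. signed p (\<lambda>_. 1) x"
  using assms
proof (induction rule: permutes_adj_induct)
  case id
  then show ?case using signed_id W_comp(5) by blast
next
  case (adj i q)
  then obtain x where x: "x \<in> W_A n \<epsilon>" "signed q (\<lambda>_. 1) x" by blast
  let ?r = "reflection (rootA \<epsilon> i (Suc i))"
  have "?r \<circ> x \<in> W_A n \<epsilon>" using refl_W_A[OF adj(1,2)] x W_comp(2) by blast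
  moreover have "signed (swp i (Suc i) \<circ> q) (\<lambda>_. 1) (?r \<circ> x)"
    using signed_comp[OF signed_adj[OF adj(1,2)] x(2)] by (simp only: mult_1)
  ultimately show ?case by blast
qed

lemma T_signed:
  assumes "x \<in> T_grp n \<epsilon>"
  shows "\<exists>sg. signed id sg x"
  using assms zero_notin(3) unfolding T_grp_def
proof (induction rule: generate_reflection_induct)
  case (step \<alpha>)
  then obtain i where "i \<in> {1..n}" "\<alpha> = \<epsilon> i" by blast
  then show ?case using signed_flip by metis
next
  case (comp x y)
  then obtain sg sg' where "signed id sg x" "signed id sg' y" by blast
  from signed_comp[OF this] show ?case unfolding comp_id by blast
qed (use signed_id in blast)

lemma signed_T:
  assumes "signed id sg x"
  shows "x \<in> T_grp n \<epsilon>"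
proof -
  have "\<exists>y\<in>T_grp n \<epsilon>. signed id (\<lambda>j. if j \<in> J then -1 else 1) y" if "finite J" "J \<subseteq> {1..n}" for J
    using that
  proof (induction J)
    case empty
    have "(\<lambda>j. if j \<in> {} then -1 else 1) = (\<lambda>_ :: nat. 1 :: real)" by simp
    then show ?case using signed_id W_comp(6) by metis
  next
    case (insert i J)
    then obtain y where y: "y \<in> T_grp n \<epsilon>" "signed id (\<lambda>j. if j \<in> J then -1 else 1) y" by blast
    have i: "i \<in> {1..n}" using insert by simp
    have "signed (id \<circ> id) (\<lambda>j. (if j \<in> J then -1 else 1) * flip i (id j)) (reflection (\<epsilon> i) \<circ> y)"
      by (rule signed_comp[OF signed_flip[OF i] y(2)])
    moreover have "(\<lambda>j. (if j \<in> J then -1 else 1) * flip i (id j)) = (\<lambda>j. if j \<in> insert i J then -1 else 1)"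
      using insert(2) by (auto simp: flip_def fun_eq_iff)
    ultimately have "signed id (\<lambda>j. if j \<in> insert i J then -1 else 1) (reflection (\<epsilon> i) \<circ> y)"
      by (metis comp_id)
    then show ?case using W_comp(3)[OF refl_T[OF i] y(1)] by blast
  qed
  moreover have "finite {j \<in> {1..n}. sg j = -1}" "{j \<in> {1..n}. sg j = -1} \<subseteq> {1..n}" by auto
  ultimately obtain y where
    y: "y \<in> T_grp n \<epsilon>" "signed id (\<lambda>j. if j \<in> {j \<in> {1..n}. sg j = -1} then -1 else 1) y" by blast
  have "(\<lambda>j. if j \<in> {j \<in> {1..n}. sg j = -1} then -1 else 1) = sg"
    using assms unfolding signed_def fun_eq_iff by (metis (mono_tags, lifting) mem_Collect_eq)
  then show ?thesis using signed_ext[OF assms] y by metis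
qed

text \<open>The element of \<open>W\<^sub>A\<close> that permutes the basis by \<open>iv
  p\<close> is a two-sided inverse of \<open>w\<close>, hence equal to the inverse
  function.\<close>

lemma W_A_inverse:
  assumes "w \<in> W_A n \<epsilon>" "signed p (\<lambda>_. 1) w"
  shows "iv w \<in> W_A n \<epsilon>" "signed (iv p) (\<lambda>_. 1) (iv w)" "w \<circ> iv w = id" "iv w \<circ> w = id"
proof -
  have p: "p permutes {1..n}" using assms(2) by (simp add: signed_def)
  obtain y where y: "y \<in> W_A n \<epsilon>" "signed (iv p) (\<lambda>_. 1) y" using W_A_ex[OF permutes_inv[OF p]] by blast
  have "signed id (\<lambda>_. 1) (w \<circ> y)" "signed id (\<lambda>_. 1) (y \<circ> w)"
    using signed_comp[OF assms(2) y(2)] signed_comp[OF y(2) assms(2)]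
    unfolding mult_1 permutes_inv_o[OF p] by auto
  then have e: "w \<circ> y = id" "y \<circ> w = id" using signed_ext signed_id by blast+
  then have "iv w = y" using inv_unique_comp by blast
  then show "iv w \<in> W_A n \<epsilon>" "signed (iv p) (\<lambda>_. 1) (iv w)" "w \<circ> iv w = id" "iv w \<circ> w = id"
    using y e by auto
qed

end

section \<open>Evaluation of noncommutative polynomials\<close>

lemma sum_single: "p = (\<Sum>u\<in>Poly_Mapping.keys p. Poly_Mapping.single u (Poly_Mapping.lookup p u))"
proof (rule poly_mapping_eqI)
  fix v
  have "(\<Sum>u\<in>Poly_Mapping.keys p. Poly_Mapping.lookup (Poly_Mapping.single u (Poly_Mapping.lookup p u)) v) =
      (\<Sum>u\<in>Poly_Mapping.keys p. if u = v then Poly_Mapping.lookup p v else 0)"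
    by (rule sum.cong) (auto simp: lookup_single)
  also have "\<dots> = Poly_Mapping.lookup p v"
    by (auto simp: in_keys_iff)
  finally show "Poly_Mapping.lookup p v =
      Poly_Mapping.lookup (\<Sum>u\<in>Poly_Mapping.keys p. Poly_Mapping.single u (Poly_Mapping.lookup p u)) v"
    by (simp add: lookup_sum)
qed

lemma single_word: "Poly_Mapping.single (Word (g # gs)) c = gen g * Poly_Mapping.single (Word gs) c"
  by (simp add: gen_def mult_single plus_word_def)

lemma single_empty: "Poly_Mapping.single (Word []) c = scalar c"
  by (simp add: scalar_def zero_word_def)

lemma free_algebra_simps [simp]:
  "x \<oplus>\<^bsub>free_algebra G\<^esub> y = x + y" "x \<otimes>\<^bsub>free_algebra G\<^esub> y = x * y"
  "\<zero>\<^bsub>free_algebra G\<^esub> = 0" "\<one>\<^bsub>free_algebra G\<^esub> = 1"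
  by (simp_all add: free_algebra_def)

text \<open>The free algebra is generated by its generators and the scalars.\<close>

lemma ncpoly_induct [consumes 1, case_names scalar gen add mult]:
  assumes p: "p \<in> carrier (free_algebra G)"
    and sc: "\<And>c. P (scalar c)" and g: "\<And>g. g \<in> G \<Longrightarrow> P (gen g)"
    and add: "\<And>p q. p \<in> carrier (free_algebra G) \<Longrightarrow> q \<in> carrier (free_algebra G) \<Longrightarrow> P p \<Longrightarrow> P q \<Longrightarrow> P (p + q)"
    and mult: "\<And>p q. p \<in> carrier (free_algebra G) \<Longrightarrow> q \<in> carrier (free_algebra G) \<Longrightarrow> P p \<Longrightarrow> P q \<Longrightarrow> P (p * q)"
  shows "P p"
proof -
  interpret ring "free_algebra G" by (rule ring_free_algebra)
  have w: "P (Poly_Mapping.single (Word gs) c) \<and> Poly_Mapping.single (Word gs) c \<in> carrier (free_algebra G)"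
    if "gs \<in> lists G" for gs c
    using that
  proof (induction gs)
    case Nil
    then show ?case unfolding single_empty by (simp add: sc) (simp add: scalar_def free_algebra_def zero_word_def)
  next
    case (Cons g' gs)
    then have "gen g' \<in> carrier (free_algebra G)" by (auto simp: gen_def free_algebra_def)
    then show ?case unfolding single_word using Cons mult[of "gen g'"] g m_closed by auto
  qed
  have z: "P 0 \<and> 0 \<in> carrier (free_algebra G)"
    using sc[of 0] zero_closed by (simp add: scalar_def)
  have "P (\<Sum>u\<in>A. Poly_Mapping.single u (Poly_Mapping.lookup p u)) \<and>
      (\<Sum>u\<in>A. Poly_Mapping.single u (Poly_Mapping.lookup p u)) \<in> carrier (free_algebra G)"
    if "A \<subseteq> Poly_Mapping.keys p" for A
    using that
  proof (induction A rule: infinite_finite_induct)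
    case (insert u A)
    have "letters u \<in> lists G" using p insert by (auto simp: free_algebra_def)
    from w[OF this, of "Poly_Mapping.lookup p u"] insert show ?case
      using add a_closed by auto
  qed (use z in auto)
  then show ?thesis using sum_single[of p] by (metis subset_refl)
qed

definition wact :: "('g \<Rightarrow> pfun \<Rightarrow> pfun) \<Rightarrow> 'g word \<Rightarrow> pfun \<Rightarrow> pfun" where
  "wact \<theta> u = foldr \<theta> (letters u)"

text \<open>The extension of an assignment of operators to generators to the free algebra; the
  last letter of a word acts first.\<close>

definition ev :: "('g \<Rightarrow> pfun \<Rightarrow> pfun) \<Rightarrow> 'g ncpoly \<Rightarrow> pfun \<Rightarrow> pfun" where
  "ev \<theta> p f = (\<Sum>u\<in>Poly_Mapping.keys p. cmul (Poly_Mapping.lookup p u) (wact \<theta> u f))"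

lemma cmul_add_left: "cmul (c + d) f = cmul c f + cmul d f"
  by (auto simp: cmul_def fun_eq_iff algebra_simps)

lemma ev_superset:
  assumes "finite A" "Poly_Mapping.keys p \<subseteq> A"
  shows "ev \<theta> p f = (\<Sum>u\<in>A. cmul (Poly_Mapping.lookup p u) (wact \<theta> u f))"
  unfolding ev_def by (rule sum.mono_neutral_left) (use assms in \<open>auto simp: in_keys_iff\<close>)

lemma ev_add: "ev \<theta> (p + q) f = ev \<theta> p f + ev \<theta> q f"
proof -
  let ?A = "Poly_Mapping.keys p \<union> Poly_Mapping.keys q"
  have "ev \<theta> (p + q) f = (\<Sum>u\<in>?A. cmul (Poly_Mapping.lookup (p + q) u) (wact \<theta> u f))"
    by (rule ev_superset) (auto simp: Poly_Mapping.keys_add)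
  also have "\<dots> = (\<Sum>u\<in>?A. cmul (Poly_Mapping.lookup p u) (wact \<theta> u f)) + (\<Sum>u\<in>?A. cmul (Poly_Mapping.lookup q u) (wact \<theta> u f))"
    unfolding lookup_add cmul_add_left sum.distrib ..
  also have "\<dots> = ev \<theta> p f + ev \<theta> q f"
    by (simp only: ev_superset[of ?A p] ev_superset[of ?A q] finite_UnI finite_keys Un_upper1 Un_upper2)
  finally show ?thesis .
qed

lemma ev_single: "ev \<theta> (Poly_Mapping.single u c) f = cmul c (wact \<theta> u f)"
proof -
  have "ev \<theta> (Poly_Mapping.single u c) f = (\<Sum>v\<in>{u}. cmul (Poly_Mapping.lookup (Poly_Mapping.single u c) v) (wact \<theta> v f))"
    by (rule ev_superset) auto
  then show ?thesis by simp
qed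

lemma ev_0: "ev \<theta> 0 f = 0" by (simp add: ev_def)

lemma ev_sum: "ev \<theta> (sum g I) f = (\<Sum>i\<in>I. ev \<theta> (g i) f)"
  by (induction I rule: infinite_finite_induct) (simp_all only: sum.infinite sum.empty sum.insert not_False_eq_True ev_0 ev_add)

lemma ev_uminus: "ev \<theta> (- p) f = - ev \<theta> p f"
proof -
  have "ev \<theta> (- p) f + ev \<theta> p f = 0" unfolding ev_add[symmetric] by (simp add: ev_0)
  then show ?thesis by (simp only: eq_neg_iff_add_eq_0)
qed

lemma ev_diff: "ev \<theta> (p - q) f = ev \<theta> p f - ev \<theta> q f"
  unfolding diff_conv_add_uminus ev_add ev_uminus ..

lemma ev_scalar: "ev \<theta> (scalar c) f = cmul c f"
  by (simp add: scalar_def ev_single wact_def zero_word_def)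

lemma ev_1: "ev \<theta> 1 f = f"
  using ev_scalar[of \<theta> 1 f] by (simp add: scalar_def)

lemma ev_gen: "ev \<theta> (gen g) f = \<theta> g f"
  by (simp add: gen_def ev_single wact_def)

lemma lin_wact: "(\<And>g. lin cmul (\<theta> g)) \<Longrightarrow> lin cmul (wact \<theta> u)"
proof -
  assume "\<And>g. lin cmul (\<theta> g)"
  then have "lin cmul (foldr \<theta> gs)" for gs
    by (induction gs) (auto simp: lin_def)
  then show ?thesis by (simp add: wact_def)
qed

lemma lin_ev:
  assumes "\<And>g. lin cmul (\<theta> g)"
  shows "lin cmul (ev \<theta> p)"
proof -
  have L: "lin cmul (wact \<theta> u)" for u using lin_wact[of \<theta> u] assms by blast
  show ?thesis
    unfolding lin_def ev_def
    by (simp only: lin_add[OF L] lin_cm[OF L] cmul_simps sum.distrib mult.commute simp_thms)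
      (simp only: lin_sum[of cmul "cmul _", OF _ ] lin_def cmul_simps mult.commute simp_thms)
qed

lemma ev_mult:
  assumes "\<And>g. lin cmul (\<theta> g)"
  shows "ev \<theta> (p * q) f = ev \<theta> p (ev \<theta> q f)"
proof -
  have L: "lin cmul (wact \<theta> u)" for u using lin_wact[of \<theta> u] assms by blast
  let ?s = "\<lambda>p u. Poly_Mapping.single u (Poly_Mapping.lookup p u)"
  have "p * q = (\<Sum>u\<in>Poly_Mapping.keys p. \<Sum>v\<in>Poly_Mapping.keys q. ?s p u * ?s q v)"
    by (subst sum_single[of p], subst sum_single[of q]) (simp only: sum_product)
  then have "ev \<theta> (p * q) f = (\<Sum>u\<in>Poly_Mapping.keys p. \<Sum>v\<in>Poly_Mapping.keys q. ev \<theta> (?s p u * ?s q v) f)"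
    by (simp only: ev_sum)
  also have "\<dots> = (\<Sum>u\<in>Poly_Mapping.keys p. \<Sum>v\<in>Poly_Mapping.keys q. ev \<theta> (?s p u) (ev \<theta> (?s q v) f))"
  proof -
    have "wact \<theta> (u + v) f = wact \<theta> u (wact \<theta> v f)" for u v
      by (simp add: wact_def plus_word_def)
    then have "ev \<theta> (?s p u * ?s q v) f = ev \<theta> (?s p u) (ev \<theta> (?s q v) f)" for u v
      unfolding mult_single ev_single lin_cm[OF L] cmul_simps by simp
    then show ?thesis by (simp only:)
  qed
  also have "\<dots> = (\<Sum>u\<in>Poly_Mapping.keys p. ev \<theta> (?s p u) (\<Sum>v\<in>Poly_Mapping.keys q. ev \<theta> (?s q v) f))"
    by (simp only: lin_sum[OF lin_ev[OF assms]])
  also have "\<dots> = ev \<theta> p (ev \<theta> q f)"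
    by (simp only: ev_sum[symmetric] sum_single[symmetric])
  finally show ?thesis .
qed

section \<open>The operators attached to the generators\<close>

locale hecke_data = weyl n \<epsilon> for n :: nat and \<epsilon> :: "nat \<Rightarrow> 'v::euclidean_space" +
  fixes k :: complex and \<gamma> :: "'v complexified \<Rightarrow> complex" and \<mu> :: "('v \<Rightarrow> 'v) \<Rightarrow> complex"
  assumes \<gamma>: "\<gamma> \<in> dual_VC" and \<mu>: "\<mu> \<in> T_dual n \<epsilon>"
begin

definition lam :: "nat \<Rightarrow> complex" where "lam j = \<gamma> (of_V (\<epsilon> j))"
definition nu :: "nat \<Rightarrow> complex" where "nu j = \<mu> (reflection (\<epsilon> j))"

lemma \<mu>_comp: "w \<in> T_grp n \<epsilon> \<Longrightarrow> w' \<in> T_grp n \<epsilon> \<Longrightarrow> \<mu> (w \<circ> w') = \<mu> w * \<mu> w'"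
  using \<mu> unfolding T_dual_def hom_def by (simp add: GL_group_def)

lemma \<mu>_neq_0: "w \<in> T_grp n \<epsilon> \<Longrightarrow> \<mu> w \<noteq> 0"
  using \<mu> unfolding T_dual_def hom_def by auto

lemma \<mu>_id: "\<mu> id = 1"
  using \<mu>_comp[OF W_comp(6) W_comp(6)] \<mu>_neq_0[OF W_comp(6)] by simp

lemma nu_pm1:
  assumes "j \<in> {1..n}"
  shows "nu j = 1 \<or> nu j = -1"
proof -
  have "reflection (\<epsilon> j) \<circ> reflection (\<epsilon> j) = id"
    using reflection_reflection[OF eps_neq_0[OF assms]] by auto
  then have "nu j * nu j = 1"
    using \<mu>_comp[OF refl_T refl_T, OF assms assms] \<mu>_id by (simp add: nu_def)
  then show ?thesis by (simp add: square_eq_1_iff)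
qed

sublocale hm: hecke_model n k lam nu
  by standard (use nu_pm1 in auto)

lemma \<gamma>_linear: "\<gamma> (u + v) = \<gamma> u + \<gamma> v" "\<gamma> (scaleC c u) = c * \<gamma> u"
proof -
  interpret Vector_Spaces.linear scaleC "(*)" \<gamma> using \<gamma> by (simp add: dual_VC_def)
  show "\<gamma> (u + v) = \<gamma> u + \<gamma> v" "\<gamma> (scaleC c u) = c * \<gamma> u" by (simp_all add: add scale)
qed

definition coord :: "'v complexified \<Rightarrow> nat \<Rightarrow> complex" where
  "coord \<zeta> j = Complex (inner (fst \<zeta>) (\<epsilon> j)) (inner (snd \<zeta>) (\<epsilon> j))"

lemma coord_add: "coord (u + v) j = coord u j + coord v j"
  and coord_scale: "coord (scaleC c u) j = c * coord u j"
  and coord_of_V: "coord (of_V a) j = complex_of_real (inner a (\<epsilon> j))"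
  by (auto simp: coord_def scaleC_def of_V_def inner_add_left inner_diff_left complex_eq_iff)

lemma \<gamma>_expand: "\<gamma> \<zeta> = (\<Sum>j\<in>{1..n}. coord \<zeta> j * lam j)"
proof -
  have re: "\<gamma> (of_V v) = (\<Sum>j\<in>{1..n}. complex_of_real (inner v (\<epsilon> j)) * lam j)" for v
  proof -
    have 0: "\<gamma> (of_V 0) = 0"
      using \<gamma>_linear(2)[of 0 "of_V 0"] by (simp add: scaleC_def of_V_def)
    have "\<gamma> (of_V (\<Sum>j\<in>A. c j *\<^sub>R \<epsilon> j)) = (\<Sum>j\<in>A. complex_of_real (c j) * lam j)" if "finite A" for A c
      using that
    proof induction
      case (insert j A)
      have "of_V (c j *\<^sub>R \<epsilon> j + (\<Sum>j\<in>A. c j *\<^sub>R \<epsilon> j)) =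
          scaleC (complex_of_real (c j)) (of_V (\<epsilon> j)) + of_V (\<Sum>j\<in>A. c j *\<^sub>R \<epsilon> j)"
        by (simp add: of_V_def scaleC_def)
      then show ?case using insert by (simp add: \<gamma>_linear lam_def)
    qed (simp add: 0)
    then show ?thesis by (subst expand[of v]) simp
  qed
  have "\<zeta> = of_V (fst \<zeta>) + scaleC \<i> (of_V (snd \<zeta>))"
    by (cases \<zeta>) (simp add: of_V_def scaleC_def)
  then have "\<gamma> \<zeta> = \<gamma> (of_V (fst \<zeta>)) + \<i> * \<gamma> (of_V (snd \<zeta>))" by (metis \<gamma>_linear)
  also have "\<dots> = (\<Sum>j\<in>{1..n}. coord \<zeta> j * lam j)"
    unfolding re sum_distrib_left sum.distrib[symmetric]
    by (rule sum.cong) (auto simp: coord_def complex_eq_iff algebra_simps)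
  finally show ?thesis .
qed

text \<open>A vector acts through the operators \<open>x\<^sub>j\<close> according to its
  coordinates.\<close>

definition Vop :: "'v complexified \<Rightarrow> pfun \<Rightarrow> pfun" where
  "Vop \<zeta> f = (\<Sum>j\<in>{1..n}. cmul (coord \<zeta> j) (hm.x j f))"

text \<open>The product of the \<open>t\<^sub>j\<close> over all \<open>j\<close> with sign
  \<open>-1\<close>.\<close>

definition TTop :: "(nat \<Rightarrow> real) \<Rightarrow> pfun \<Rightarrow> pfun" where
  "TTop sg f = (\<lambda>q. if q permutes {1..n} then (\<Prod>j\<in>{1..n}. if sg j = -1 then nu (iv q j) else 1) * f q else f q)"

definition prm :: "('v \<Rightarrow> 'v) \<Rightarrow> nat \<Rightarrow> nat" where "prm w = (THE p. \<exists>sg. signed p sg w)"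
definition sgn_of :: "('v \<Rightarrow> 'v) \<Rightarrow> nat \<Rightarrow> real" where "sgn_of w = (THE sg. \<exists>p. signed p sg w)"

lemma prm_sgn: "signed p sg w \<Longrightarrow> prm w = p" "signed p sg w \<Longrightarrow> sgn_of w = sg"
  unfolding prm_def sgn_of_def using signed_unique by blast+

text \<open>Every \<open>w \<in> W\<^sub>B\<close> is uniquely a sign change followed by a
  permutation of the basis; outside \<open>W\<^sub>B\<close> the description of
  \<open>prm\<close> and \<open>sgn_of\<close> is not meaningful.\<close>

definition Wop :: "('v \<Rightarrow> 'v) \<Rightarrow> pfun \<Rightarrow> pfun" where
  "Wop w f = Sop n (prm w) (TTop (sgn_of w) f)"

lemma Wop_signed: "signed p sg w \<Longrightarrow> Wop w f = Sop n p (TTop sg f)"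
  by (simp add: Wop_def prm_sgn)

definition theta :: "'v hgen \<Rightarrow> pfun \<Rightarrow> pfun" where
  "theta g = (case g of Vec \<zeta> \<Rightarrow> Vop \<zeta> | Grp w \<Rightarrow> Wop w)"

lemma lin_TTop: "lin cmul (TTop sg)"
  by (auto simp: lin_def TTop_def cmul_def fun_eq_iff algebra_simps)

lemma lin_Wop: "lin cmul (Wop w)"
  by (simp only: lin_def Wop_def lin_add[OF lin_TTop] lin_add[OF lin_Sop] lin_cm[OF lin_TTop] lin_cm[OF lin_Sop] simp_thms)

lemma lin_Vop: "lin cmul (Vop \<zeta>)"
  unfolding lin_def Vop_def hm.lin_rules
  by (auto simp: sum.distrib hm.lin_rules lin_sum[OF hm.lin_cmul] mult.commute)

lemma lin_theta: "lin cmul (theta g)"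
  by (cases g) (simp_all add: theta_def lin_Wop lin_Vop)

lemma TTop_one: "TTop (\<lambda>_. 1) f = f"
  by (simp add: TTop_def fun_eq_iff)

lemma TTop_flip: "j \<in> {1..n} \<Longrightarrow> TTop (flip j) f = hm.t j f"
proof
  fix q assume j: "j \<in> {1..n}"
  have "(\<Prod>l\<in>{1..n}. if flip j l = -1 then nu (iv q l) else 1) = (\<Prod>l\<in>{1..n}. if l = j then nu (iv q j) else 1)"
    by (rule prod.cong) (auto simp: flip_def)
  also have "\<dots> = nu (iv q j)" using j by simp
  finally show "TTop (flip j) f q = hm.t j f q" by (simp add: TTop_def Top_def)
qed

lemma TTop_TTop:
  assumes "\<And>j. sg j = 1 \<or> sg j = -1" "\<And>j. sg' j = 1 \<or> sg' j = -1"
  shows "TTop sg (TTop sg' f) = TTop (\<lambda>j. sg' j * sg j) f"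
proof
  fix q
  show "TTop sg (TTop sg' f) q = TTop (\<lambda>j. sg' j * sg j) f q"
  proof (cases "q permutes {1..n}")
    case True
    have "(if sg j = -1 then nu (iv q j) else 1) * (if sg' j = -1 then nu (iv q j) else 1) =
        (if sg' j * sg j = -1 then nu (iv q j) else 1)" if "j \<in> {1..n}" for j
    proof -
      have "nu (iv q j) * nu (iv q j) = 1"
        using hm.nu_sq hm.iv_in[OF True] that by simp
      then show ?thesis using assms(1)[of j] assms(2)[of j] by (elim disjE) simp_all
    qed
    then have "(\<Prod>j\<in>{1..n}. if sg j = -1 then nu (iv q j) else 1) * (\<Prod>j\<in>{1..n}. if sg' j = -1 then nu (iv q j) else 1) =
       (\<Prod>j\<in>{1..n}. if sg' j * sg j = -1 then nu (iv q j) else 1)"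
      unfolding prod.distrib[symmetric] by (rule prod.cong[OF refl])
    then show ?thesis using True by (simp add: TTop_def mult.assoc[symmetric])
  qed (simp add: TTop_def)
qed

lemma TTop_Sop:
  assumes p: "p permutes {1..n}"
  shows "TTop sg (Sop n p f) = Sop n p (TTop (\<lambda>j. sg (p j)) f)"
proof
  fix q
  show "TTop sg (Sop n p f) q = Sop n p (TTop (\<lambda>j. sg (p j)) f) q"
  proof (cases "q permutes {1..n}")
    case True
    have pq: "iv p \<circ> q permutes {1..n}" using permutes_compose[OF True permutes_inv[OF p]] .
    have "iv (iv p \<circ> q) j = iv q (p j)" for j
      using iv_comp[OF permutes_inv[OF p] True] permutes_inv_inv[OF p] by simp
    then have "(\<Prod>j\<in>{1..n}. if sg (p j) = -1 then nu (iv (iv p \<circ> q) j) else 1) =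
        (\<Prod>j\<in>{1..n}. (\<lambda>j. if sg j = -1 then nu (iv q j) else 1) (p j))"
      by (simp cong: if_cong)
    also have "\<dots> = (\<Prod>j\<in>{1..n}. if sg j = -1 then nu (iv q j) else 1)"
      using prod.permute[OF p, of "\<lambda>j. if sg j = -1 then nu (iv q j) else 1"] by (simp add: comp_def)
    finally show ?thesis using True pq by (simp add: TTop_def Sop_def)
  qed (simp add: TTop_def Sop_def)
qed

lemma Wop_comp:
  assumes "w \<in> W_B n \<epsilon>" "w' \<in> W_B n \<epsilon>"
  shows "Wop w (Wop w' f) = Wop (w \<circ> w') f"
proof -
  obtain p sg p' sg' where 1: "signed p sg w" and 2: "signed p' sg' w'"
    using W_B_signed[OF assms(1)] W_B_signed[OF assms(2)] by blast
  have p: "p permutes {1..n}" "p' permutes {1..n}" and s: "\<And>j. sg j = 1 \<or> sg j = -1" "\<And>j. sg' j = 1 \<or> sg' j = -1"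
    using 1 2 by (auto simp: signed_def)
  show ?thesis
    unfolding Wop_signed[OF 1] Wop_signed[OF 2] Wop_signed[OF signed_comp[OF 1 2]] TTop_Sop[OF p(2)]
      Sop_Sop[OF p] by (subst TTop_TTop) (use s in auto)
qed

lemma Wop_id: "Wop id f = f"
  unfolding Wop_signed[OF signed_id] TTop_one Sop_id ..

lemma Wop_flip: "j \<in> {1..n} \<Longrightarrow> Wop (reflection (\<epsilon> j)) f = hm.t j f"
  unfolding Wop_signed[OF signed_flip] TTop_flip Sop_id ..

lemma Wop_adj: "1 \<le> i \<Longrightarrow> i < n \<Longrightarrow> Wop (reflection (rootA \<epsilon> i (Suc i))) f = hm.s i f"
  unfolding Wop_signed[OF signed_adj] TTop_one ..

lemma Wop_T_x:
  assumes "w \<in> T_grp n \<epsilon>" "j \<in> {1..n}"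
  shows "Wop w (hm.x j f) = hm.x j (Wop w f)"
  using assms(1) zero_notin(3) unfolding T_grp_def
proof (induction arbitrary: f rule: generate_reflection_induct)
  case id
  show ?case unfolding Wop_id ..
next
  case (step \<alpha>)
  then obtain i where i: "i \<in> {1..n}" "\<alpha> = \<epsilon> i" by blast
  show ?case unfolding i(2) Wop_flip[OF i(1)] using i assms(2) by (intro hm.t_x) auto
next
  case (comp w w')
  then have "w \<in> W_B n \<epsilon>" "w' \<in> W_B n \<epsilon>" using T_sub unfolding T_grp_def by blast+
  from Wop_comp[OF this] show ?case by (metis comp(3,4))
qed

lemma Wop_T_Vop:
  assumes "w \<in> T_grp n \<epsilon>"
  shows "Wop w (Vop \<zeta> f) = Vop \<zeta> (Wop w f)"
  unfolding Vop_def lin_sum[OF lin_Wop] by (rule sum.cong[OF refl]) (simp only: lin_cm[OF lin_Wop] Wop_T_x[OF assms])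

lemma Vop_add: "Vop (u + v) f = Vop u f + Vop v f"
  by (simp only: Vop_def coord_add cmul_add_left sum.distrib)

lemma Vop_scale: "Vop (scaleC c u) f = cmul c (Vop u f)"
  by (simp only: Vop_def coord_scale lin_sum[OF hm.lin_cmul] cmul_simps)

lemma Vop_comm: "Vop u (Vop v f) = Vop v (Vop u f)"
proof -
  have *: "Vop u (Vop v f) = (\<Sum>i\<in>{1..n}. \<Sum>j\<in>{1..n}. cmul (coord u i * coord v j) (hm.x i (hm.x j f)))" for u v
    by (simp only: Vop_def lin_sum[OF hm.lin_x] lin_sum[OF hm.lin_cmul] hm.lin_rules cmul_simps)
  have "Vop u (Vop v f) = (\<Sum>i\<in>{1..n}. \<Sum>j\<in>{1..n}. cmul (coord v i * coord u j) (hm.x i (hm.x j f)))"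
    by (subst *, subst sum.swap, intro sum.cong refl) (simp add: hm.x_comm mult.commute)
  then show ?thesis by (simp only: *)
qed

lemma Vop_eps: "j \<in> {1..n} \<Longrightarrow> Vop (of_V (\<epsilon> j)) f = hm.x j f"
proof -
  assume j: "j \<in> {1..n}"
  have "Vop (of_V (\<epsilon> j)) f = (\<Sum>i\<in>{1..n}. if i = j then hm.x j f else 0)"
    unfolding Vop_def by (rule sum.cong[OF refl]) (use j in \<open>auto simp: coord_of_V inner_eps\<close>)
  then show ?thesis using j by simp
qed

lemma Vop_delta: "Vop \<zeta> (delta id) = cmul (\<gamma> \<zeta>) (delta id)"
proof -
  have "Vop \<zeta> (delta id) = (\<Sum>j\<in>{1..n}. cmul (coord \<zeta> j * lam j) (delta id))"
    unfolding Vop_def by (rule sum.cong[OF refl]) (simp add: hm.x_delta)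
  also have "\<dots> = cmul (\<Sum>j\<in>{1..n}. coord \<zeta> j * lam j) (delta id)"
    by (induction rule: infinite_finite_induct) (simp_all only: sum.infinite sum.empty sum.insert not_False_eq_True cmul_simps cmul_add_left)
  finally show ?thesis by (simp only: \<gamma>_expand[of \<zeta>])
qed

lemma Wop_T_delta:
  assumes "w \<in> T_grp n \<epsilon>"
  shows "Wop w (delta id) = cmul (\<mu> w) (delta id)"
  using assms zero_notin(3) unfolding T_grp_def
proof (induction rule: generate_reflection_induct)
  case id
  show ?case unfolding Wop_id \<mu>_id by (simp only: cmul_simps)
next
  case (step \<alpha>)
  then obtain i where i: "i \<in> {1..n}" "\<alpha> = \<epsilon> i" by blast
  show ?case unfolding i(2) Wop_flip[OF i(1)] hm.t_delta nu_def ..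
next
  case (comp w w')
  then have T: "w \<in> T_grp n \<epsilon>" "w' \<in> T_grp n \<epsilon>" unfolding T_grp_def by blast+
  then have "w \<in> W_B n \<epsilon>" "w' \<in> W_B n \<epsilon>" using T_sub by blast+
  from Wop_comp[OF this, symmetric, of "delta id"] show ?case
    unfolding comp(4) lin_cm[OF lin_Wop] comp(3) cmul_simps \<mu>_comp[OF T] by (simp only: mult.commute)
qed

text \<open>The crossing relation for an arbitrary vector, by linear extension from the
  basis.\<close>

lemma Wop_adj_Vop:
  assumes i: "1 \<le> i" "i < n" and "\<alpha> = rootA \<epsilon> i (Suc i)"
  shows "Wop (reflection \<alpha>) (Vop (of_V \<zeta>) f) = Vop (of_V (reflection \<alpha> \<zeta>)) (Wop (reflection \<alpha>) f) +
     cmul (complex_of_real (coroot \<alpha> (reflection \<alpha> \<zeta>))) (hm.kap i (Suc i) f)"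
proof -
  let ?s = "swp i (Suc i)" and ?c = "\<lambda>j. complex_of_real (inner \<zeta> (\<epsilon> j))"
  let ?e = "\<lambda>j. (if j = i then -1 else if j = Suc i then 1 else 0) :: complex"
  have ii: "i \<in> {1..n}" "Suc i \<in> {1..n}" using i by auto
  have aa: "inner \<alpha> \<alpha> = 2"
    using ii by (simp add: assms(3) rootA_def inner_diff_left inner_diff_right inner_eps)
  have r: "reflection \<alpha> \<zeta> = \<zeta> - (inner \<zeta> (\<epsilon> i) - inner \<zeta> (\<epsilon> (Suc i))) *\<^sub>R \<alpha>"
    using aa by (simp add: reflection_def coroot_def assms(3) rootA_def inner_diff_left inner_diff_right inner_commute)
  have cr: "inner (reflection \<alpha> \<zeta>) (\<epsilon> j) = inner \<zeta> (\<epsilon> (?s j))" if "j \<in> {1..n}" for j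
    unfolding r unfolding assms(3) rootA_def using ii that
    by (auto simp: inner_diff_left inner_eps Transposition.transpose_def)
  have co: "coroot \<alpha> (reflection \<alpha> \<zeta>) = inner \<zeta> (\<epsilon> (Suc i)) - inner \<zeta> (\<epsilon> i)"
  proof -
    have "inner \<alpha> v = inner v (\<epsilon> i) - inner v (\<epsilon> (Suc i))" for v
      by (simp add: assms(3) rootA_def inner_diff_left inner_diff_right inner_commute)
    then show ?thesis unfolding coroot_def aa using cr[OF ii(1)] cr[OF ii(2)] by simp
  qed
  have "hm.s i (Vop (of_V \<zeta>) f) = (\<Sum>j\<in>{1..n}. cmul (?c j) (hm.s i (hm.x j f)))"
    by (simp only: Vop_def lin_sum[OF hm.lin_s] hm.lin_rules coord_of_V)
  also have "\<dots> = (\<Sum>j\<in>{1..n}. cmul (?c j) (hm.x (?s j) (hm.s i f)) + cmul (?c j * ?e j) (hm.kap i (Suc i) f))"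
  proof (rule sum.cong[OF refl])
    fix j assume "j \<in> {1..n}"
    then have "hm.s i (hm.x j f) = hm.x (?s j) (hm.s i f) + cmul (?e j) (hm.kap i (Suc i) f)"
      using hm.cross_aux[OF i, of j f] by (simp add: Kop_def hm.kap_def)
    then show "cmul (?c j) (hm.s i (hm.x j f)) = cmul (?c j) (hm.x (?s j) (hm.s i f)) + cmul (?c j * ?e j) (hm.kap i (Suc i) f)"
      by (simp only: cmul_simps)
  qed
  also have "\<dots> = (\<Sum>j\<in>{1..n}. cmul (?c j) (hm.x (?s j) (hm.s i f))) + cmul (\<Sum>j\<in>{1..n}. ?c j * ?e j) (hm.kap i (Suc i) f)"
  proof -
    have "(\<Sum>j\<in>A. cmul (d j) g) = cmul (\<Sum>j\<in>A. d j) g" for A :: "nat set" and d g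
      by (induction A rule: infinite_finite_induct) (simp_all only: sum.infinite sum.empty sum.insert not_False_eq_True cmul_simps cmul_add_left)
    then show ?thesis unfolding sum.distrib by (simp only:)
  qed
  also have "(\<Sum>j\<in>{1..n}. ?c j * ?e j) = complex_of_real (coroot \<alpha> (reflection \<alpha> \<zeta>))"
  proof -
    have "(\<Sum>j\<in>{1..n}. ?c j * ?e j) = (\<Sum>j\<in>{1..n}. (if j = Suc i then ?c j else 0) - (if j = i then ?c j else 0))"
      by (rule sum.cong) auto
    also have "\<dots> = ?c (Suc i) - ?c i" using ii by (simp add: sum_subtractf)
    finally show ?thesis by (simp add: co)
  qed
  also have "(\<Sum>j\<in>{1..n}. cmul (?c j) (hm.x (?s j) (hm.s i f))) = Vop (of_V (reflection \<alpha> \<zeta>)) (hm.s i f)"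
  proof -
    have "(\<Sum>j\<in>{1..n}. cmul (?c j) (hm.x (?s j) (hm.s i f))) =
        (\<Sum>j\<in>{1..n}. ((\<lambda>j. cmul (?c (?s j)) (hm.x j (hm.s i f))) \<circ> ?s) j)"
      by simp
    also have "\<dots> = (\<Sum>j\<in>{1..n}. cmul (?c (?s j)) (hm.x j (hm.s i f)))"
      by (rule sum.permute[OF permutes_adj[OF i], symmetric])
    also have "\<dots> = Vop (of_V (reflection \<alpha> \<zeta>)) (hm.s i f)"
      unfolding Vop_def by (rule sum.cong[OF refl]) (simp only: coord_of_V cr)
    finally show ?thesis .
  qed
  finally show ?thesis
    unfolding assms(3) Wop_adj[OF i] .
qed

end

section \<open>The Hecke algebra acting on the model\<close>

lemma FA_closed:
  "p \<in> carrier (free_algebra G) \<Longrightarrow> q \<in> carrier (free_algebra G) \<Longrightarrow> p + q \<in> carrier (free_algebra G)"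
  "p \<in> carrier (free_algebra G) \<Longrightarrow> q \<in> carrier (free_algebra G) \<Longrightarrow> p * q \<in> carrier (free_algebra G)"
  "p \<in> carrier (free_algebra G) \<Longrightarrow> - p \<in> carrier (free_algebra G)"
  "p \<in> carrier (free_algebra G) \<Longrightarrow> q \<in> carrier (free_algebra G) \<Longrightarrow> p - q \<in> carrier (free_algebra G)"
  "1 \<in> carrier (free_algebra G)" "0 \<in> carrier (free_algebra G)" "scalar c \<in> carrier (free_algebra G)"
  "g \<in> G \<Longrightarrow> gen g \<in> carrier (free_algebra G)"
proof -
  interpret ring "free_algebra G" by (rule ring_free_algebra)
  show 1: "p + q \<in> carrier (free_algebra G)" if "p \<in> carrier (free_algebra G)" "q \<in> carrier (free_algebra G)" for p q
    using a_closed[OF that] by simp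
  show "p * q \<in> carrier (free_algebra G)" if "p \<in> carrier (free_algebra G)" "q \<in> carrier (free_algebra G)" for p q
    using m_closed[OF that] by simp
  show 2: "- p \<in> carrier (free_algebra G)" if "p \<in> carrier (free_algebra G)" for p
    using that by (simp add: free_algebra_def)
  show "p - q \<in> carrier (free_algebra G)" if "p \<in> carrier (free_algebra G)" "q \<in> carrier (free_algebra G)" for p q
    using 1[OF that(1) 2[OF that(2)]] by simp
  show "1 \<in> carrier (free_algebra G)" "0 \<in> carrier (free_algebra G)"
    using one_closed zero_closed by simp_all
  show "scalar c \<in> carrier (free_algebra G)"
    by (simp add: scalar_def free_algebra_def zero_word_def)
  show "gen g \<in> carrier (free_algebra G)" if "g \<in> G"
    using that by (simp add: gen_def free_algebra_def)
qed

lemma FA_uminus: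
  assumes "p \<in> carrier (free_algebra G)"
  shows "\<ominus>\<^bsub>free_algebra G\<^esub> p = - p"
proof -
  interpret ring "free_algebra G" by (rule ring_free_algebra)
  show ?thesis using minus_equality[of "- p" p] assms FA_closed(3)[OF assms] by simp
qed

lemma FA_minus:
  assumes "p \<in> carrier (free_algebra G)" "q \<in> carrier (free_algebra G)"
  shows "p \<ominus>\<^bsub>free_algebra G\<^esub> q = p - q"
  using assms by (simp add: a_minus_def FA_uminus)

lemma supp_invsub:
  assumes "hecke_model n nu"
  shows "invsub n k lam nu (supp n)"
proof -
  interpret hecke_model n k lam nu by (rule assms)
  show ?thesis
    unfolding invsub_def
    using s_supp[OF permutes_adj] x_supp Top_supp supp_add supp_cmul by simp
qed

context hecke_data
begin

abbreviation FA where "FA \<equiv> free_algebra (hecke_gens n \<epsilon>)"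
abbreviation Idl_H where "Idl_H \<equiv> hecke_ideal n \<epsilon> k"
abbreviation HB where "HB \<equiv> H_B n \<epsilon> k"
abbreviation cls where "cls \<equiv> hecke_class n \<epsilon> k"

definition rels where
  "rels = sym_rels \<union> group_rels (W_B n \<epsilon>) \<union> cross_rels n \<epsilon> k"

lemma FA_vgen: "vgen \<zeta> \<in> carrier FA" and FA_tgen: "w \<in> W_B n \<epsilon> \<Longrightarrow> tgen w \<in> carrier FA"
  by (rule FA_closed; simp add: hecke_gens_def)+

lemma refl_W_B:
  "j \<in> {1..n} \<Longrightarrow> reflection (\<epsilon> j) \<in> W_B n \<epsilon>"
  "1 \<le> i \<Longrightarrow> i < n \<Longrightarrow> reflection (rootA \<epsilon> i (Suc i)) \<in> W_B n \<epsilon>"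
  using refl_T T_sub refl_W_A W_A_sub by blast+

lemma FA_k_tilde: "1 \<le> i \<Longrightarrow> i < n \<Longrightarrow> k_tilde \<epsilon> k i (Suc i) \<in> carrier FA"
  unfolding k_tilde_def by (intro FA_closed FA_tgen refl_W_B) auto

lemma rels_cases:
  assumes "p \<in> rels"
  obtains (add) u v where "p = vgen (u + v) - (vgen u + vgen v)"
  | (scale) c u where "p = vgen (scaleC c u) - scalar c * vgen u"
  | (comm) u v where "p = vgen u * vgen v - vgen v * vgen u"
  | (grp) w w' where "p = tgen w * tgen w' - tgen (w \<circ> w')" "w \<in> W_B n \<epsilon>" "w' \<in> W_B n \<epsilon>"
  | (one) "p = tgen id - 1"
  | (T) w \<zeta> where "p = tgen w * vgen (of_V \<zeta>) - vgen (of_V \<zeta>) * tgen w" "w \<in> T_grp n \<epsilon>"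
  | (cross) i \<zeta> where "1 \<le> i" "i < n"
      "p = tgen (reflection (rootA \<epsilon> i (Suc i))) * vgen (of_V \<zeta>) -
        (vgen (of_V (reflection (rootA \<epsilon> i (Suc i)) \<zeta>)) * tgen (reflection (rootA \<epsilon> i (Suc i))) +
         scalar (complex_of_real (coroot (rootA \<epsilon> i (Suc i)) (reflection (rootA \<epsilon> i (Suc i)) \<zeta>))) * k_tilde \<epsilon> k i (Suc i))"
  using assms unfolding rels_def sym_rels_def group_rels_def cross_rels_def Suc_eq_plus1 by blast

lemma rels_sub: "rels \<subseteq> carrier FA"
proof
  fix p assume "p \<in> rels"
  then show "p \<in> carrier FA"
  proof (cases rule: rels_cases)
    case (cross i \<zeta>)
    show ?thesis
      unfolding cross(3) using cross(1,2) by (intro FA_closed(1-7) FA_vgen FA_tgen refl_W_B FA_k_tilde)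
  next
    case (T w \<zeta>)
    then have "w \<in> W_B n \<epsilon>" using T_sub by blast
    then show ?thesis unfolding T(1) by (intro FA_closed(1-7) FA_vgen FA_tgen)
  qed (simp_all only:, (intro FA_closed(1-7) FA_vgen FA_tgen W_comp; assumption?)+)
qed

abbreviation evt where "evt \<equiv> ev theta"

lemma evt_mult: "evt (p * q) f = evt p (evt q f)"
  by (rule ev_mult[OF lin_theta])

lemma evt_gens: "evt (vgen \<zeta>) f = Vop \<zeta> f" "evt (tgen w) f = Wop w f"
  by (simp_all add: ev_gen theta_def)

lemma evt_k_tilde:
  assumes "1 \<le> i" "i < n"
  shows "evt (k_tilde \<epsilon> k i (Suc i)) f = hm.kap i (Suc i) f"
proof -
  have "i \<in> {1..n}" "Suc i \<in> {1..n}" using assms by auto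
  then show ?thesis
    unfolding k_tilde_def evt_mult ev_add ev_1 evt_gens ev_scalar hm.kap_def by (simp only: Wop_flip)
qed

lemma evt_rels:
  assumes "p \<in> rels"
  shows "evt p f = 0"
  using assms
proof (cases rule: rels_cases)
  case (cross i \<zeta>)
  show ?thesis
    unfolding cross(3) ev_diff ev_add evt_mult evt_gens ev_scalar evt_k_tilde[OF cross(1,2)]
      Wop_adj_Vop[OF cross(1,2) refl] by (rule diff_self)
next
  case (T w \<zeta>)
  show ?thesis unfolding T(1) ev_diff evt_mult evt_gens Wop_T_Vop[OF T(2)] by (rule diff_self)
next
  case (comm u v)
  show ?thesis unfolding comm ev_diff evt_mult evt_gens Vop_comm[of u v] by (rule diff_self)
next
  case (grp w w')
  show ?thesis unfolding grp(1) ev_diff evt_mult evt_gens Wop_comp[OF grp(2,3)] by (rule diff_self)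
next
  case one
  show ?thesis unfolding one ev_diff evt_gens Wop_id ev_1 by (rule diff_self)
next
  case (add u v)
  show ?thesis unfolding add ev_diff ev_add evt_gens Vop_add by (rule diff_self)
next
  case (scale c u)
  show ?thesis unfolding scale ev_diff evt_mult evt_gens Vop_scale ev_scalar by (rule diff_self)
qed

sublocale FA: ring FA by (rule ring_free_algebra)

lemma Idl_genideal: "Idl_H = genideal FA rels"
  by (simp add: hecke_ideal_def rels_def)

sublocale I: ideal Idl_H FA
  unfolding Idl_genideal by (rule FA.genideal_ideal[OF rels_sub])

text \<open>The polynomials acting as zero form an ideal, so the whole Hecke ideal acts as zero
  once the defining relations do.\<close>

lemma ideal_kernel: "ideal {p \<in> carrier FA. \<forall>f. evt p f = 0} FA"
proof (rule idealI)
  show "ring FA" by (rule ring_free_algebra)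
  show "subgroup {p \<in> carrier FA. \<forall>f. evt p f = 0} (add_monoid FA)"
  proof (rule FA.add.subgroupI)
    fix p assume "p \<in> {p \<in> carrier FA. \<forall>f. evt p f = 0}"
    then have p: "p \<in> carrier FA" "evt p f = 0" for f by auto
    then show "\<ominus>\<^bsub>FA\<^esub> p \<in> {p \<in> carrier FA. \<forall>f. evt p f = 0}"
      unfolding FA_uminus[OF p(1)] using FA_closed(3)[OF p(1)] by (simp add: ev_uminus)
  next
    show "{p \<in> carrier FA. \<forall>f. evt p f = 0} \<noteq> {}" using FA_closed(6) ev_0 by blast
  qed (auto simp: ev_add FA_closed)
next
  fix a p assume a: "a \<in> {p \<in> carrier FA. \<forall>f. evt p f = 0}" "p \<in> carrier FA"
  then have "p * a \<in> carrier FA" "a * p \<in> carrier FA" by (auto intro: FA_closed(2))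
  moreover have "evt q 0 = 0" for q by (rule lin_0[OF lin_ev[OF lin_theta]])
  ultimately show "p \<otimes>\<^bsub>FA\<^esub> a \<in> {p \<in> carrier FA. \<forall>f. evt p f = 0}"
      "a \<otimes>\<^bsub>FA\<^esub> p \<in> {p \<in> carrier FA. \<forall>f. evt p f = 0}"
    using a by (simp_all only: mem_Collect_eq free_algebra_simps evt_mult simp_thms)
qed

lemma evt_ideal: "p \<in> Idl_H \<Longrightarrow> evt p f = 0"
  using FA.genideal_minimal[OF ideal_kernel, of rels] rels_sub evt_rels unfolding Idl_genideal by blast

lemma HB_def': "HB = FA Quot Idl_H"
  by (simp add: H_B_def)

lemma cls_def': "cls p = Idl_H +>\<^bsub>FA\<^esub> p"
  by (simp add: hecke_class_def)

sublocale HB: ring HB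
  unfolding HB_def' by (rule I.quotient_is_ring)

lemma carrier_HB: "carrier HB = cls ` carrier FA"
  unfolding HB_def' cls_def' by (auto simp: FactRing_def A_RCOSETS_def')

lemma cls_ops:
  "p \<in> carrier FA \<Longrightarrow> q \<in> carrier FA \<Longrightarrow> cls (p + q) = cls p \<oplus>\<^bsub>HB\<^esub> cls q"
  "p \<in> carrier FA \<Longrightarrow> q \<in> carrier FA \<Longrightarrow> cls (p * q) = cls p \<otimes>\<^bsub>HB\<^esub> cls q"
  "cls 1 = \<one>\<^bsub>HB\<^esub>"
  using ring_hom_add[OF I.rcos_ring_hom] ring_hom_mult[OF I.rcos_ring_hom] ring_hom_one[OF I.rcos_ring_hom]
  unfolding HB_def' cls_def' by simp_all

lemma cls_eq_iff:
  "p \<in> carrier FA \<Longrightarrow> q \<in> carrier FA \<Longrightarrow> cls p = cls q \<longleftrightarrow> p - q \<in> Idl_H"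
  using FA.quotient_eq_iff_same_a_r_cos[OF I.is_ideal] FA_minus unfolding cls_def' by metis

lemma cls_rel: "p - q \<in> rels \<Longrightarrow> p \<in> carrier FA \<Longrightarrow> q \<in> carrier FA \<Longrightarrow> cls p = cls q"
  using FA.genideal_self[OF rels_sub] unfolding cls_eq_iff Idl_genideal by blast

lemma cls_in: "p \<in> carrier FA \<Longrightarrow> cls p \<in> carrier HB"
  unfolding carrier_HB by blast

lemma cls_0: "cls 0 = \<zero>\<^bsub>HB\<^esub>"
proof -
  have "cls 0 \<oplus>\<^bsub>HB\<^esub> cls 0 = cls 0" using cls_ops(1)[OF FA_closed(6,6)] by simp
  then show ?thesis using cls_in[OF FA_closed(6)] HB.add.r_cancel_one by blast
qed

lemma cls_uminus:
  assumes p: "p \<in> carrier FA"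
  shows "cls (- p) = \<ominus>\<^bsub>HB\<^esub> cls p"
  using cls_ops(1)[OF FA_closed(3)[OF p] p] cls_0
    HB.minus_equality[OF _ cls_in[OF p] cls_in[OF FA_closed(3)[OF p]]] by simp

text \<open>By \<open>evt_ideal\<close> all representatives of a class act in the same way, so
  the choice does not matter (\<open>rho_cls\<close>).\<close>

definition rho :: "'v hgen ncpoly set \<Rightarrow> pfun \<Rightarrow> pfun" where
  "rho C = evt (SOME p. p \<in> carrier FA \<and> cls p = C)"

lemma rho_cls: "p \<in> carrier FA \<Longrightarrow> rho (cls p) f = evt p f"
proof -
  assume p: "p \<in> carrier FA"
  define q where "q = (SOME q. q \<in> carrier FA \<and> cls q = cls p)"
  have q: "q \<in> carrier FA \<and> cls q = cls p"
    unfolding q_def by (rule someI[of _ p]) (use p in simp)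
  then have "evt (q - p) f = 0" using cls_eq_iff[of q p] p evt_ideal by blast
  then have "evt q f = evt p f" by (simp only: ev_diff right_minus_eq)
  then show ?thesis by (simp only: rho_def q_def)
qed

lemma rho_ops:
  assumes "h \<in> carrier HB"
  shows "h' \<in> carrier HB \<Longrightarrow> rho (h \<oplus>\<^bsub>HB\<^esub> h') f = rho h f + rho h' f"
    "h' \<in> carrier HB \<Longrightarrow> rho (h \<otimes>\<^bsub>HB\<^esub> h') f = rho h (rho h' f)"
    "rho (\<ominus>\<^bsub>HB\<^esub> h) f = - rho h f"
    "lin cmul (rho h)"
proof -
  obtain p where p: "h = cls p" "p \<in> carrier FA" using assms unfolding carrier_HB by blast
  {
    assume "h' \<in> carrier HB"
    then obtain q where q: "h' = cls q" "q \<in> carrier FA" unfolding carrier_HB by blast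
    show "rho (h \<oplus>\<^bsub>HB\<^esub> h') f = rho h f + rho h' f"
      unfolding p(1) q(1) cls_ops(1)[OF p(2) q(2), symmetric]
      by (simp only: rho_cls p(2) q(2) FA_closed(1) ev_add)
    show "rho (h \<otimes>\<^bsub>HB\<^esub> h') f = rho h (rho h' f)"
      unfolding p(1) q(1) cls_ops(2)[OF p(2) q(2), symmetric]
      by (simp only: rho_cls p(2) q(2) FA_closed(2) evt_mult)
  }
  show "rho (\<ominus>\<^bsub>HB\<^esub> h) f = - rho h f"
    unfolding p(1) cls_uminus[OF p(2), symmetric] by (simp only: rho_cls p(2) FA_closed(3) ev_uminus)
  have "rho h = evt p" unfolding p(1) by (rule ext) (rule rho_cls[OF p(2)])
  then show "lin cmul (rho h)" using lin_ev[OF lin_theta] by simp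
qed

lemma rho_gens:
  "rho (cls (scalar c)) f = cmul c f" "rho (cls (vgen \<zeta>)) f = Vop \<zeta> f"
  "w \<in> W_B n \<epsilon> \<Longrightarrow> rho (cls (tgen w)) f = Wop w f"
  by (simp_all only: rho_cls FA_closed(7) FA_vgen FA_tgen ev_scalar evt_gens)

lemma rho_one: "rho \<one>\<^bsub>HB\<^esub> f = f"
  unfolding cls_ops(3)[symmetric] by (simp only: rho_cls FA_closed(5) ev_1)

section \<open>The character of the commutative subalgebra\<close>

abbreviation A where "A \<equiv> SCT n \<epsilon> k"

definition SCT_gens where
  "SCT_gens = cls ` (range scalar \<union> range vgen \<union> tgen ` T_grp n \<epsilon>)"

lemma A_eq: "A = generate_ring HB SCT_gens"
  by (simp add: SCT_def SCT_gens_def)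

lemma SCT_gens_sub: "SCT_gens \<subseteq> carrier HB"
  unfolding SCT_gens_def using T_sub
  by (auto intro!: cls_in intro: FA_closed(7) FA_vgen FA_tgen)

lemma A_sub: "A \<subseteq> carrier HB"
  unfolding A_eq by (rule HB.generate_ring_incl[OF SCT_gens_sub])

text \<open>The eigenvalue of \<open>a\<close> at \<open>delta id\<close>, read off as the value
  of the image at \<open>id\<close>.\<close>

definition psi where "psi a = rho a (delta id) id"

lemma A_eigen:
  assumes "a \<in> A"
  shows "\<exists>c. rho a (delta id) = cmul c (delta id)"
  using assms unfolding A_eq
proof induction
  case one
  show ?case by (rule exI[of _ 1]) (simp only: rho_one cmul_simps)
next
  case (incl h)
  then consider c where "h = cls (scalar c)" | \<zeta> where "h = cls (vgen \<zeta>)" | w where "h = cls (tgen w)" "w \<in> T_grp n \<epsilon>"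
    unfolding SCT_gens_def by blast
  then show ?case
  proof cases
    case 3
    then have "w \<in> W_B n \<epsilon>" using T_sub by blast
    then show ?thesis using rho_gens(3) Wop_T_delta[OF 3(2)] 3(1) by metis
  qed (use rho_gens(1,2) Vop_delta in metis)+
next
  case (a_inv h)
  then have h: "h \<in> carrier HB" using A_sub unfolding A_eq by blast
  from a_inv obtain c where c: "rho h (delta id) = cmul c (delta id)" by blast
  show ?case
    unfolding rho_ops(3)[OF h] c by (rule exI[of _ "- c"]) (simp only: hm.cm_minus)
next
  case (eng_add h1 h2)
  then have h: "h1 \<in> carrier HB" "h2 \<in> carrier HB" using A_sub unfolding A_eq by blast+
  show ?case unfolding rho_ops(1)[OF h] using eng_add(3,4) cmul_add_left by metis
next
  case (eng_mult h1 h2)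
  then have h: "h1 \<in> carrier HB" "h2 \<in> carrier HB" using A_sub unfolding A_eq by blast+
  from eng_mult obtain c d where c: "rho h1 (delta id) = cmul c (delta id)" "rho h2 (delta id) = cmul d (delta id)" by blast
  show ?case
    unfolding rho_ops(2)[OF h] c lin_cm[OF rho_ops(4)[OF h(1)]] cmul_simps by blast
qed

lemma rho_A: "a \<in> A \<Longrightarrow> rho a (delta id) = cmul (psi a) (delta id)"
proof -
  assume "a \<in> A"
  then obtain c where c: "rho a (delta id) = cmul c (delta id)" using A_eigen by blast
  then have "psi a = c" by (simp add: psi_def cmul_def delta_def)
  then show ?thesis using c by simp
qed

lemma psi_unique: "rho a (delta id) = cmul c (delta id) \<Longrightarrow> psi a = c"
  by (simp add: psi_def cmul_def delta_def)

abbreviation HA where "HA \<equiv> HB\<lparr>carrier := A\<rparr>"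

lemma gens_in_A:
  "cls (scalar c) \<in> A" "cls (vgen \<zeta>) \<in> A" "w \<in> T_grp n \<epsilon> \<Longrightarrow> cls (tgen w) \<in> A"
  unfolding A_eq by (rule generate_ring.incl; unfold SCT_gens_def; blast)+

lemma psi_hom: "psi \<in> ring_hom HA ring_of_type_algebra"
proof (rule ring_hom_memI)
  fix a b assume "a \<in> carrier HA" "b \<in> carrier HA"
  then have ab: "a \<in> A" "b \<in> A" "a \<in> carrier HB" "b \<in> carrier HB" using A_sub by auto
  have "psi (a \<otimes>\<^bsub>HB\<^esub> b) = psi a * psi b"
    by (rule psi_unique) (simp only: rho_ops(2,4) ab rho_A lin_cm[OF rho_ops(4)[OF ab(3)]] cmul_simps mult.commute)
  then show "psi (a \<otimes>\<^bsub>HA\<^esub> b) = psi a \<otimes>\<^bsub>ring_of_type_algebra\<^esub> psi b"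
    by (simp add: ring_of_type_algebra_def)
  have "psi (a \<oplus>\<^bsub>HB\<^esub> b) = psi a + psi b"
    by (rule psi_unique) (simp only: rho_ops(1) ab rho_A cmul_add_left)
  then show "psi (a \<oplus>\<^bsub>HA\<^esub> b) = psi a \<oplus>\<^bsub>ring_of_type_algebra\<^esub> psi b"
    by (simp add: ring_of_type_algebra_def)
next
  have "psi \<one>\<^bsub>HB\<^esub> = 1" by (rule psi_unique) (simp only: rho_one cmul_simps)
  then show "psi \<one>\<^bsub>HA\<^esub> = \<one>\<^bsub>ring_of_type_algebra\<^esub>" by (simp add: ring_of_type_algebra_def)
qed (simp add: ring_of_type_algebra_def)

text \<open>The character is given by a definite description. Existence needs a representation
  of the Hecke algebra with an eigenvector of the prescribed weight, without which the relations
  might collapse the subalgebra; \<open>delta id\<close> is one. Uniqueness holds because the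
  subalgebra is generated by elements on which the values are prescribed.\<close>

lemma tensor_char_eq:
  assumes "a \<in> A"
  shows "tensor_char n \<epsilon> k \<gamma> \<mu> a = psi a"
proof -
  let ?P = "\<lambda>\<psi>. \<psi> \<in> ring_hom HA ring_of_type_algebra \<and> \<psi> \<in> extensional A \<and>
     (\<forall>c. \<psi> (cls (scalar c)) = c) \<and> (\<forall>\<zeta>. \<psi> (cls (vgen \<zeta>)) = \<gamma> \<zeta>) \<and>
     (\<forall>x\<in>T_grp n \<epsilon>. \<psi> (cls (tgen x)) = \<mu> x)"
  have v: "psi (cls (scalar c)) = c" "psi (cls (vgen \<zeta>)) = \<gamma> \<zeta>" "w \<in> T_grp n \<epsilon> \<Longrightarrow> psi (cls (tgen w)) = \<mu> w" for c \<zeta> w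
    using T_sub by (intro psi_unique; auto simp: rho_gens Vop_delta Wop_T_delta)+
  have ex: "?P (restrict psi A)"
  proof (intro conjI allI ballI)
    show "restrict psi A \<in> ring_hom HA ring_of_type_algebra"
      by (rule ring.ring_hom_restrict[OF HB.generate_ring_is_ring[OF SCT_gens_sub, folded A_eq] psi_hom]) simp
  qed (simp_all add: gens_in_A v)
  have uniq: "\<psi> = restrict psi A" if P: "?P \<psi>" for \<psi>
  proof
    fix a
    show "\<psi> a = restrict psi A a"
    proof (cases "a \<in> A")
      case True
      note h = conjunct1[OF P] psi_hom
      have z: "\<psi> \<zero>\<^bsub>HB\<^esub> = 0" "psi \<zero>\<^bsub>HB\<^esub> = 0"
      proof -
        have "cls (scalar 0) = \<zero>\<^bsub>HB\<^esub>" using cls_0 by (simp add: scalar_def)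
        then show "\<psi> \<zero>\<^bsub>HB\<^esub> = 0" "psi \<zero>\<^bsub>HB\<^esub> = 0" using P v(1)[of 0] by metis+
      qed
      have "\<psi> a = psi a"
        using True unfolding A_eq
      proof induction
        case one
        show ?case using ring_hom_one[OF h(1)] ring_hom_one[OF h(2)] by simp
      next
        case (incl h)
        then show ?case unfolding SCT_gens_def using P v by auto
      next
        case (a_inv b)
        then have b: "b \<in> A" "b \<in> carrier HB" using A_sub unfolding A_eq by blast+
        have nb: "\<ominus>\<^bsub>HB\<^esub> b \<in> A" using generate_ring.a_inv[OF a_inv(1)] unfolding A_eq .
        have e: "\<ominus>\<^bsub>HB\<^esub> b \<oplus>\<^bsub>HB\<^esub> b = \<zero>\<^bsub>HB\<^esub>" using b HB.l_neg by blast
        have "\<psi> (\<ominus>\<^bsub>HB\<^esub> b) + \<psi> b = 0" "psi (\<ominus>\<^bsub>HB\<^esub> b) + psi b = 0"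
          using ring_hom_add[OF h(1), of "\<ominus>\<^bsub>HB\<^esub> b" b] ring_hom_add[OF h(2), of "\<ominus>\<^bsub>HB\<^esub> b" b] b nb e z
          by (simp_all add: ring_of_type_algebra_def)
        then show ?case using a_inv by (simp add: eq_neg_iff_add_eq_0[symmetric])
      next
        case (eng_add b c)
        then have "b \<in> A" "c \<in> A" unfolding A_eq by blast+
        then show ?case
          using ring_hom_add[OF h(1), of b c] ring_hom_add[OF h(2), of b c] eng_add(3,4)
          by (simp add: ring_of_type_algebra_def)
      next
        case (eng_mult b c)
        then have "b \<in> A" "c \<in> A" unfolding A_eq by blast+
        then show ?case
          using ring_hom_mult[OF h(1), of b c] ring_hom_mult[OF h(2), of b c] eng_mult(3,4)
          by (simp add: ring_of_type_algebra_def)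
      qed
      then show ?thesis using True by simp
    next
      case False
      then show ?thesis using P by (auto simp: extensional_def)
    qed
  qed
  have "tensor_char n \<epsilon> k \<gamma> \<mu> = restrict psi A"
    unfolding tensor_char_def by (rule the_equality[of ?P, OF ex uniq])
  then show ?thesis using assms by simp
qed

end

section \<open>Normal forms in the principal series\<close>

context hecke_data
begin

abbreviation chi where "chi \<equiv> tensor_char n \<epsilon> k \<gamma> \<mu>"

sublocale ind: induced_char HB A chi
  by standard (rule A_sub)

definition wp :: "(nat \<Rightarrow> nat) \<Rightarrow> 'v \<Rightarrow> 'v" where
  "wp p = (SOME w. w \<in> W_A n \<epsilon> \<and> signed p (\<lambda>_. 1) w)"

lemma wp: "p permutes {1..n} \<Longrightarrow> wp p \<in> W_A n \<epsilon>" "p permutes {1..n} \<Longrightarrow> signed p (\<lambda>_. 1) (wp p)"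
proof -
  assume "p permutes {1..n}"
  from W_A_ex[OF this] have "\<exists>w. w \<in> W_A n \<epsilon> \<and> signed p (\<lambda>_. 1) w" by blast
  from someI_ex[OF this] show "wp p \<in> W_A n \<epsilon>" "signed p (\<lambda>_. 1) (wp p)" unfolding wp_def by blast+
qed

lemma wp_W_B: "p permutes {1..n} \<Longrightarrow> wp p \<in> W_B n \<epsilon>"
  using wp(1) W_A_sub by blast

lemma wp_id: "wp id = id"
  using signed_ext[OF wp(2)[OF permutes_id] signed_id] .

lemma wp_adj:
  assumes "1 \<le> i" "i < n" "p permutes {1..n}"
  shows "wp (swp i (Suc i) \<circ> p) = reflection (rootA \<epsilon> i (Suc i)) \<circ> wp p"
proof (rule signed_ext)
  show "signed (swp i (Suc i) \<circ> p) (\<lambda>_. 1) (wp (swp i (Suc i) \<circ> p))"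
    by (rule wp(2)[OF permutes_compose[OF assms(3) permutes_adj[OF assms(1,2)]]])
  show "signed (swp i (Suc i) \<circ> p) (\<lambda>_. 1) (reflection (rootA \<epsilon> i (Suc i)) \<circ> wp p)"
    using signed_comp[OF signed_adj[OF assms(1,2)] wp(2)[OF assms(3)]] by (simp only: mult_1)
qed

lemma W_B_decomp:
  assumes "w \<in> W_B n \<epsilon>"
  obtains p u where "p permutes {1..n}" "u \<in> T_grp n \<epsilon>" "w = wp p \<circ> u"
proof -
  obtain p sg where ps: "signed p sg w" using W_B_signed[OF assms] by blast
  then have p: "p permutes {1..n}" by (simp add: signed_def)
  note inv = W_A_inverse[OF wp[OF p]]
  have "signed (iv p \<circ> p) (\<lambda>j. sg j * 1) (iv (wp p) \<circ> w)"
    by (rule signed_comp[OF inv(2) ps])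
  then have "signed id sg (iv (wp p) \<circ> w)"
    unfolding permutes_inv_o(2)[OF p] mult_1_right .
  then have "iv (wp p) \<circ> w \<in> T_grp n \<epsilon>" by (rule signed_T)
  moreover have "w = wp p \<circ> (iv (wp p) \<circ> w)"
    unfolding comp_assoc[symmetric] inv(3) id_comp ..
  ultimately show ?thesis using that p by blast
qed

lemma Wop_wp: "p permutes {1..n} \<Longrightarrow> Wop (wp p) f = Sop n p f"
  unfolding Wop_signed[OF wp(2)] TTop_one ..

lemma invsub_Wop:
  assumes N: "invsub n k lam nu N" and w: "w \<in> W_B n \<epsilon>" and f: "f \<in> N"
  shows "Wop w f \<in> N"
proof -
  have T: "Wop u f \<in> N" if "u \<in> T_grp n \<epsilon>" "f \<in> N" for u f
    using that(1) zero_notin(3) that(2) unfolding T_grp_def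
  proof (induction arbitrary: f rule: generate_reflection_induct)
    case id
    then show ?case unfolding Wop_id by simp
  next
    case (step \<alpha>)
    then obtain i where i: "i \<in> {1..n}" "\<alpha> = \<epsilon> i" by blast
    show ?case unfolding i(2) Wop_flip[OF i(1)] using i step by (intro invsubD(7)[OF N]) auto
  next
    case (comp u u')
    then have "u \<in> W_B n \<epsilon>" "u' \<in> W_B n \<epsilon>" using T_sub unfolding T_grp_def by blast+
    from Wop_comp[OF this] show ?case using comp(3,4,5) by metis
  qed
  obtain p u where p: "p permutes {1..n}" "u \<in> T_grp n \<epsilon>" "w = wp p \<circ> u" using W_B_decomp[OF w] by blast
  have "u \<in> W_B n \<epsilon>" using p(2) T_sub by blast
  then have "Wop w f = Sop n p (Wop u f)"
    unfolding p(3) Wop_wp[OF p(1), symmetric] by (rule Wop_comp[OF wp_W_B[OF p(1)], symmetric])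
  then show ?thesis using invsub_Sop[OF N T[OF p(2) f] p(1)] by simp
qed

lemma invsub_Vop:
  assumes N: "invsub n k lam nu N" and f: "f \<in> N"
  shows "Vop \<zeta> f \<in> N"
proof -
  have "(\<Sum>j\<in>B. cmul (coord \<zeta> j) (hm.x j f)) \<in> N" if "B \<subseteq> {1..n}" for B
    using that
  proof (induction B rule: infinite_finite_induct)
    case (insert j B)
    have "cmul (coord \<zeta> j) (hm.x j f) \<in> N"
      using insert f by (intro invsubD(4,6)[OF N]) auto
    with insert show ?case
      by (simp only: sum.insert[OF insert(1,2)]) (intro invsubD(3)[OF N], auto)
  qed (use invsubD(2)[OF N] in auto)
  then show ?thesis unfolding Vop_def by blast
qed

lemma invsub_rho:
  assumes N: "invsub n k lam nu N" and h: "h \<in> carrier HB" and f: "f \<in> N"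
  shows "rho h f \<in> N"
proof -
  obtain p where p: "h = cls p" "p \<in> carrier FA" using h unfolding carrier_HB by blast
  have "\<forall>f\<in>N. evt p f \<in> N"
    using p(2)
  proof (induction rule: ncpoly_induct)
    case (scalar c)
    show ?case unfolding ev_scalar using invsubD(4)[OF N] by blast
  next
    case (gen g)
    then consider \<zeta> where "g = Vec \<zeta>" | w where "g = Grp w" "w \<in> W_B n \<epsilon>" unfolding hecke_gens_def by blast
    then show ?case
      by cases (simp_all add: evt_gens invsub_Vop[OF N] invsub_Wop[OF N])
  next
    case (add p q)
    show ?case unfolding ev_add using add(3,4) invsubD(3)[OF N] by blast
  next
    case (mult p q)
    show ?case unfolding evt_mult using mult(3,4) by blast
  qed
  then show ?thesis unfolding p(1) rho_cls[OF p(2)] using f by blast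
qed

lemma supp_inv: "invsub n k lam nu (supp n)"
  by (rule supp_invsub) standard

abbreviation gw where "gw p \<equiv> cls (tgen (wp p))"

lemma gw_in: "p permutes {1..n} \<Longrightarrow> gw p \<in> carrier HB"
  by (intro cls_in FA_tgen wp_W_B)

text \<open>The representative \<open>\<Sum>\<^sub>p t\<^sub>p \<otimes> g p\<close> of a tensor
  in normal form. It depends additively on \<open>g\<close> only modulo the balancing relations,
  since the free abelian group knows nothing about addition in
  \<open>\<complex>\<close>.\<close>

definition Psi :: "pfun \<Rightarrow> ('v hgen ncpoly set \<times> complex \<Rightarrow>\<^sub>0 int)" where
  "Psi g = (\<Sum>p\<in>{p. p permutes {1..n}}. frag_of (gw p, g p))"

lemma F_sum: "(\<And>i. i \<in> I \<Longrightarrow> c i \<in> carrier ind.F) \<Longrightarrow> sum c I \<in> carrier ind.F"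
  by (rule sum_closed_free_Abelian_group)

lemma Psi_F: "Psi g \<in> carrier ind.F"
  unfolding Psi_def by (intro F_sum ind.F_of gw_in) simp

lemma frag_0_K: "y \<in> carrier HB \<Longrightarrow> frag_of (y, 0) \<in> ind.K"
  using ind.K_minus[OF ind.K_rels(2)[of y 0 0]] by simp

lemma Psi_add_K: "Psi (g + h) - (Psi g + Psi h) \<in> ind.K"
proof -
  have "Psi (g + h) - (Psi g + Psi h) =
      (\<Sum>p\<in>{p. p permutes {1..n}}. frag_of (gw p, g p + h p) - frag_of (gw p, g p) - frag_of (gw p, h p))"
    unfolding Psi_def by (simp add: sum.distrib sum_subtractf diff_diff_eq)
  also have "\<dots> \<in> ind.K"
    by (intro ind.K_sum ind.K_rels(2) gw_in) simp
  finally show ?thesis .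
qed

lemma Psi_0_K: "Psi 0 \<in> ind.K"
  unfolding Psi_def by (intro ind.K_sum) (simp add: frag_0_K gw_in)

lemma Psi_delta_K:
  assumes "p permutes {1..n}"
  shows "Psi (cmul z (delta p)) - frag_of (gw p, z) \<in> ind.K"
proof -
  have "Psi (cmul z (delta p)) = frag_of (gw p, cmul z (delta p) p) +
      (\<Sum>q\<in>{q. q permutes {1..n}} - {p}. frag_of (gw q, cmul z (delta p) q))"
    unfolding Psi_def using assms by (intro sum.remove) (auto simp: finite_permutations)
  moreover have "(\<Sum>q\<in>{q. q permutes {1..n}} - {p}. frag_of (gw q, cmul z (delta p) q)) \<in> ind.K"
    by (intro ind.K_sum) (auto simp: cmul_def delta_def frag_0_K gw_in)
  ultimately show ?thesis by (simp add: cmul_def delta_def)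
qed

text \<open>Tensors that can be brought to normal form. Together with
  \<open>span_stable\<close>, the elements of the Hecke algebra whose action preserves them,
  this is the spanning half of a Poincare--Birkhoff--Witt theorem.\<close>

definition spanned where "spanned c \<longleftrightarrow> c \<in> carrier ind.F \<and> (\<exists>g\<in>supp n. c - Psi g \<in> ind.K)"

lemma spanned_add: "spanned c \<Longrightarrow> spanned d \<Longrightarrow> spanned (c + d)"
proof -
  assume "spanned c" "spanned d"
  then obtain g h where g: "g \<in> supp n" "c - Psi g \<in> ind.K" "h \<in> supp n" "d - Psi h \<in> ind.K"
    and F: "c \<in> carrier ind.F" "d \<in> carrier ind.F" by (auto simp: spanned_def)
  have "c + d - Psi (g + h) = (c - Psi g) + (d - Psi h) - (Psi (g + h) - (Psi g + Psi h))" by simp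
  also have "\<dots> \<in> ind.K" by (intro ind.K_add ind.K_diff g Psi_add_K)
  finally show ?thesis
    unfolding spanned_def using ind.F_add[OF F] supp_add[OF g(1,3)] by blast
qed

lemma spanned_cong: "spanned d \<Longrightarrow> c \<in> carrier ind.F \<Longrightarrow> c - d \<in> ind.K \<Longrightarrow> spanned c"
proof -
  assume "spanned d" and c: "c \<in> carrier ind.F" "c - d \<in> ind.K"
  then obtain g where g: "g \<in> supp n" "d - Psi g \<in> ind.K" by (auto simp: spanned_def)
  have "c - Psi g = (c - d) + (d - Psi g)" by simp
  also have "\<dots> \<in> ind.K" by (intro ind.K_add c g)
  finally show ?thesis unfolding spanned_def using c(1) g(1) by blast
qed

lemma spanned_0: "spanned 0"
  unfolding spanned_def using ind.K_minus[OF Psi_0_K] ind.F_0 by (intro conjI bexI[of _ 0]) simp_all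

lemma spanned_uminus: "spanned c \<Longrightarrow> spanned (- c)"
proof -
  assume "spanned c"
  then obtain g where g: "g \<in> supp n" "c - Psi g \<in> ind.K" and F: "c \<in> carrier ind.F" by (auto simp: spanned_def)
  let ?h = "cmul (-1) g"
  have s: "g + ?h = 0" by (simp add: cmul_def fun_eq_iff)
  have "- c - Psi ?h = - (c - Psi g) - Psi 0 + (Psi (g + ?h) - (Psi g + Psi ?h))" unfolding s by simp
  also have "\<dots> \<in> ind.K" by (intro ind.K_add ind.K_diff ind.K_minus g Psi_add_K Psi_0_K)
  finally show ?thesis
    unfolding spanned_def using ind.F_diff[OF ind.F_0 F] supp_cmul[OF g(1), of "-1"] by auto
qed

lemma spanned_sum: "(\<And>i. i \<in> I \<Longrightarrow> spanned (c i)) \<Longrightarrow> spanned (sum c I)"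
  by (induction I rule: infinite_finite_induct) (auto intro: spanned_0 spanned_add)

lemma spanned_basis: "p permutes {1..n} \<Longrightarrow> spanned (frag_of (gw p, z))"
proof -
  assume p: "p permutes {1..n}"
  have "frag_of (gw p, z) - Psi (cmul z (delta p)) \<in> ind.K"
    using ind.K_minus[OF Psi_delta_K[OF p, of z]] by simp
  then show ?thesis
    unfolding spanned_def using supp_cmul[OF supp_delta[OF p]] ind.F_of[OF gw_in[OF p]] by blast
qed

definition span_stable where "span_stable h \<longleftrightarrow> h \<in> carrier HB \<and> (\<forall>c. spanned c \<longrightarrow> spanned (ind.L h c))"

lemma span_stableI:
  assumes h: "h \<in> carrier HB" and b: "\<And>p z. p permutes {1..n} \<Longrightarrow> spanned (frag_of (h \<otimes>\<^bsub>HB\<^esub> gw p, z))"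
  shows "span_stable h"
  unfolding span_stable_def
proof (intro conjI allI impI h)
  fix c assume "spanned c"
  then obtain g where g: "c - Psi g \<in> ind.K" and F: "c \<in> carrier ind.F" by (auto simp: spanned_def)
  have "spanned (ind.L h (Psi g))"
    unfolding Psi_def ind.L_sum ind.L_of by (rule spanned_sum) (use b in simp)
  moreover have "ind.L h c - ind.L h (Psi g) \<in> ind.K"
    using ind.L_K[OF h g] by (simp only: ind.L_diff)
  ultimately show "spanned (ind.L h c)" using spanned_cong ind.L_F[OF h F] by blast
qed

lemma span_stable_frag: "span_stable h \<Longrightarrow> spanned (frag_of (y, z)) \<Longrightarrow> spanned (frag_of (h \<otimes>\<^bsub>HB\<^esub> y, z))"
  unfolding span_stable_def using ind.L_of by metis

lemma spanned_frag_add: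
  assumes "x \<in> carrier HB" "y \<in> carrier HB" "spanned (frag_of (x, z))" "spanned (frag_of (y, z))"
  shows "spanned (frag_of (x \<oplus>\<^bsub>HB\<^esub> y, z))"
proof (rule spanned_cong[OF spanned_add[OF assms(3,4)]])
  show "frag_of (x \<oplus>\<^bsub>HB\<^esub> y, z) \<in> carrier ind.F" by (intro ind.F_of HB.a_closed assms)
  show "frag_of (x \<oplus>\<^bsub>HB\<^esub> y, z) - (frag_of (x, z) + frag_of (y, z)) \<in> ind.K"
    using ind.K_rels(1)[OF assms(1,2)] by (simp only: diff_diff_eq)
qed

lemma spanned_frag_uminus:
  assumes "x \<in> carrier HB" "spanned (frag_of (x, z))"
  shows "spanned (frag_of (\<ominus>\<^bsub>HB\<^esub> x, z))"
proof (rule spanned_cong[OF spanned_uminus[OF assms(2)]])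
  have n: "\<ominus>\<^bsub>HB\<^esub> x \<in> carrier HB" using assms(1) by simp
  show "frag_of (\<ominus>\<^bsub>HB\<^esub> x, z) \<in> carrier ind.F" by (rule ind.F_of[OF n])
  have z: "\<zero>\<^bsub>HB\<^esub> \<in> carrier HB" by simp
  have "frag_of (\<zero>\<^bsub>HB\<^esub>, z) \<in> ind.K"
    using ind.K_minus[OF ind.K_rels(1)[OF z z, of z]] by simp
  moreover have "frag_of (\<zero>\<^bsub>HB\<^esub>, z) - frag_of (\<ominus>\<^bsub>HB\<^esub> x, z) - frag_of (x, z) \<in> ind.K"
    using ind.K_rels(1)[OF n assms(1), of z] assms(1) by (simp add: HB.l_neg)
  ultimately have "frag_of (\<zero>\<^bsub>HB\<^esub>, z) - (frag_of (\<zero>\<^bsub>HB\<^esub>, z) - frag_of (\<ominus>\<^bsub>HB\<^esub> x, z) - frag_of (x, z)) \<in> ind.K"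
    by (rule ind.K_diff)
  then show "frag_of (\<ominus>\<^bsub>HB\<^esub> x, z) - - frag_of (x, z) \<in> ind.K"
    by (simp add: algebra_simps)
qed

text \<open>Elements of the subalgebra on the right of the first factor pass through the tensor
  sign and become scalars.\<close>

lemma spanned_move:
  assumes "x \<in> carrier HB" "a \<in> A" "\<And>z. spanned (frag_of (x, z))"
  shows "spanned (frag_of (x \<otimes>\<^bsub>HB\<^esub> a, z))"
proof (rule spanned_cong[OF assms(3)])
  have "a \<in> carrier HB" using assms(2) A_sub by blast
  then show "frag_of (x \<otimes>\<^bsub>HB\<^esub> a, z) \<in> carrier ind.F" by (intro ind.F_of HB.m_closed assms)
  show "frag_of (x \<otimes>\<^bsub>HB\<^esub> a, z) - frag_of (x, chi a * z) \<in> ind.K" by (rule ind.K_rels(3)[OF assms(1,2)])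
qed

lemma scalar_comm: "scalar c * p = p * scalar c"
proof -
  have "scalar c * Poly_Mapping.single u d = Poly_Mapping.single u d * scalar c" for u d
    by (simp add: scalar_def mult_single mult.commute)
  then have "(\<Sum>u\<in>Poly_Mapping.keys p. scalar c * Poly_Mapping.single u (Poly_Mapping.lookup p u)) =
     (\<Sum>u\<in>Poly_Mapping.keys p. Poly_Mapping.single u (Poly_Mapping.lookup p u) * scalar c)" by (rule sum.cong[OF refl])
  then show ?thesis
    unfolding sum_distrib_left[symmetric] sum_distrib_right[symmetric] sum_single[symmetric] .
qed

lemma span_stable_scalar: "span_stable (cls (scalar c))"
proof (rule span_stableI)
  show "cls (scalar c) \<in> carrier HB" by (intro cls_in FA_closed)
  fix p z assume p: "p permutes {1..n}"
  have "tgen (wp p) \<in> carrier FA" by (rule FA_tgen[OF wp_W_B[OF p]])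
  then have "cls (scalar c) \<otimes>\<^bsub>HB\<^esub> gw p = gw p \<otimes>\<^bsub>HB\<^esub> cls (scalar c)"
    by (simp only: cls_ops(2)[symmetric] FA_closed(7) scalar_comm)
  then show "spanned (frag_of (cls (scalar c) \<otimes>\<^bsub>HB\<^esub> gw p, z))"
    using spanned_move[OF gw_in[OF p] gens_in_A(1)] spanned_basis[OF p] by metis
qed

lemma cls_tgen_comp:
  assumes "w \<in> W_B n \<epsilon>" "w' \<in> W_B n \<epsilon>"
  shows "cls (tgen w) \<otimes>\<^bsub>HB\<^esub> cls (tgen w') = cls (tgen (w \<circ> w'))"
proof -
  have "tgen w * tgen w' - tgen (w \<circ> w') \<in> rels"
    unfolding rels_def group_rels_def using assms by blast
  from cls_rel[OF this] show ?thesis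
    using assms by (simp add: cls_ops(2)[symmetric] FA_tgen FA_closed(2) W_comp(1))
qed

lemma span_stable_tgen:
  assumes w: "w \<in> W_B n \<epsilon>"
  shows "span_stable (cls (tgen w))"
proof (rule span_stableI)
  show "cls (tgen w) \<in> carrier HB" by (intro cls_in FA_tgen w)
  fix p z assume p: "p permutes {1..n}"
  have "w \<circ> wp p \<in> W_B n \<epsilon>" by (rule W_comp(1)[OF w wp_W_B[OF p]])
  then obtain q u where q: "q permutes {1..n}" "u \<in> T_grp n \<epsilon>" "w \<circ> wp p = wp q \<circ> u" by (rule W_B_decomp)
  have "u \<in> W_B n \<epsilon>" using q(2) T_sub by blast
  then have "cls (tgen w) \<otimes>\<^bsub>HB\<^esub> gw p = gw q \<otimes>\<^bsub>HB\<^esub> cls (tgen u)"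
    unfolding cls_tgen_comp[OF w wp_W_B[OF p]] q(3) using cls_tgen_comp[OF wp_W_B[OF q(1)]] by simp
  then show "spanned (frag_of (cls (tgen w) \<otimes>\<^bsub>HB\<^esub> gw p, z))"
    using spanned_move[OF gw_in[OF q(1)] gens_in_A(3)[OF q(2)]] spanned_basis[OF q(1)] by metis
qed

lemma span_stable_mult: "span_stable h \<Longrightarrow> span_stable h' \<Longrightarrow> span_stable (h \<otimes>\<^bsub>HB\<^esub> h')"
proof (rule span_stableI)
  assume h: "span_stable h" "span_stable h'"
  then have c: "h \<in> carrier HB" "h' \<in> carrier HB" by (auto simp: span_stable_def)
  then show "h \<otimes>\<^bsub>HB\<^esub> h' \<in> carrier HB" by simp
  fix p z assume p: "p permutes {1..n}"
  have "spanned (frag_of (h \<otimes>\<^bsub>HB\<^esub> (h' \<otimes>\<^bsub>HB\<^esub> gw p), z))"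
    by (intro span_stable_frag h spanned_basis p)
  then show "spanned (frag_of (h \<otimes>\<^bsub>HB\<^esub> h' \<otimes>\<^bsub>HB\<^esub> gw p, z))"
    using c gw_in[OF p] by (simp only: HB.m_assoc)
qed

lemma span_stable_add: "span_stable h \<Longrightarrow> span_stable h' \<Longrightarrow> span_stable (h \<oplus>\<^bsub>HB\<^esub> h')"
proof (rule span_stableI)
  assume h: "span_stable h" "span_stable h'"
  then have c: "h \<in> carrier HB" "h' \<in> carrier HB" by (auto simp: span_stable_def)
  then show "h \<oplus>\<^bsub>HB\<^esub> h' \<in> carrier HB" by simp
  fix p z assume p: "p permutes {1..n}"
  have "spanned (frag_of (h \<otimes>\<^bsub>HB\<^esub> gw p \<oplus>\<^bsub>HB\<^esub> h' \<otimes>\<^bsub>HB\<^esub> gw p, z))"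
    using c gw_in[OF p] by (intro spanned_frag_add span_stable_frag h spanned_basis p HB.m_closed)
  then show "spanned (frag_of ((h \<oplus>\<^bsub>HB\<^esub> h') \<otimes>\<^bsub>HB\<^esub> gw p, z))"
    using c gw_in[OF p] by (simp only: HB.l_distr)
qed

lemma span_stable_k_tilde:
  assumes "1 \<le> i" "i < n"
  shows "span_stable (cls (k_tilde \<epsilon> k i (Suc i)))"
proof -
  have w: "reflection (\<epsilon> i) \<in> W_B n \<epsilon>" "reflection (\<epsilon> (Suc i)) \<in> W_B n \<epsilon>" using assms by (auto intro: refl_W_B)
  have one: "cls 1 = cls (scalar 1)" by (simp add: scalar_def)
  show ?thesis
    unfolding k_tilde_def
    by (simp only: cls_ops(1,2) FA_closed(1,2,5,7) FA_tgen w)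
      (simp only: one span_stable_mult span_stable_add span_stable_scalar span_stable_tgen w)
qed

text \<open>The crossing relation for \<open>r \<zeta>\<close> in place of
  \<open>\<zeta>\<close>, solved for the product in which the vector comes first.\<close>

lemma cls_vgen_refl:
  assumes i: "1 \<le> i" "i < n" and r: "r = reflection (rootA \<epsilon> i (Suc i))"
  shows "cls (vgen (of_V \<zeta>)) \<otimes>\<^bsub>HB\<^esub> cls (tgen r) =
    cls (tgen r) \<otimes>\<^bsub>HB\<^esub> cls (vgen (of_V (r \<zeta>))) \<oplus>\<^bsub>HB\<^esub>
    (\<ominus>\<^bsub>HB\<^esub> (cls (scalar (complex_of_real (coroot (rootA \<epsilon> i (Suc i)) \<zeta>))) \<otimes>\<^bsub>HB\<^esub> cls (k_tilde \<epsilon> k i (Suc i))))"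
proof -
  let ?c = "scalar (complex_of_real (coroot (rootA \<epsilon> i (Suc i)) \<zeta>)) :: 'v hgen ncpoly" and ?kk = "k_tilde \<epsilon> k i (Suc i)"
  have "rootA \<epsilon> i (Suc i) \<noteq> 0" using root_neq_0[of i "Suc i" "-1"] i by (simp add: rootA_def)
  then have rr: "r (r \<zeta>) = \<zeta>" unfolding r by (rule reflection_reflection)
  have rW: "tgen r \<in> carrier FA" unfolding r by (intro FA_tgen refl_W_B i)
  note F = rW FA_vgen FA_k_tilde[OF i] FA_closed(7)
  have "tgen r * vgen (of_V (r \<zeta>)) - (vgen (of_V (r (r \<zeta>))) * tgen r + scalar (complex_of_real (coroot (rootA \<epsilon> i (Suc i)) (r (r \<zeta>)))) * ?kk) \<in> rels"
    unfolding rels_def cross_rels_def r Suc_eq_plus1 using i by blast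
  then have "cls (tgen r * vgen (of_V (r \<zeta>))) = cls (vgen (of_V \<zeta>) * tgen r + ?c * ?kk)"
    unfolding rr by (rule cls_rel) (intro FA_closed(1,2) F)+
  then have e: "cls (tgen r) \<otimes>\<^bsub>HB\<^esub> cls (vgen (of_V (r \<zeta>))) =
      cls (vgen (of_V \<zeta>)) \<otimes>\<^bsub>HB\<^esub> cls (tgen r) \<oplus>\<^bsub>HB\<^esub> cls ?c \<otimes>\<^bsub>HB\<^esub> cls ?kk"
    by (simp only: cls_ops(1,2) F FA_closed(2))
  have "cls (vgen (of_V \<zeta>)) \<otimes>\<^bsub>HB\<^esub> cls (tgen r) \<in> carrier HB" "cls ?c \<otimes>\<^bsub>HB\<^esub> cls ?kk \<in> carrier HB"
    by (intro HB.m_closed cls_in F)+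
  then show ?thesis unfolding e by (simp add: HB.a_assoc HB.r_neg)
qed

text \<open>The vector is moved to the right past one adjacent transposition after the other,
  until it meets the tensor sign. The corrections lie in the group algebra, which is known to
  preserve normal forms.\<close>

lemma span_stable_vgen_real: "span_stable (cls (vgen (of_V \<zeta>)))"
proof (rule span_stableI)
  show "cls (vgen (of_V \<zeta>)) \<in> carrier HB" by (intro cls_in FA_vgen)
  fix p z assume "p permutes {1..n}"
  then show "spanned (frag_of (cls (vgen (of_V \<zeta>)) \<otimes>\<^bsub>HB\<^esub> gw p, z))"
  proof (induction arbitrary: \<zeta> z rule: permutes_adj_induct)
    case id
    have "tgen id - 1 \<in> rels" unfolding rels_def group_rels_def by blast
    then have "cls (tgen id) = cls 1" by (rule cls_rel) (intro FA_tgen W_comp FA_closed)+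
    then have g: "gw id = \<one>\<^bsub>HB\<^esub>" unfolding wp_id cls_ops(3) .
    have v: "cls (vgen (of_V \<zeta>)) \<in> carrier HB" by (intro cls_in FA_vgen)
    have "spanned (frag_of (gw id \<otimes>\<^bsub>HB\<^esub> cls (vgen (of_V \<zeta>)), z))"
      by (intro spanned_move gw_in permutes_id gens_in_A spanned_basis)
    then show ?case unfolding g using v by simp
  next
    case (adj i q)
    define r where "r = reflection (rootA \<epsilon> i (Suc i))"
    have rW: "r \<in> W_B n \<epsilon>" unfolding r_def by (intro refl_W_B adj(1,2))
    have gq: "gw (swp i (Suc i) \<circ> q) = cls (tgen r) \<otimes>\<^bsub>HB\<^esub> gw q"
      using cls_tgen_comp[OF rW wp_W_B[OF adj(3)]] unfolding wp_adj[OF adj(1-3)] r_def by (rule sym)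
    define a where "a = cls (vgen (of_V \<zeta>))"
    define b where "b = cls (tgen r)"
    define v where "v = cls (vgen (of_V (r \<zeta>)))"
    define c where "c = cls (scalar (complex_of_real (coroot (rootA \<epsilon> i (Suc i)) \<zeta>))) \<otimes>\<^bsub>HB\<^esub> cls (k_tilde \<epsilon> k i (Suc i))"
    have in1: "a \<in> carrier HB" "b \<in> carrier HB" "v \<in> carrier HB" "c \<in> carrier HB" "gw q \<in> carrier HB"
      unfolding a_def b_def v_def c_def
      by (intro HB.m_closed cls_in FA_vgen FA_tgen rW FA_closed(7) FA_k_tilde adj(1,2) gw_in[OF adj(3)])+
    have e: "a \<otimes>\<^bsub>HB\<^esub> b = b \<otimes>\<^bsub>HB\<^esub> v \<oplus>\<^bsub>HB\<^esub> (\<ominus>\<^bsub>HB\<^esub> c)"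
      unfolding a_def b_def v_def c_def by (rule cls_vgen_refl[OF adj(1,2) r_def])
    have "a \<otimes>\<^bsub>HB\<^esub> gw (swp i (Suc i) \<circ> q) = (a \<otimes>\<^bsub>HB\<^esub> b) \<otimes>\<^bsub>HB\<^esub> gw q"
      unfolding gq b_def[symmetric] using in1 by (simp only: HB.m_assoc)
    also have "\<dots> = b \<otimes>\<^bsub>HB\<^esub> (v \<otimes>\<^bsub>HB\<^esub> gw q) \<oplus>\<^bsub>HB\<^esub> (\<ominus>\<^bsub>HB\<^esub> (c \<otimes>\<^bsub>HB\<^esub> gw q))"
      unfolding e using in1 by (simp add: HB.l_distr HB.m_assoc HB.l_minus)
    finally have E: "a \<otimes>\<^bsub>HB\<^esub> gw (swp i (Suc i) \<circ> q) = b \<otimes>\<^bsub>HB\<^esub> (v \<otimes>\<^bsub>HB\<^esub> gw q) \<oplus>\<^bsub>HB\<^esub> (\<ominus>\<^bsub>HB\<^esub> (c \<otimes>\<^bsub>HB\<^esub> gw q))" .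
    have g1: "spanned (frag_of (b \<otimes>\<^bsub>HB\<^esub> (v \<otimes>\<^bsub>HB\<^esub> gw q), z))"
      unfolding b_def v_def by (intro span_stable_frag span_stable_tgen rW adj(4))
    have "spanned (frag_of (c \<otimes>\<^bsub>HB\<^esub> gw q, z))"
      unfolding c_def by (intro span_stable_frag span_stable_mult span_stable_scalar span_stable_k_tilde spanned_basis adj(1,2,3))
    then have g2: "spanned (frag_of (\<ominus>\<^bsub>HB\<^esub> (c \<otimes>\<^bsub>HB\<^esub> gw q), z))"
      using in1 by (intro spanned_frag_uminus HB.m_closed)
    show ?case
      unfolding a_def[symmetric] E using in1 by (intro spanned_frag_add g1 g2 HB.m_closed HB.a_inv_closed)
  qed
qed

lemma span_stable_vgen: "span_stable (cls (vgen \<zeta>))"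
proof -
  let ?a = "of_V (fst \<zeta>)" and ?b = "of_V (snd \<zeta>)"
  have z: "\<zeta> = ?a + scaleC \<i> ?b"
    by (cases \<zeta>) (simp add: of_V_def scaleC_def)
  have "vgen (?a + scaleC \<i> ?b) - (vgen ?a + vgen (scaleC \<i> ?b)) \<in> rels"
    unfolding rels_def sym_rels_def by blast
  then have 1: "cls (vgen (?a + scaleC \<i> ?b)) = cls (vgen ?a + vgen (scaleC \<i> ?b))"
    by (rule cls_rel) (intro FA_closed(1) FA_vgen)+
  have "vgen (scaleC \<i> ?b) - scalar \<i> * vgen ?b \<in> rels"
    unfolding rels_def sym_rels_def by blast
  then have 2: "cls (vgen (scaleC \<i> ?b)) = cls (scalar \<i> * vgen ?b)"
    by (rule cls_rel) (intro FA_closed(2,7) FA_vgen)+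
  have "cls (vgen \<zeta>) = cls (vgen ?a) \<oplus>\<^bsub>HB\<^esub> cls (scalar \<i>) \<otimes>\<^bsub>HB\<^esub> cls (vgen ?b)"
    by (subst z, unfold 1) (simp only: cls_ops(1) FA_vgen 2 cls_ops(2) FA_closed(7))
  then show ?thesis
    using span_stable_add[OF span_stable_vgen_real span_stable_mult[OF span_stable_scalar span_stable_vgen_real]] by metis
qed

lemma span_stable_all:
  assumes "h \<in> carrier HB"
  shows "span_stable h"
proof -
  obtain p where p: "h = cls p" "p \<in> carrier FA" using assms unfolding carrier_HB by blast
  have "span_stable (cls p)"
    using p(2)
  proof (induction rule: ncpoly_induct)
    case (gen g)
    then consider \<zeta> where "g = Vec \<zeta>" | w where "g = Grp w" "w \<in> W_B n \<epsilon>" unfolding hecke_gens_def by blast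
    then show ?case by cases (simp_all only: span_stable_vgen span_stable_tgen)
  next
    case (add p q)
    show ?case unfolding cls_ops(1)[OF add(1,2)] by (rule span_stable_add[OF add(3,4)])
  next
    case (mult p q)
    show ?case unfolding cls_ops(2)[OF mult(1,2)] by (rule span_stable_mult[OF mult(3,4)])
  qed (rule span_stable_scalar)
  then show ?thesis by (simp only: p(1))
qed

text \<open>Every \<open>y \<otimes> z\<close> is obtained from the normal form \<open>1
  \<otimes> z\<close> by the action of \<open>y\<close>.\<close>

lemma spanned_all: "c \<in> carrier ind.F \<Longrightarrow> spanned c"
proof (induction rule: ind.F_induct)
  case (of y z)
  have "cls (tgen id) = \<one>\<^bsub>HB\<^esub>"
    unfolding cls_ops(3)[symmetric]
    by (rule cls_rel) (unfold rels_def group_rels_def, blast, (intro FA_tgen W_comp FA_closed)+)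
  then have g: "gw id = \<one>\<^bsub>HB\<^esub>" unfolding wp_id .
  have "spanned (frag_of (y \<otimes>\<^bsub>HB\<^esub> gw id, z))"
    by (intro span_stable_frag span_stable_all of spanned_basis permutes_id)
  then show ?case unfolding g using of by simp
next
  case (diff c d)
  show ?case using spanned_add[OF diff(3) spanned_uminus[OF diff(4)]] by simp
qed (rule spanned_0)

end

section \<open>The principal series and the model\<close>

context hecke_data
begin

abbreviation PS where "PS \<equiv> principal_series n \<epsilon> k chi"

lemma PS_eq: "PS = ind.M"
  by (simp add: principal_series_def)

lemma psi_chi: "a \<in> A \<Longrightarrow> rho a (delta id) = cmul (chi a) (delta id)"
  using rho_A tensor_char_eq by simp

lemma Phi_ex:
  "\<exists>\<Phi>. (\<forall>h\<in>carrier HB. \<forall>z. \<Phi> (frag_of (h, z)) = cmul z (rho h (delta id))) \<and>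
    (\<forall>c\<in>carrier ind.F. \<forall>d\<in>carrier ind.F. \<Phi> (c + d) = \<Phi> c + \<Phi> d) \<and> (\<forall>c\<in>ind.K. \<Phi> c = 0)"
proof -
  let ?f = "\<lambda>h z. cmul z (rho h (delta id))"
  have 1: "?f (h \<oplus>\<^bsub>HB\<^esub> h') z = ?f h z + ?f h' z" if "h \<in> carrier HB" "h' \<in> carrier HB" for h h' z
    using that by (simp only: rho_ops(1) cmul_simps)
  have 2: "?f h (z + w) = ?f h z + ?f h w" if "h \<in> carrier HB" for h z w
    by (rule cmul_add_left)
  have 3: "?f (h \<otimes>\<^bsub>HB\<^esub> a) z = ?f h (chi a * z)" if h: "h \<in> carrier HB" "a \<in> A" for h a z
  proof -
    have a: "a \<in> carrier HB" using h(2) A_sub by blast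
    show ?thesis
      unfolding rho_ops(2)[OF h(1) a] psi_chi[OF h(2)] lin_cm[OF rho_ops(4)[OF h(1)]] cmul_simps
      by (simp only: mult.commute)
  qed
  show ?thesis
    by (rule ind.universal[of ?f]) (fact 1 2 3)+
qed

text \<open>The map \<open>h \<otimes> z \<mapsto> z h \<delta>\<close>, where
  \<open>\<delta>\<close> is \<open>delta id\<close>, is well defined on the principal series
  because \<open>\<delta>\<close> has the weight \<open>\<gamma> \<otimes> \<mu>\<close>. It is
  an isomorphism: \<open>Psi\<close> is a section of it, and by \<open>spanned_all\<close> every
  tensor is congruent to a value of \<open>Psi\<close>, so that the kernel consists of balancing
  relations. Submodules and invariant subspaces then correspond to each other.\<close>

theorem simple_iff_model:
  "simple_module HB PS \<longleftrightarrow> simple_model n k lam nu"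
proof -
  obtain \<Phi> where \<Phi>: "(\<forall>h\<in>carrier HB. \<forall>z. \<Phi> (frag_of (h, z)) = cmul z (rho h (delta id))) \<and>
      (\<forall>c\<in>carrier ind.F. \<forall>d\<in>carrier ind.F. \<Phi> (c + d) = \<Phi> c + \<Phi> d) \<and> (\<forall>c\<in>ind.K. \<Phi> c = 0)"
    using Phi_ex by blast
  have val: "\<Phi> (frag_of (h, z)) = cmul z (rho h (delta id))" if "h \<in> carrier HB" for h z
    using \<Phi> that by blast
  have add: "\<Phi> (c + d) = \<Phi> c + \<Phi> d" if "c \<in> carrier ind.F" "d \<in> carrier ind.F" for c d
    using \<Phi> that by blast
  have K0: "\<Phi> c = 0" if "c \<in> ind.K" for c
    using \<Phi> that by blast
  have zero: "\<Phi> 0 = 0" by (rule K0[OF ind.K_0])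
  have diff: "\<Phi> (c - d) = \<Phi> c - \<Phi> d" if "c \<in> carrier ind.F" "d \<in> carrier ind.F" for c d
    using add[OF ind.F_diff[OF that] that(2)] by simp
  have equiv: "\<Phi> (ind.L h c) = rho h (\<Phi> c)" if h: "h \<in> carrier HB" and c: "c \<in> carrier ind.F" for h c
    using c
  proof (induction rule: ind.F_induct)
    case zero
    show ?case unfolding ind.L_0 \<open>\<Phi> 0 = 0\<close> lin_0[OF rho_ops(4)[OF h]] ..
  next
    case (diff c d)
    show ?case
      unfolding ind.L_diff \<open>\<And>d c. c \<in> carrier ind.F \<Longrightarrow> d \<in> carrier ind.F \<Longrightarrow> \<Phi> (c - d) = \<Phi> c - \<Phi> d\<close>[OF ind.L_F[OF h diff(1)] ind.L_F[OF h diff(2)]]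
        \<open>\<And>d c. c \<in> carrier ind.F \<Longrightarrow> d \<in> carrier ind.F \<Longrightarrow> \<Phi> (c - d) = \<Phi> c - \<Phi> d\<close>[OF diff(1,2)]
        diff(3,4) lin_diff[OF rho_ops(4)[OF h]] ..
  next
    case (of y z)
    show ?case
      unfolding ind.L_of val[OF of] val[OF HB.m_closed[OF h of]] rho_ops(2)[OF h of] lin_cm[OF rho_ops(4)[OF h]] ..
  qed
  have supp: "\<Phi> c \<in> supp n" if "c \<in> carrier ind.F" for c
    using that
  proof (induction rule: ind.F_induct)
    case zero
    show ?case unfolding \<open>\<Phi> 0 = 0\<close> by (rule supp_0)
  next
    case (diff c d)
    show ?case
      unfolding \<open>\<And>d c. c \<in> carrier ind.F \<Longrightarrow> d \<in> carrier ind.F \<Longrightarrow> \<Phi> (c - d) = \<Phi> c - \<Phi> d\<close>[OF diff(1,2)]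
      by (rule invsub_diff[OF supp_inv diff(3,4)])
  next
    case (of y z)
    show ?case unfolding val[OF of]
      by (intro supp_cmul invsub_rho[OF supp_inv of] supp_delta permutes_id)
  qed
  have Psi: "\<Phi> (Psi g) = g" if "g \<in> supp n" for g
  proof -
    have "\<Phi> (\<Sum>p\<in>B. frag_of (gw p, g p)) = (\<Sum>p\<in>B. cmul (g p) (delta p))"
      if "finite B" "B \<subseteq> {p. p permutes {1..n}}" for B
      using that
    proof (induction B)
      case (insert p B)
      then have p: "p permutes {1..n}" by blast
      have "\<Phi> (frag_of (gw p, g p)) = cmul (g p) (delta p)"
        unfolding val[OF gw_in[OF p]] rho_gens(3)[OF wp_W_B[OF p]] Wop_wp[OF p] Sop_delta[OF p permutes_id] comp_id ..
      moreover have "(\<Sum>p\<in>B. frag_of (gw p, g p)) \<in> carrier ind.F"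
        using insert by (intro F_sum ind.F_of gw_in) blast
      ultimately show ?case
        using insert add[OF ind.F_of[OF gw_in[OF p]]] by (simp only: sum.insert insert_subset simp_thms)
    qed (simp only: sum.empty zero)
    then show ?thesis
      unfolding Psi_def using supp_expand[OF that] finite_permutations[of "{1..n}"] by simp
  qed
  have ker: "c \<in> ind.K" if ker_asm: "c \<in> carrier ind.F" "\<Phi> c = 0" for c
  proof -
    obtain g where g: "g \<in> supp n" "c - Psi g \<in> ind.K"
      using spanned_all[OF ker_asm(1)] by (auto simp: spanned_def)
    have "\<Phi> c - g = 0" using K0[OF g(2)] diff[OF ker_asm(1) Psi_F] Psi[OF g(1)] by metis
    then have "g = 0" using ker_asm(2) by simp
    then show ?thesis using ind.K_add[OF g(2) Psi_0_K] by simp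
  qed
  have cl_iff: "ind.cl c = ind.cl d \<longleftrightarrow> \<Phi> c = \<Phi> d" if "c \<in> carrier ind.F" "d \<in> carrier ind.F" for c d
    unfolding ind.cl_eq_iff using ker[OF ind.F_diff[OF that]] K0[of "c - d"] diff[OF that] by auto
  interpret M: abelian_group ind.M by (rule ind.abelian_group_M)
  have lm: "left_module HB ind.M" by (rule ind.left_module_M)
  have ne: "carrier ind.M \<noteq> {\<zero>\<^bsub>ind.M\<^esub>}"
  proof
    assume "carrier ind.M = {\<zero>\<^bsub>ind.M\<^esub>}"
    then have "ind.cl (Psi (delta id)) = ind.cl 0"
      unfolding ind.M_carrier ind.M_zero using Psi_F by blast
    then have "\<Phi> (Psi (delta id)) = \<Phi> 0" using cl_iff[OF Psi_F ind.F_0] by simp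
    then have "delta id = 0" using Psi[OF supp_delta[OF permutes_id]] zero by simp
    then have "delta id id = 0" by simp
    then show False by (simp add: delta_def)
  qed
  show ?thesis
  proof
    assume "simple_module HB PS"
    then have simple: "N = {\<zero>\<^bsub>ind.M\<^esub>} \<or> N = carrier ind.M" if "submodule N HB ind.M" for N
      using that unfolding simple_module_def PS_eq by blast
    show "simple_model n k lam nu"
      unfolding simple_model_def
    proof (intro allI impI)
      fix N1 assume N1: "invsub n k lam nu N1"
      define N where "N = ind.cl ` {c \<in> carrier ind.F. \<Phi> c \<in> N1}"
      have memb: "ind.cl c \<in> N \<longleftrightarrow> \<Phi> c \<in> N1" if c: "c \<in> carrier ind.F" for c
      proof
        assume "ind.cl c \<in> N"
        then obtain d where d: "ind.cl c = ind.cl d" "d \<in> carrier ind.F" "\<Phi> d \<in> N1"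
          unfolding N_def by blast
        then show "\<Phi> c \<in> N1" using cl_iff[OF c d(2)] by metis
      next
        assume "\<Phi> c \<in> N1"
        then show "ind.cl c \<in> N" unfolding N_def using c by blast
      qed
      have sub: "N \<subseteq> carrier ind.M" unfolding N_def ind.M_carrier by blast
      have "submodule N HB ind.M"
      proof (intro submodule.intro submodule_axioms.intro)
        show "subgroup N (add_monoid ind.M)"
        proof (rule M.add.subgroupI)
          have "ind.cl 0 \<in> N" using memb[OF ind.F_0] zero invsubD(2)[OF N1] by simp
          then show "N \<noteq> {}" by blast
          fix m assume m: "m \<in> N"
          then obtain c where c: "m = ind.cl c" "c \<in> carrier ind.F" "\<Phi> c \<in> N1" unfolding N_def by blast
          have nc: "- c \<in> carrier ind.F" "\<Phi> (- c) = - \<Phi> c"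
            using ind.F_diff[OF ind.F_0 c(2)] diff[OF ind.F_0 c(2)] zero by simp_all
          have "ind.cl (- c) \<oplus>\<^bsub>ind.M\<^esub> m = \<zero>\<^bsub>ind.M\<^esub>"
            unfolding c(1) ind.M_add[OF nc(1) c(2)] ind.M_zero by simp
          then have "\<ominus>\<^bsub>ind.M\<^esub> m = ind.cl (- c)"
            using M.minus_equality[of "ind.cl (- c)" m] m sub nc(1) unfolding ind.M_carrier by blast
          moreover have "- \<Phi> c \<in> N1" using invsubD(4)[OF N1 c(3), of "-1"] by (simp only: cmul_minus1)
          ultimately show "\<ominus>\<^bsub>ind.M\<^esub> m \<in> N" using memb[OF nc(1)] nc(2) by simp
          fix m' assume "m' \<in> N"
          then obtain d where d: "m' = ind.cl d" "d \<in> carrier ind.F" "\<Phi> d \<in> N1" unfolding N_def by blast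
          show "m \<oplus>\<^bsub>ind.M\<^esub> m' \<in> N"
            unfolding c(1) d(1) ind.M_add[OF c(2) d(2)] memb[OF ind.F_add[OF c(2) d(2)]] add[OF c(2) d(2)]
            by (rule invsubD(3)[OF N1 c(3) d(3)])
        qed (rule sub)
      next
        fix h m assume h: "h \<in> carrier HB" and "m \<in> N"
        then obtain c where c: "m = ind.cl c" "c \<in> carrier ind.F" "\<Phi> c \<in> N1" unfolding N_def by blast
        show "h \<odot>\<^bsub>ind.M\<^esub> m \<in> N"
          unfolding c(1) ind.M_smult[OF h c(2)] memb[OF ind.L_F[OF h c(2)]] equiv[OF h c(2)]
          by (rule invsub_rho[OF N1 h c(3)])
      qed
      from simple[OF this] show "N1 = {0} \<or> N1 = supp n"
      proof
        assume N: "N = {\<zero>\<^bsub>ind.M\<^esub>}"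
        have "f = 0" if "f \<in> N1" for f
        proof -
          have f: "f \<in> supp n" using that invsubD(1)[OF N1] by blast
          have "ind.cl (Psi f) \<in> N" using memb[OF Psi_F] Psi[OF f] that by simp
          then have "ind.cl (Psi f) = ind.cl 0" unfolding N ind.M_zero by simp
          then show ?thesis using cl_iff[OF Psi_F ind.F_0] Psi[OF f] zero by simp
        qed
        then show ?thesis using invsubD(2)[OF N1] by blast
      next
        assume N: "N = carrier ind.M"
        have "f \<in> N1" if "f \<in> supp n" for f
        proof -
          have "ind.cl (Psi f) \<in> N" unfolding N ind.M_carrier using Psi_F by blast
          then show ?thesis using memb[OF Psi_F] Psi[OF that] by simp
        qed
        then show ?thesis using invsubD(1)[OF N1] by blast
      qed
    qed
  next
    assume S: "simple_model n k lam nu"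
    show "simple_module HB PS"
      unfolding simple_module_def PS_eq
    proof (intro conjI allI impI lm ne)
      fix N assume "submodule N HB ind.M"
      then interpret N: submodule N HB ind.M .
      have sub: "N \<subseteq> carrier ind.M" using N.subset by simp
      define N1 where "N1 = \<Phi> ` {c \<in> carrier ind.F. ind.cl c \<in> N}"
      have N1I: "\<Phi> c \<in> N1" if "c \<in> carrier ind.F" "ind.cl c \<in> N" for c
        unfolding N1_def by (intro imageI CollectI conjI that)
      have smult: "rho h f \<in> N1" if "h \<in> carrier HB" "f \<in> N1" for h f
      proof -
        obtain c where c: "f = \<Phi> c" "c \<in> carrier ind.F" "ind.cl c \<in> N" using \<open>f \<in> N1\<close> unfolding N1_def by blast
        have "ind.cl (ind.L h c) \<in> N"
          using N.smult_closed[OF that(1) c(3)] ind.M_smult[OF that(1) c(2)] by simp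
        then show ?thesis
          unfolding c(1) equiv[OF that(1) c(2), symmetric] by (rule N1I[OF ind.L_F[OF that(1) c(2)]])
      qed
      have "invsub n k lam nu N1"
        unfolding invsub_def
      proof (intro conjI ballI allI impI)
        show "N1 \<subseteq> supp n" unfolding N1_def using supp by blast
        have "ind.cl 0 \<in> N" using N.one_closed by (simp add: ind.M_zero)
        then show "0 \<in> N1" using N1I[OF ind.F_0] zero by simp
      next
        fix f g assume "f \<in> N1" "g \<in> N1"
        then obtain c d where c: "f = \<Phi> c" "c \<in> carrier ind.F" "ind.cl c \<in> N"
          and d: "g = \<Phi> d" "d \<in> carrier ind.F" "ind.cl d \<in> N" unfolding N1_def by blast
        have "ind.cl (c + d) \<in> N" using N.m_closed[OF c(3) d(3)] ind.M_add[OF c(2) d(2)] by simp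
        then show "f + g \<in> N1" unfolding c(1) d(1) add[OF c(2) d(2), symmetric] by (rule N1I[OF ind.F_add[OF c(2) d(2)]])
      next
        fix c f assume "f \<in> N1"
        from smult[OF cls_in[OF FA_closed(7)] this] show "cmul c f \<in> N1" unfolding rho_gens(1) .
      next
        fix i f assume "1 \<le> i" "i < n" "f \<in> N1"
        with smult[OF cls_in[OF FA_tgen[OF refl_W_B(2)]], of i f] show "hm.s i f \<in> N1"
          by (simp only: rho_gens(3) refl_W_B(2) Wop_adj)
      next
        fix j f assume j: "1 \<le> j" "j \<le> n" and f: "f \<in> N1"
        have j': "j \<in> {1..n}" using j by simp
        show "hm.x j f \<in> N1" using smult[OF cls_in[OF FA_vgen] f] unfolding rho_gens(2) Vop_eps[OF j', symmetric] .
        show "hm.t j f \<in> N1"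
          using smult[OF cls_in[OF FA_tgen[OF refl_W_B(1)[OF j']]] f]
          unfolding rho_gens(3)[OF refl_W_B(1)[OF j']] Wop_flip[OF j'] .
      qed
      then have "N1 = {0} \<or> N1 = supp n" using S unfolding simple_model_def by blast
      then show "N = {\<zero>\<^bsub>ind.M\<^esub>} \<or> N = carrier ind.M"
      proof
        assume N1: "N1 = {0}"
        have "m = \<zero>\<^bsub>ind.M\<^esub>" if "m \<in> N" for m
        proof -
          have "m \<in> carrier ind.M" using that sub by (rule subsetD[rotated])
          then obtain c where c: "m = ind.cl c" "c \<in> carrier ind.F"
            unfolding ind.M_carrier by (rule imageE)
          have "\<Phi> c \<in> N1" using N1I[OF c(2)] c(1) that by simp
          then have "\<Phi> c = \<Phi> 0" unfolding N1 zero by simp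
          then show ?thesis unfolding c(1) ind.M_zero using cl_iff[OF c(2) ind.F_0] by simp
        qed
        moreover have "\<zero>\<^bsub>ind.M\<^esub> \<in> N" using N.one_closed by simp
        ultimately show ?thesis by blast
      next
        assume N1: "N1 = supp n"
        have "m \<in> N" if "m \<in> carrier ind.M" for m
        proof -
          from that obtain c where c: "m = ind.cl c" "c \<in> carrier ind.F"
            unfolding ind.M_carrier by (rule imageE)
          have "\<Phi> c \<in> N1" unfolding N1 by (rule supp[OF c(2)])
          then obtain d where d: "\<Phi> c = \<Phi> d" "d \<in> carrier ind.F" "ind.cl d \<in> N"
            unfolding N1_def by (elim imageE CollectE conjE)
          then show ?thesis unfolding c(1) using cl_iff[OF c(2) d(2)] by simp
        qed
        then show ?thesis using sub by blast
      qed
    qed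
  qed
qed

lemma simple_iff:
  assumes "k \<noteq> 0" "1 \<le> n"
  shows "simple_module HB PS \<longleftrightarrow>
    (\<forall>a b. 1 \<le> a \<and> a < b \<and> b \<le> n \<and> nu a = nu b \<longrightarrow> (lam a - lam b)\<^sup>2 \<noteq> (2 * k)\<^sup>2)"
  unfolding simple_iff_model by (rule simple_model_iff[OF _ assms]) standard

section \<open>Twisting by the symmetric group\<close>

lemma twist_data:
  assumes w: "w \<in> W_A n \<epsilon>"
  shows "hecke_data n \<epsilon> (twist_V w \<gamma>) (twist_T w \<mu>)"
proof -
  obtain p where p: "signed p (\<lambda>_. 1) w" using W_A_signed[OF w] by blast
  note inv = W_A_inverse[OF w p]
  have lin: "Real_Vector_Spaces.linear (iv w)" using inv(2) by (simp add: signed_def)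
  show ?thesis
  proof
    have 1: "complexify (iv w) (u + v) = complexify (iv w) u + complexify (iv w) v" for u v
      by (cases u; cases v) (simp add: complexify_def linear_add[OF lin])
    have 2: "complexify (iv w) (scaleC c u) = scaleC c (complexify (iv w) u)" for c u
      by (cases u) (simp add: complexify_def scaleC_def linear_add[OF lin] linear_diff[OF lin] linear_scale[OF lin])
    interpret V: vector_space "scaleC :: complex \<Rightarrow> 'v complexified \<Rightarrow> _" by (rule vector_space_scaleC)
    interpret C: vector_space "(*) :: complex \<Rightarrow> complex \<Rightarrow> _" by standard (simp_all add: algebra_simps)
    have "Vector_Spaces.linear scaleC (*) (twist_V w \<gamma>)"
      by unfold_locales (simp_all add: twist_V_def 1 2 \<gamma>_linear)
    then show "twist_V w \<gamma> \<in> dual_VC" by (simp add: dual_VC_def)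
    have conj: "iv w \<circ> u \<circ> w \<in> T_grp n \<epsilon>" if u: "u \<in> T_grp n \<epsilon>" for u
    proof -
      obtain sg where sg: "signed id sg u" using T_signed[OF u] by blast
      have "signed (iv p \<circ> id \<circ> p) (\<lambda>j. 1 * (sg (p j) * 1)) (iv w \<circ> u \<circ> w)"
        using signed_comp[OF signed_comp[OF inv(2) sg] p] by simp
      moreover have "iv p \<circ> id \<circ> p = id" using permutes_inv_o(2)[of p "{1..n}"] p by (simp add: signed_def)
      ultimately show ?thesis using signed_T by metis
    qed
    have "twist_T w \<mu> (u \<circ> v) = twist_T w \<mu> u * twist_T w \<mu> v" if "u \<in> T_grp n \<epsilon>" "v \<in> T_grp n \<epsilon>" for u v
    proof -
      have "iv w \<circ> (u \<circ> v) \<circ> w = (iv w \<circ> u \<circ> w) \<circ> (iv w \<circ> v \<circ> w)"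
        using inv(3) by (metis comp_assoc comp_id)
      then show ?thesis unfolding twist_T_def by (simp only: \<mu>_comp[OF conj[OF that(1)] conj[OF that(2)]])
    qed
    then show "twist_T w \<mu> \<in> T_dual n \<epsilon>"
      using \<mu>_neq_0[OF conj] unfolding T_dual_def hom_def by (auto simp: GL_group_def twist_T_def)
  qed
qed

text \<open>If \<open>w\<close> permutes the basis by \<open>p\<close>, then twisting by
  \<open>w\<close> composes \<open>lam\<close> and \<open>nu\<close> with the inverse of
  \<open>p\<close>.\<close>

lemma twist_values:
  assumes "signed p (\<lambda>_. 1) w" "w \<in> W_A n \<epsilon>" "j \<in> {1..n}"
  shows "twist_V w \<gamma> (of_V (\<epsilon> j)) = lam (iv p j)" "twist_T w \<mu> (reflection (\<epsilon> j)) = nu (iv p j)"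
proof -
  note inv = W_A_inverse[OF assms(2,1)]
  have p: "p permutes {1..n}" using assms(1) by (simp add: signed_def)
  have ij: "iv p j \<in> {1..n}" using permutes_in_image[OF permutes_inv[OF p]] assms(3) by simp
  have e: "iv w (\<epsilon> j) = \<epsilon> (iv p j)" using inv(2) assms(3) by (simp add: signed_def)
  have "iv w 0 = 0" using inv(2) linear_0 by (auto simp: signed_def)
  then show "twist_V w \<gamma> (of_V (\<epsilon> j)) = lam (iv p j)"
    by (simp add: twist_V_def complexify_def of_V_def lam_def e)
  have "signed (iv p \<circ> id \<circ> p) (\<lambda>l. 1 * (flip j (p l) * 1)) (iv w \<circ> reflection (\<epsilon> j) \<circ> w)"
    using signed_comp[OF signed_comp[OF inv(2) signed_flip[OF assms(3)]] assms(1)] by simp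
  moreover have "iv p \<circ> id \<circ> p = id" using permutes_inv_o(2)[OF p] by simp
  moreover have "(\<lambda>l. 1 * (flip j (p l) * 1)) = flip (iv p j)"
  proof
    fix l
    have "p l = j \<longleftrightarrow> l = iv p j" using permutes_inv_eq[OF p, of j l] by auto
    then show "1 * (flip j (p l) * 1) = flip (iv p j) l" by (simp add: flip_def)
  qed
  ultimately have "signed id (flip (iv p j)) (iv w \<circ> reflection (\<epsilon> j) \<circ> w)" by metis
  then have "iv w \<circ> reflection (\<epsilon> j) \<circ> w = reflection (\<epsilon> (iv p j))"
    using signed_flip[OF ij] signed_ext by blast
  then show "twist_T w \<mu> (reflection (\<epsilon> j)) = nu (iv p j)"
    by (simp add: twist_T_def nu_def)
qed

text \<open>Simplicity of the module with parameters \<open>l\<close>, \<open>v\<close>, in a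
  form symmetric in the two indices, hence visibly invariant under permutations.\<close>

definition noncrit :: "(nat \<Rightarrow> complex) \<Rightarrow> (nat \<Rightarrow> complex) \<Rightarrow> bool" where
  "noncrit l v \<longleftrightarrow> (\<forall>a\<in>{1..n}. \<forall>b\<in>{1..n}. a \<noteq> b \<and> v a = v b \<longrightarrow> (l a - l b)\<^sup>2 \<noteq> (2 * k)\<^sup>2)"

lemma noncrit_ordered:
  "noncrit l v \<longleftrightarrow> (\<forall>a b. 1 \<le> a \<and> a < b \<and> b \<le> n \<and> v a = v b \<longrightarrow> (l a - l b)\<^sup>2 \<noteq> (2 * k)\<^sup>2)"
proof
  assume R: "\<forall>a b. 1 \<le> a \<and> a < b \<and> b \<le> n \<and> v a = v b \<longrightarrow> (l a - l b)\<^sup>2 \<noteq> (2 * k)\<^sup>2"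
  show "noncrit l v"
    unfolding noncrit_def
  proof (intro ballI impI)
    fix a b assume ab: "a \<in> {1..n}" "b \<in> {1..n}" "a \<noteq> b \<and> v a = v b"
    then consider "a < b" | "b < a" by linarith
    then show "(l a - l b)\<^sup>2 \<noteq> (2 * k)\<^sup>2"
    proof cases
      case 1
      then show ?thesis using R ab by auto
    next
      case 2
      then have "(l b - l a)\<^sup>2 \<noteq> (2 * k)\<^sup>2" using R ab by auto
      then show ?thesis by (metis power2_commute)
    qed
  qed
qed (auto simp: noncrit_def)

lemma noncrit_cong:
  assumes "\<And>a. a \<in> {1..n} \<Longrightarrow> l a = l' a" "\<And>a. a \<in> {1..n} \<Longrightarrow> v a = v' a"
  shows "noncrit l v \<longleftrightarrow> noncrit l' v'"
  unfolding noncrit_def using assms by (intro ball_cong refl) simp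

lemma noncrit_permute:
  assumes "p permutes {1..n}"
  shows "noncrit (\<lambda>a. l (p a)) (\<lambda>a. v (p a)) \<longleftrightarrow> noncrit l v"
proof -
  have "noncrit (\<lambda>a. l (p a)) (\<lambda>a. v (p a))" if "noncrit l v" "p permutes {1..n}" for p l v
    unfolding noncrit_def
  proof (intro ballI impI)
    fix a b assume "a \<in> {1..n}" "b \<in> {1..n}" "a \<noteq> b \<and> v (p a) = v (p b)"
    moreover from this have "p a \<in> {1..n}" "p b \<in> {1..n}" "p a \<noteq> p b"
      using permutes_in_image[OF that(2)] permutes_inj[OF that(2)] by (auto dest: injD)
    ultimately show "(l (p a) - l (p b))\<^sup>2 \<noteq> (2 * k)\<^sup>2"
      using that(1) unfolding noncrit_def by blast
  qed
  note imp = this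
  show ?thesis
  proof
    assume "noncrit (\<lambda>a. l (p a)) (\<lambda>a. v (p a))"
    from imp[OF this permutes_inv[OF assms]] show "noncrit l v"
      by (simp add: permutes_inverses[OF assms])
  qed (use imp assms in blast)
qed

lemma simple_twist:
  assumes "k \<noteq> 0" "1 \<le> n" and w: "w \<in> W_A n \<epsilon>"
  shows "simple_module HB (principal_series n \<epsilon> k (tensor_char n \<epsilon> k (twist_V w \<gamma>) (twist_T w \<mu>))) \<longleftrightarrow> noncrit lam nu"
proof -
  interpret W: hecke_data n \<epsilon> k "twist_V w \<gamma>" "twist_T w \<mu>" by (rule twist_data[OF w])
  obtain p where p: "signed p (\<lambda>_. 1) w" using W_A_signed[OF w] by blast
  then have pp: "p permutes {1..n}" by (simp add: signed_def)
  have "simple_module HB W.PS \<longleftrightarrow> noncrit W.lam W.nu"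
    unfolding W.simple_iff[OF assms(1,2)] noncrit_ordered ..
  also have "\<dots> \<longleftrightarrow> noncrit (\<lambda>a. lam (iv p a)) (\<lambda>a. nu (iv p a))"
    by (rule noncrit_cong) (simp_all only: W.lam_def W.nu_def twist_values[OF p w])
  also have "\<dots> \<longleftrightarrow> noncrit lam nu"
    by (rule noncrit_permute[OF permutes_inv[OF pp]])
  finally show ?thesis .
qed

section \<open>Sorting the signs\<close>

text \<open>If \<open>p\<close> is the permutation given by \<open>\<sigma>\<close>, then its
  inverse lists first the indices with sign \<open>1\<close> and then those with sign
  \<open>-1\<close>. Hence two indices have equal signs after sorting exactly if both are at
  most \<open>i\<close> or both exceed \<open>i\<close>, which are the pairs occurring in
  \<open>R\<^sub>i\<^sup>+\<close>.\<close>

lemma P_set_iff: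
  assumes i: "i = card (plus_inds n \<epsilon> \<mu>)" and \<sigma>: "is_sorting_element n \<epsilon> \<mu> \<sigma>"
  shows "P_set n \<epsilon> k i (twist_V \<sigma> \<gamma>) = {} \<longleftrightarrow> noncrit lam nu"
proof -
  have w: "\<sigma> \<in> W_A n \<epsilon>" using \<sigma> by (simp add: is_sorting_element_def)
  interpret W: hecke_data n \<epsilon> k "twist_V \<sigma> \<gamma>" "twist_T \<sigma> \<mu>" by (rule twist_data[OF w])
  obtain p where p: "signed p (\<lambda>_. 1) \<sigma>" using W_A_signed[OF w] by blast
  then have pp: "p permutes {1..n}" by (simp add: signed_def)
  let ?q = "iv p"
  have qp: "?q permutes {1..n}" by (rule permutes_inv[OF pp])
  let ?P = "plus_inds n \<epsilon> \<mu>" and ?N = "minus_inds n \<epsilon> \<mu>"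
  have P: "?P = {j \<in> {1..n}. nu j = 1}" and N: "?N = {j \<in> {1..n}. nu j = -1}"
    by (simp_all add: plus_inds_def minus_inds_def nu_def)
  have fin: "finite ?P" "finite ?N" by (auto simp: P N)
  have un: "?P \<union> ?N = {1..n}" using nu_pm1 unfolding P N by blast
  have dis: "?P \<inter> ?N = {}" unfolding P N by auto
  have len: "length (sorted_inds n \<epsilon> \<mu>) = n"
    using card_Un_disjoint[OF fin dis] un by (simp add: sorted_inds_def)
  have i_n: "i \<le> n" using card_mono[of "{1..n}" ?P] un i by auto
  have nth_in: "sorted_inds n \<epsilon> \<mu> ! (a - 1) \<in> (if a \<le> i then ?P else ?N)" if "a \<in> {1..n}" for a
  proof (cases "a \<le> i")
    case True
    then have "a - 1 < length (sorted_list_of_set ?P)" using that i by (simp, linarith)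
    then show ?thesis using True nth_mem[of "a - 1" "sorted_list_of_set ?P"] fin
      by (simp add: sorted_inds_def nth_append)
  next
    case False
    then have "\<not> a - 1 < length (sorted_list_of_set ?P)" using that i by auto
    moreover have "a - 1 - length (sorted_list_of_set ?P) < length (sorted_list_of_set ?N)"
      using len that False i by (auto simp: sorted_inds_def)
    ultimately show ?thesis using False nth_mem[of "a - 1 - card ?P" "sorted_list_of_set ?N"] fin
      by (simp add: sorted_inds_def nth_append)
  qed
  have q_eq: "?q a = sorted_inds n \<epsilon> \<mu> ! (a - 1)" if a: "a \<in> {1..n}" for a
  proof -
    let ?j = "sorted_inds n \<epsilon> \<mu> ! (a - 1)"
    have j: "?j \<in> {1..n}" using nth_in[OF a] un by (auto split: if_splits)
    have "\<sigma> (\<epsilon> ?j) = \<epsilon> a" using \<sigma> a by (simp add: is_sorting_element_def)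
    moreover have "\<sigma> (\<epsilon> ?j) = \<epsilon> (p ?j)" using p j by (simp add: signed_def)
    ultimately have "1 *\<^sub>R \<epsilon> (p ?j) = 1 *\<^sub>R \<epsilon> a" by simp
    then have "p ?j = a" using eps_inj[of "p ?j" a 1 1] permutes_in_image[OF pp, of ?j] j a by simp
    then show ?thesis using permutes_inverses(2)[OF pp, of ?j] by simp
  qed
  have nu_q: "nu (?q a) = (if a \<le> i then 1 else -1)" if "a \<in> {1..n}" for a
    using nth_in[OF that] unfolding q_eq[OF that] P N by (auto split: if_splits)
  have val: "twist_V \<sigma> \<gamma> (of_V (rootA \<epsilon> a b)) = lam (?q a) - lam (?q b)" if "a \<in> {1..n}" "b \<in> {1..n}" for a b
  proof -
    have "of_V (rootA \<epsilon> a b) = of_V (\<epsilon> a) + scaleC (-1) (of_V (\<epsilon> b))"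
      by (simp add: of_V_def rootA_def scaleC_def)
    then have "twist_V \<sigma> \<gamma> (of_V (rootA \<epsilon> a b)) = twist_V \<sigma> \<gamma> (of_V (\<epsilon> a)) - twist_V \<sigma> \<gamma> (of_V (\<epsilon> b))"
      by (simp only: W.\<gamma>_linear) simp
    then show ?thesis using twist_values(1)[OF p w] that by simp
  qed
  have root_eq: "a = c \<and> b = d" if "rootA \<epsilon> a b = rootA \<epsilon> c d" "a \<in> {1..n}" "b \<in> {1..n}" "c \<in> {1..n}" "d \<in> {1..n}" "a \<noteq> b" "c \<noteq> d" for a b c d
  proof -
    have ip: "inner (rootA \<epsilon> a b) (\<epsilon> l) = (if a = l then 1 else 0) - (if b = l then 1 else 0)"
      "inner (rootA \<epsilon> c d) (\<epsilon> l) = (if c = l then 1 else 0) - (if d = l then 1 else 0)" if "l \<in> {1..n}" for l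
      using that \<open>a \<in> {1..n}\<close> \<open>b \<in> {1..n}\<close> \<open>c \<in> {1..n}\<close> \<open>d \<in> {1..n}\<close> by (simp_all add: rootA_def inner_diff_left inner_eps)
    have e: "(if a = l then 1 else 0) - (if b = l then 1 else 0) = ((if c = l then 1 else 0) - (if d = l then 1 else 0) :: real)"
      if "l \<in> {1..n}" for l
      using ip[OF that] \<open>rootA \<epsilon> a b = rootA \<epsilon> c d\<close> by metis
    have "c = a"
      using e[OF \<open>a \<in> {1..n}\<close>] \<open>a \<noteq> b\<close> by (cases "c = a"; cases "d = a") simp_all
    moreover have "d = b"
      using e[OF \<open>b \<in> {1..n}\<close>] \<open>a \<noteq> b\<close> by (cases "c = b"; cases "d = b") simp_all
    ultimately show ?thesis by simp
  qed
  have roots: "R_sub n \<epsilon> i \<inter> R_A_pos n \<epsilon> =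
     {rootA \<epsilon> a b | a b. 1 \<le> a \<and> a < b \<and> b \<le> n \<and> (b \<le> i \<or> i < a)}"
  proof (intro equalityI subsetI)
    fix \<alpha> assume "\<alpha> \<in> R_sub n \<epsilon> i \<inter> R_A_pos n \<epsilon>"
    then obtain e a b c d where e: "\<alpha> = e *\<^sub>R rootA \<epsilon> a b" "e = 1 \<or> e = -1"
        "1 \<le> a \<and> a < b \<and> b \<le> i \<or> i < a \<and> a < b \<and> b \<le> n"
      and c: "\<alpha> = rootA \<epsilon> c d" "c \<in> {1..n}" "d \<in> {1..n}" "c < d"
      unfolding R_sub_def R_A_pos_def by blast
    have ab: "a \<in> {1..n}" "b \<in> {1..n}" "a < b" using e(3) i_n by auto
    \<comment> \<open>\<open>R\<^sub>i\<close> is closed under negation; a negative of a root from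
      its list is not positive because a root determines its pair of indices.\<close>
    have "e = 1"
    proof (rule ccontr)
      assume "e \<noteq> 1"
      then have "rootA \<epsilon> b a = rootA \<epsilon> c d" using e c by (simp add: rootA_def)
      then show False using root_eq[of b a c d] ab c by auto
    qed
    then show "\<alpha> \<in> {rootA \<epsilon> a b | a b. 1 \<le> a \<and> a < b \<and> b \<le> n \<and> (b \<le> i \<or> i < a)}"
      using e ab by auto
  next
    fix \<alpha> assume "\<alpha> \<in> {rootA \<epsilon> a b | a b. 1 \<le> a \<and> a < b \<and> b \<le> n \<and> (b \<le> i \<or> i < a)}"
    then obtain a b where ab: "\<alpha> = rootA \<epsilon> a b" "1 \<le> a" "a < b" "b \<le> n" "b \<le> i \<or> i < a" by blast
    have "\<alpha> = 1 *\<^sub>R rootA \<epsilon> a b" using ab by simp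
    then have "\<alpha> \<in> R_sub n \<epsilon> i" unfolding R_sub_def using ab by blast
    moreover have "\<alpha> \<in> R_A_pos n \<epsilon>" unfolding R_A_pos_def using ab by force
    ultimately show "\<alpha> \<in> R_sub n \<epsilon> i \<inter> R_A_pos n \<epsilon>" by blast
  qed
  have sq: "(y = 2 * k \<or> y = - 2 * k) \<longleftrightarrow> y\<^sup>2 = (2 * k)\<^sup>2" for y
    unfolding power2_eq_iff mult_minus_left ..
  have "P_set n \<epsilon> k i (twist_V \<sigma> \<gamma>) = {} \<longleftrightarrow>
     (\<forall>a b. 1 \<le> a \<and> a < b \<and> b \<le> n \<and> (b \<le> i \<or> i < a) \<longrightarrow> (lam (?q a) - lam (?q b))\<^sup>2 \<noteq> (2 * k)\<^sup>2)"
    unfolding P_set_def roots sq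
  proof
    assume L: "{\<alpha> \<in> {rootA \<epsilon> a b | a b. 1 \<le> a \<and> a < b \<and> b \<le> n \<and> (b \<le> i \<or> i < a)}. (twist_V \<sigma> \<gamma> (of_V \<alpha>))\<^sup>2 = (2 * k)\<^sup>2} = {}"
    show "\<forall>a b. 1 \<le> a \<and> a < b \<and> b \<le> n \<and> (b \<le> i \<or> i < a) \<longrightarrow> (lam (?q a) - lam (?q b))\<^sup>2 \<noteq> (2 * k)\<^sup>2"
    proof (intro allI impI)
      fix a b assume ab: "1 \<le> a \<and> a < b \<and> b \<le> n \<and> (b \<le> i \<or> i < a)"
      then have "(twist_V \<sigma> \<gamma> (of_V (rootA \<epsilon> a b)))\<^sup>2 \<noteq> (2 * k)\<^sup>2" using L by blast
      then show "(lam (?q a) - lam (?q b))\<^sup>2 \<noteq> (2 * k)\<^sup>2" using val[of a b] ab by simp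
    qed
  next
    assume R: "\<forall>a b. 1 \<le> a \<and> a < b \<and> b \<le> n \<and> (b \<le> i \<or> i < a) \<longrightarrow> (lam (?q a) - lam (?q b))\<^sup>2 \<noteq> (2 * k)\<^sup>2"
    show "{\<alpha> \<in> {rootA \<epsilon> a b | a b. 1 \<le> a \<and> a < b \<and> b \<le> n \<and> (b \<le> i \<or> i < a)}. (twist_V \<sigma> \<gamma> (of_V \<alpha>))\<^sup>2 = (2 * k)\<^sup>2} = {}"
    proof (intro equals0I)
      fix \<alpha> assume "\<alpha> \<in> {\<alpha> \<in> {rootA \<epsilon> a b | a b. 1 \<le> a \<and> a < b \<and> b \<le> n \<and> (b \<le> i \<or> i < a)}. (twist_V \<sigma> \<gamma> (of_V \<alpha>))\<^sup>2 = (2 * k)\<^sup>2}"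
      then obtain a b where ab: "1 \<le> a \<and> a < b \<and> b \<le> n \<and> (b \<le> i \<or> i < a)"
        "(twist_V \<sigma> \<gamma> (of_V (rootA \<epsilon> a b)))\<^sup>2 = (2 * k)\<^sup>2" by blast
      then show False using R val[of a b] by auto
    qed
  qed
  also have "\<dots> \<longleftrightarrow> noncrit (\<lambda>a. lam (?q a)) (\<lambda>a. nu (?q a))"
    unfolding noncrit_ordered
  proof (intro iff_allI)
    fix a b
    have "1 \<le> a \<and> a < b \<and> b \<le> n \<and> nu (?q a) = nu (?q b) \<longleftrightarrow> 1 \<le> a \<and> a < b \<and> b \<le> n \<and> (b \<le> i \<or> i < a)"
      using nu_q[of a] nu_q[of b] by (auto split: if_splits)
    then show "(1 \<le> a \<and> a < b \<and> b \<le> n \<and> (b \<le> i \<or> i < a) \<longrightarrow> (lam (?q a) - lam (?q b))\<^sup>2 \<noteq> (2 * k)\<^sup>2) =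
      (1 \<le> a \<and> a < b \<and> b \<le> n \<and> nu (?q a) = nu (?q b) \<longrightarrow> (lam (?q a) - lam (?q b))\<^sup>2 \<noteq> (2 * k)\<^sup>2)"
      by (simp only:)
  qed
  also have "\<dots> \<longleftrightarrow> noncrit lam nu" by (rule noncrit_permute[OF qp])
  finally show ?thesis .
qed

end

theorem mainTheorem1:
  fixes n :: nat and \<epsilon> :: "nat \<Rightarrow> 'v::euclidean_space" and k :: complex
    and \<gamma> :: "'v complexified \<Rightarrow> complex" and \<mu> :: "('v \<Rightarrow> 'v) \<Rightarrow> complex"
    and i :: nat and \<sigma> :: "'v \<Rightarrow> 'v"
  assumes "n \<ge> 2" and "orthonormal_basis n \<epsilon>" and "k \<noteq> 0"
    and "\<gamma> \<in> dual_VC" and "\<mu> \<in> T_dual n \<epsilon>"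
    and "i = card (plus_inds n \<epsilon> \<mu>)" and "is_sorting_element n \<epsilon> \<mu> \<sigma>"
  defines "M \<equiv> \<lambda>\<gamma>' \<mu>'. principal_series n \<epsilon> k (tensor_char n \<epsilon> k \<gamma>' \<mu>')"
  shows "(simple_module (H_B n \<epsilon> k) (M \<gamma> \<mu>) \<longleftrightarrow>
           (\<forall>w\<in>W_A n \<epsilon>. simple_module (H_B n \<epsilon> k) (M (twist_V w \<gamma>) (twist_T w \<mu>)))) \<and>
         (simple_module (H_B n \<epsilon> k) (M \<gamma> \<mu>) \<longleftrightarrow>
           P_set n \<epsilon> k i (twist_V \<sigma> \<gamma>) = {})"
proof -
  interpret hecke_data n \<epsilon> k \<gamma> \<mu>
    by standard (fact assms)+
  have n: "1 \<le> n" using assms(1) by simp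
  have "simple_module HB (M \<gamma> \<mu>) \<longleftrightarrow> noncrit lam nu"
    unfolding M_def simple_iff[OF assms(3) n] noncrit_ordered ..
  moreover have "simple_module HB (M (twist_V w \<gamma>) (twist_T w \<mu>)) \<longleftrightarrow> noncrit lam nu"
    if "w \<in> W_A n \<epsilon>" for w
    unfolding M_def by (rule simple_twist[OF assms(3) n that])
  moreover have "id \<in> W_A n \<epsilon>" by (rule W_comp)
  moreover have "P_set n \<epsilon> k i (twist_V \<sigma> \<gamma>) = {} \<longleftrightarrow> noncrit lam nu"
    by (rule P_set_iff[OF assms(6,7)])
  ultimately show ?thesis by blast
qed

end
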